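(* Let $\zeta^0,\zeta^1\in\mathbb C$ satisfy $e^{2\pi i\zeta^1}=1/(1-e^{2\pi i\zeta^0})$, and let $\mathcal Z:\mathbb C^N\to\mathbb C^N$ be the linear map with $\mathcal Z(\hat v_n)=\sum_{n'=0}^{N-1}\Lambda(\zeta^0,\zeta^1\mid n'-n)\hat v_{n'}$ for the standard basis $\{\hat v_n\}_{n\in\mathbb Z/N}$. Then \[ \det\mathcal Z=\frac{N^N}{D(0)^N}\,\omega^{N(N-1)\zeta^0/2}\exp\Big(-\frac{\mathcal L(\zeta^0,\zeta^1)}{2\pi i}\Big). \]
   Context: $N\ge2$, $\omega=e^{2\pi i/N}$, $\omega^x=e^{2\pi ix/N}$; principal branch of $\log$. $\Lambda(\zeta)=\Phi_{\sqrt N}(i\zeta/\sqrt N-\frac i2(\sqrt N+1/\sqrt N)+i/\sqrt N)$ with Faddeev's $\Phi_{\mathsf b}(z)=\exp\int_{\mathbb R+i0}\frac{e^{-2izw}}{4\sinh(w\mathsf b)\sinh(w/\mathsf b)}\frac{dw}w$; $\Lambda(\zeta^0,\zeta^1\mid n)=\omega^{-\zeta^0\zeta^1/2}\omega^{-n\zeta^1}\Lambda(\zeta^0+n)$. $D(0)=\exp\big(\frac1N\sum_{k=1}^{N-1}k\log(1-\omega^k)\big)$. $\mathcal L(\zeta^0,\zeta^1)=\operatorname{Li}_2(e^{2\pi i\zeta^0})+\frac{(2\pi i)^2}2\zeta^0\zeta^1+2\pi i\zeta^0\log(1-e^{2\pi i\zeta^0})$, $\operatorname{Li}_2(z)=-\int_0^z\frac{\log(1-t)}t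 dt$. *)

theory Defs
  imports "HOL-Complex_Analysis.Complex_Analysis" "Jordan_Normal_Form.Determinant"
begin

definition omega_pow :: "nat \<Rightarrow> complex \<Rightarrow> complex" where
  "omega_pow N x = exp (2 * of_real pi * \<i> * x / of_nat N)"

definition c_b :: "real \<Rightarrow> real" where
  "c_b b = (b + 1 / b) / 2"

definition faddeev_integrand :: "real \<Rightarrow> complex \<Rightarrow> complex \<Rightarrow> complex" where
  "faddeev_integrand b z w =
     exp (- 2 * \<i> * z * w) / (4 * sinh (w * of_real b) * sinh (w / of_real b)) / w"

text \<open>The integral over R + i0: integral along the line Im w = eps, eps tending to 0 from above.\<close>
definition faddeev_strip :: "real \<Rightarrow> complex \<Rightarrow> complex" where
  "faddeev_strip b z =
     exp (Lim (at_right 0) (\<lambda>eps::real.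
        integral UNIV (\<lambda>t::real. faddeev_integrand b z (of_real t + \<i> * of_real eps))))"

text \<open>Faddeev's quantum dilogarithm: the (unique) meromorphic continuation to C of the
  integral formula valid in the strip |Im z| < c_b (value 0 at poles, by convention).\<close>
definition faddeev :: "real \<Rightarrow> complex \<Rightarrow> complex" where
  "faddeev b = (THE F. F nicely_meromorphic_on UNIV \<and>
                   (\<forall>z. \<bar>Im z\<bar> < c_b b \<longrightarrow> F z = faddeev_strip b z))"

definition Lambda :: "nat \<Rightarrow> complex \<Rightarrow> complex" where
  "Lambda N \<zeta> = faddeev (sqrt (real N))
      (\<i> * \<zeta> / of_real (sqrt (real N))
       - \<i> / 2 * of_real (sqrt (real N) + 1 / sqrt (real N))
       + \<i> / of_real (sqrt (real N)))"

definition Lambda3 :: "nat \<Rightarrow> complex \<Rightarrow> complex \<Rightarrow> int \<Rightarrow> complex" where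
  "Lambda3 N z0 z1 n =
     omega_pow N (- z0 * z1 / 2) * omega_pow N (- of_int n * z1) * Lambda N (z0 + of_int n)"

definition D0 :: "nat \<Rightarrow> complex" where
  "D0 N = exp (1 / of_nat N * (\<Sum>k=1..N-1. of_nat k * Ln (1 - omega_pow N (of_nat k))))"

definition Li2 :: "complex \<Rightarrow> complex" where
  "Li2 z = - contour_integral (linepath 0 z) (\<lambda>t. Ln (1 - t) / t)"

definition calL :: "complex \<Rightarrow> complex \<Rightarrow> complex" where
  "calL z0 z1 = Li2 (exp (2 * of_real pi * \<i> * z0))
      + (2 * of_real pi * \<i>)\<^sup>2 / 2 * z0 * z1
      + 2 * of_real pi * \<i> * z0 * Ln (1 - exp (2 * of_real pi * \<i> * z0))"

end

theory Submission
  imports Defs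
begin

text \<open>
  For \<open>b\<^sup>2 = N\<close> write \<open>\<Lambda> = exp I\<close> on the strip \<open>-1 < Re \<zeta> < N\<close>. The integrand of \<open>I'\<close> is quasi-periodic under
  \<open>w \<mapsto> w + \<pi>i\<close> with factor \<open>x = exp (2\<pi>i\<zeta>)\<close>, so a contour shift evaluates \<open>(1 - x) I'\<close> by residues as an elementary
  function. Comparing logarithmic derivatives and the limit \<open>\<Lambda> \<rightarrow> 1\<close> for \<open>Im \<zeta> \<rightarrow> \<infinity>\<close> gives
  \<open>\<Lambda>(\<zeta>) = (1 - \<omega>\<^bsup>\<zeta>+1\<^esup>) \<Lambda>(\<zeta>+1)\<close> and \<open>\<Lambda>(\<zeta>) = (1 - x) \<Lambda>(\<zeta>+N)\<close>; the second equation also yields the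
  meromorphic continuation. Hence the matrix is circulant, and its determinant is the product of the sums
  \<open>S\<^sub>k = \<Sum>\<^sub>n (\<omega>\<^sup>k u)\<^sup>n \<Lambda>(\<zeta>+n)\<close> with \<open>u\<^sup>N = 1 - x\<close>. The first equation gives \<open>\<omega>\<^sup>\<zeta> S\<^bsub>k+1\<^esub> = (1 - \<omega>\<^sup>k u) S\<^sub>k\<close>, and with
  it \<open>S\<^sub>0\<close> satisfies a first-order linear differential equation whose solution, normalised at \<open>Im \<zeta> \<rightarrow> \<infinity>\<close>, is
  \<open>S\<^sub>0\<^sup>N = N\<^sup>N D(0)\<^bsup>-N\<^esup> (\<Prod>\<^sub>i (1 - \<omega>\<^sup>i u)\<^sup>i) exp (- Li\<^sub>2(x) / 2\<pi>i - \<zeta> log (1 - x))\<close>.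
\<close>

text \<open>The factor 1/w in the integrand of I blocks a direct shift by one period.
  Differentiation in \<zeta> removes it, which is why derivatives are computed and each identity is
  integrated afterwards. Their derivation divides by 1 - x, so it runs between consecutive integral
  values of Re \<zeta>. Differentiating S_0 produces every S_j. The recurrence turns each into a
  multiple of S_0, and a polynomial identity in u recognises the resulting coefficient as a
  logarithmic derivative. The remaining difficulty is the branches. For -1 < Re \<zeta> < 0 all N
  values of \<Lambda> lie in the strip of the integral and x avoids the cut [1, infinity). The line
  Re \<zeta> = 0, where x may lie on the cut, is reached from the left: then 1 - x stays in the
  upper half plane, from which the principal Ln attains its values on the negative axis. All other
  \<zeta> follow by integer translation. The product over k does not change under u -> \<omega> u,
  so any N-th root u of 1 - x may be used.\<close>

abbreviation (input) exp2pi :: "complex \<Rightarrow> complex" where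
  "exp2pi z \<equiv> exp (2 * of_real pi * \<i> * z)"

section \<open>Integrals along horizontal lines\<close>

lemma integrable_exp_neg_abs:
  fixes c :: real
  assumes "c > 0"
  shows "(\<lambda>t::real. exp (- c * \<bar>t\<bar>)) integrable_on UNIV"
proof -
  have R: "(\<lambda>t::real. exp (- c * \<bar>t\<bar>)) integrable_on {0..}"
    using integrable_on_exp_minus_to_infinity[OF assms, of 0]
    by (rule integrable_spike_finite[of "{}", rotated 2]) auto
  define h where "h = (\<lambda>k t. if t \<in> {- real k..real k} then exp (- c * \<bar>t\<bar>) else 0)"
  have I: "((\<lambda>t. exp (- c * \<bar>t\<bar>)) has_integral (2 / c * (1 - exp (- c * real k)))) {- real k..real k}" for k
  proof -
    have 1: "((\<lambda>t. exp (- c * \<bar>t\<bar>)) has_integral (- exp (- c * real k) / c - (- exp (- c * 0) / c))) {0..real k}"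
    proof (rule fundamental_theorem_of_calculus)
      fix x :: real assume x: "x \<in> {0..real k}"
      have "((\<lambda>t. - exp (- c * t) / c) has_vector_derivative exp (- c * x)) (at x within {0..real k})"
        using assms unfolding has_real_derivative_iff_has_vector_derivative[symmetric]
        by (auto intro!: derivative_eq_intros)
      then show "((\<lambda>t. - exp (- c * t) / c) has_vector_derivative exp (- c * \<bar>x\<bar>)) (at x within {0..real k})"
        using x by simp
    qed auto
    then have 2: "((\<lambda>t. exp (- c * \<bar>- t\<bar>)) has_integral (- exp (- c * real k) / c - (- exp (- c * 0) / c))) {- real k..-0}"
      by (subst has_integral_reflect_real) auto
    have "((\<lambda>t. exp (- c * \<bar>t\<bar>)) has_integral ((- exp (- c * real k) / c - (- exp (- c * 0) / c)) + (- exp (- c * real k) / c - (- exp (- c * 0) / c)))) {- real k..real k}"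
      by (rule has_integral_combine[where c = 0]) (use 1 2 in auto)
    then show ?thesis by (simp add: right_diff_distrib diff_divide_distrib)
  qed
  have H: "(h k has_integral (2 / c * (1 - exp (- c * real k)))) UNIV" for k
    unfolding h_def using I[of k] by (subst has_integral_restrict_UNIV)
  have "((\<lambda>t. exp (- c * \<bar>t\<bar>)) has_integral (2 / c * (1 - 0))) UNIV"
  proof (rule has_integral_monotone_convergence_increasing[OF H])
    show "h k t \<le> h (Suc k) t" for k t by (auto simp: h_def)
    show "(\<lambda>k. h k t) \<longlonglongrightarrow> exp (- c * \<bar>t\<bar>)" for t
    proof (rule tendsto_eventually)
      obtain k0 where "\<bar>t\<bar> \<le> real k0" using real_arch_simple by blast
      then show "\<forall>\<^sub>F k in sequentially. h k t = exp (- c * \<bar>t\<bar>)"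
        by (intro eventually_mono[OF eventually_ge_at_top[of k0]]) (auto simp: h_def abs_le_iff)
    qed
    have "(\<lambda>k. exp (- c * real k)) \<longlonglongrightarrow> 0" using assms by real_asymp
    then show "(\<lambda>k. 2 / c * (1 - exp (- c * real k))) \<longlonglongrightarrow> 2 / c * (1 - 0)"
      by (intro tendsto_intros)
  qed
  then show ?thesis by (rule has_integral_integrable)
qed

text \<open>By the definition of the gauge integral, the integral over the line is approached by
  those over all boxes containing a large ball, in particular over symmetric intervals. Contour
  shifts, rescaling and differentiation are done on such intervals and then passed to the
  limit.\<close>

lemma integral_symmetric_tendsto_UNIV:
  fixes f :: "real \<Rightarrow> 'a::euclidean_space"
  assumes "f integrable_on UNIV" "filterlim X at_top F"
  shows "((\<lambda>n. integral {- X n..X n} f) \<longlongrightarrow> integral UNIV f) F"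
proof (rule tendstoI)
  fix r :: real assume "r > 0"
  then obtain B where B: "B > 0" "\<And>a b. ball 0 B \<subseteq> cbox a b \<Longrightarrow> norm (integral (cbox a b) f - integral UNIV f) < r"
    using integrable_integral[OF assms(1)] unfolding has_integral_alt'[of f] by auto
  have "\<forall>\<^sub>F n in F. X n \<ge> B" using assms(2) by (simp add: filterlim_at_top)
  then show "\<forall>\<^sub>F n in F. dist (integral {- X n..X n} f) (integral UNIV f) < r"
  proof eventually_elim
    case (elim n)
    then have "ball 0 B \<subseteq> cbox (- X n) (X n)" by (auto simp: dist_real_def)
    from B(2)[OF this] show ?case by (simp add: dist_norm)
  qed
qed

text \<open>Compactness handles the middle interval: there the quotient by the positive exponential
  is continuous, hence bounded.\<close>

lemma continuous_decay_bound:
  fixes g :: "real \<Rightarrow> complex" and c :: real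
  assumes "continuous_on UNIV g" "\<And>t. \<bar>t\<bar> \<ge> T \<Longrightarrow> norm (g t) \<le> C * exp (- c * \<bar>t\<bar>)"
  obtains B where "B > 0" "\<And>t. norm (g t) \<le> B * exp (- c * \<bar>t\<bar>)"
proof -
  have "continuous_on {-\<bar>T\<bar>..\<bar>T\<bar>} (\<lambda>t. norm (g t) / exp (- c * \<bar>t\<bar>))"
    by (intro continuous_intros continuous_on_subset[OF assms(1)]) auto
  then have "bounded ((\<lambda>t. norm (g t) / exp (- c * \<bar>t\<bar>)) ` {-\<bar>T\<bar>..\<bar>T\<bar>})"
    by (intro compact_imp_bounded compact_continuous_image) auto
  then obtain M where "\<forall>x\<in>(\<lambda>t. norm (g t) / exp (- c * \<bar>t\<bar>)) ` {-\<bar>T\<bar>..\<bar>T\<bar>}. norm x \<le> M"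
    unfolding bounded_iff by blast
  then have M: "norm (g t) / exp (- c * \<bar>t\<bar>) \<le> M" if "t \<in> {-\<bar>T\<bar>..\<bar>T\<bar>}" for t
    using that by auto
  show thesis
  proof (rule that[of "\<bar>M\<bar> + \<bar>C\<bar> + 1"])
    fix t
    consider "\<bar>t\<bar> \<ge> T" | "t \<in> {-\<bar>T\<bar>..\<bar>T\<bar>}" by fastforce
    then have "norm (g t) \<le> max M C * exp (- c * \<bar>t\<bar>)"
    proof cases
      case 1 then show ?thesis using assms(2)[OF 1]
        by (meson exp_ge_zero max.cobounded2 mult_right_mono order_trans)
    next
      case 2 then have "norm (g t) \<le> M * exp (- c * \<bar>t\<bar>)" using M[OF 2] by (simp add: field_simps)
      then show ?thesis by (meson exp_ge_zero max.cobounded1 mult_right_mono order_trans)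
    qed
    also have "\<dots> \<le> (\<bar>M\<bar> + \<bar>C\<bar> + 1) * exp (- c * \<bar>t\<bar>)" by (intro mult_right_mono) auto
    finally show "norm (g t) \<le> (\<bar>M\<bar> + \<bar>C\<bar> + 1) * exp (- c * \<bar>t\<bar>)" .
  qed auto
qed

lemma integrable_on_UNIV_decay:
  fixes g :: "real \<Rightarrow> complex" and c :: real
  assumes "continuous_on UNIV g" "c > 0" "\<And>t. norm (g t) \<le> B * exp (- c * \<bar>t\<bar>)"
  shows "g integrable_on UNIV"
proof (rule measurable_bounded_by_integrable_imp_integrable)
  show "g \<in> borel_measurable (lebesgue_on UNIV)"
    using assms(1) by (rule continuous_imp_measurable_on_sets_lebesgue) auto
  show "(\<lambda>t. B * exp (- c * \<bar>t\<bar>)) integrable_on UNIV"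
    using integrable_exp_neg_abs[OF assms(2)] by (rule integrable_on_mult_right)
qed (use assms in auto)

lemma contour_integral_linepath_same_Im:
  assumes "a < b"
  shows "contour_integral (linepath (Complex a c) (Complex b c)) f = integral {a..b} (\<lambda>t. f (Complex t c))"
proof -
  have "contour_integral (linepath (Complex a c) (Complex b c)) f
      = contour_integral (linepath (of_real a) (of_real b)) (\<lambda>w. f (w + \<i> * of_real c))"
    unfolding contour_integral_integral
    by (intro integral_cong) (simp add: linepath_def scaleR_conv_of_real Complex_eq algebra_simps)
  also have "\<dots> = integral {a..b} (\<lambda>t. f (Complex t c))"
    using assms by (subst contour_integral_linepath_Reals_eq) (auto simp: Complex_eq)
  finally show ?thesis .
qed

text \<open>The vertical sides stay contour integrals because they are only estimated; the
  horizontal sides become the real integrals whose limits are wanted.\<close>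

lemma contour_integral_rectpath_split:
  assumes "x1 < x2" "y1 < y2" "continuous_on (path_image (rectpath (Complex x1 y1) (Complex x2 y2))) f"
  shows "contour_integral (rectpath (Complex x1 y1) (Complex x2 y2)) f =
     integral {x1..x2} (\<lambda>t. f (Complex t y1)) + contour_integral (linepath (Complex x2 y1) (Complex x2 y2)) f
     - integral {x1..x2} (\<lambda>t. f (Complex t y2)) - contour_integral (linepath (Complex x1 y1) (Complex x1 y2)) f"
proof -
  have sub: "closed_segment (Complex x1 y1) (Complex x2 y1) \<subseteq> path_image (rectpath (Complex x1 y1) (Complex x2 y2))"
     "closed_segment (Complex x2 y1) (Complex x2 y2) \<subseteq> path_image (rectpath (Complex x1 y1) (Complex x2 y2))"
     "closed_segment (Complex x2 y2) (Complex x1 y2) \<subseteq> path_image (rectpath (Complex x1 y1) (Complex x2 y2))"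
     "closed_segment (Complex x1 y2) (Complex x1 y1) \<subseteq> path_image (rectpath (Complex x1 y1) (Complex x2 y2))"
    by (auto simp: rectpath_def Let_def path_image_join)
  have int: "f contour_integrable_on linepath (Complex x1 y1) (Complex x2 y1)"
    "f contour_integrable_on linepath (Complex x2 y1) (Complex x2 y2)"
    "f contour_integrable_on linepath (Complex x2 y2) (Complex x1 y2)"
    "f contour_integrable_on linepath (Complex x1 y2) (Complex x1 y1)"
    using sub by (auto intro!: contour_integrable_continuous_linepath continuous_on_subset[OF assms(3)])
  have "contour_integral (rectpath (Complex x1 y1) (Complex x2 y2)) f =
     contour_integral (linepath (Complex x1 y1) (Complex x2 y1)) f +
     (contour_integral (linepath (Complex x2 y1) (Complex x2 y2)) f +
     (contour_integral (linepath (Complex x2 y2) (Complex x1 y2)) f +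
     contour_integral (linepath (Complex x1 y2) (Complex x1 y1)) f))"
    using int by (simp add: rectpath_def Let_def contour_integrable_joinI)
  moreover have "contour_integral (linepath (Complex x2 y2) (Complex x1 y2)) f = - contour_integral (linepath (Complex x1 y2) (Complex x2 y2)) f"
     "contour_integral (linepath (Complex x1 y2) (Complex x1 y1)) f = - contour_integral (linepath (Complex x1 y1) (Complex x1 y2)) f"
    using contour_integral_reversepath[of "linepath (Complex x1 y2) (Complex x2 y2)" f]
      contour_integral_reversepath[of "linepath (Complex x1 y1) (Complex x1 y2)" f] by auto
  ultimately show ?thesis
    using assms(1) by (simp add: contour_integral_linepath_same_Im)
qed

text \<open>Residue theorem on the rectangles between real parts -n and n; the decay makes the
  vertical sides vanish in the limit. The margins \<alpha> < y1 and y2 < \<beta> provide an open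
  convex region around the closed rectangles.\<close>

lemma horizontal_line_shift:
  fixes f :: "complex \<Rightarrow> complex" and y1 y2 c :: real
  assumes y: "\<alpha> < y1" "y1 < y2" "y2 < \<beta>" and pts: "finite pts" "\<And>p. p \<in> pts \<Longrightarrow> y1 < Im p \<and> Im p < y2"
    and holo: "f holomorphic_on {z. \<alpha> < Im z \<and> Im z < \<beta>} - pts"
    and c: "c > 0" and dec: "\<And>t y. \<bar>t\<bar> \<ge> T \<Longrightarrow> y1 \<le> y \<Longrightarrow> y \<le> y2 \<Longrightarrow> norm (f (Complex t y)) \<le> C * exp (- c * \<bar>t\<bar>)"
  shows "integral UNIV (\<lambda>t. f (Complex t y1)) - integral UNIV (\<lambda>t. f (Complex t y2))
     = 2 * of_real pi * \<i> * (\<Sum>p\<in>pts. residue f p)"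
proof -
  define S where "S = {z. \<alpha> < Im z \<and> Im z < \<beta>}"
  have S: "open S" "convex S"
  proof -
    have "S = {z. Im z > \<alpha>} \<inter> {z. Im z < \<beta>}" by (auto simp: S_def)
    then show "open S" "convex S"
      by (auto intro!: open_halfspace_Im_gt open_halfspace_Im_lt convex_Int convex_halfspace_Im_gt convex_halfspace_Im_lt)
  qed
  have cont: "continuous_on (S - pts) f" using holo unfolding S_def by (rule holomorphic_on_imp_continuous_on)
  have int: "(\<lambda>t. f (Complex t y)) integrable_on UNIV" if "y = y1 \<or> y = y2" for y
  proof -
    have C: "continuous_on UNIV (\<lambda>t. f (Complex t y))"
      by (rule continuous_on_compose2[OF cont]) (use that y pts in \<open>force simp: S_def Complex_eq intro!: continuous_intros\<close>)+
    have D: "\<bar>t\<bar> \<ge> T \<Longrightarrow> norm (f (Complex t y)) \<le> C * exp (- c * \<bar>t\<bar>)" for t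
      using dec[of t y] that y by auto
    obtain B where "B > 0" "\<And>t. norm (f (Complex t y)) \<le> B * exp (- c * \<bar>t\<bar>)"
      using continuous_decay_bound[OF C D] by blast
    then show ?thesis using integrable_on_UNIV_decay[OF C c, of B] by blast
  qed
  define P where "P = (\<lambda>n. rectpath (Complex (- real n) y1) (Complex (real n) y2))"
  define V where "V = (\<lambda>n. contour_integral (linepath (Complex (real n) y1) (Complex (real n) y2)) f
       - contour_integral (linepath (Complex (- real n) y1) (Complex (- real n) y2)) f)"
  \<comment> \<open>From \<open>n0\<close> on, the vertical sides lie in the region of decay and the
    rectangle encloses every point of \<open>pts\<close>.\<close>
  obtain n0 where n0: "real n0 > \<bar>T\<bar>" "\<And>p. p \<in> pts \<Longrightarrow> \<bar>Re p\<bar> < real n0" "real n0 > 0"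
  proof -
    have "finite ((\<lambda>p. \<bar>Re p\<bar>) ` pts)" using pts by auto
    then obtain M where M: "\<And>p. p \<in> pts \<Longrightarrow> \<bar>Re p\<bar> \<le> M" by (meson bdd_above_finite bdd_above.E imageI)
    obtain n where "real n > max M (max 0 \<bar>T\<bar>)" using reals_Archimedean2 by blast
    then show thesis using M by (intro that[of n]) force+
  qed
  have img: "path_image (P n) \<subseteq> S - pts" if "n \<ge> n0" for n
  proof -
    have "real n \<ge> real n0" using that by simp
    then show ?thesis
    using n0 y pts unfolding P_def by (subst path_image_rectpath) (force simp: S_def)+
  qed
  have eq: "integral {- real n..real n} (\<lambda>t. f (Complex t y1)) - integral {- real n..real n} (\<lambda>t. f (Complex t y2)) + V n
     = 2 * of_real pi * \<i> * (\<Sum>p\<in>pts. residue f p)" if n: "n \<ge> n0" for n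
  proof -
    have nn: "real n \<ge> real n0" using that by simp
    have "contour_integral (P n) f = of_real (2 * pi) * \<i> * (\<Sum>p\<in>pts. winding_number (P n) p * residue f p)"
    proof (rule Residue_theorem)
      show "connected S" using S convex_connected by auto
      show "\<forall>z. z \<notin> S \<longrightarrow> winding_number (P n) z = 0"
        unfolding P_def using y n0 nn
        by (auto intro!: winding_number_rectpath_outside simp: S_def in_cbox_complex_iff)
    qed (use S pts holo img[OF n] in \<open>auto simp: S_def P_def\<close>)
    moreover have "winding_number (P n) p = 1" if "p \<in> pts" for p
      unfolding P_def using pts(2)[OF that] n0(2)[OF that] nn
      by (intro winding_number_rectpath) (auto simp: in_box_complex_iff)
    ultimately have "contour_integral (P n) f = 2 * of_real pi * \<i> * (\<Sum>p\<in>pts. residue f p)" by simp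
    moreover have "contour_integral (P n) f = integral {- real n..real n} (\<lambda>t. f (Complex t y1)) - integral {- real n..real n} (\<lambda>t. f (Complex t y2)) + V n"
      unfolding P_def V_def using y n0 nn img[OF n]
      by (subst contour_integral_rectpath_split) (auto simp: P_def intro: continuous_on_subset[OF cont])
    ultimately show ?thesis by simp
  qed
  have bnd: "norm (contour_integral (linepath (Complex x y1) (Complex x y2)) f) \<le> \<bar>C\<bar> * exp (- c * real n) * (y2 - y1)"
    if n: "n \<ge> n0" and x: "\<bar>x\<bar> = real n" for n x
  proof -
    have nn: "real n \<ge> real n0" using n by simp
    have seg: "w \<in> closed_segment (Complex x y1) (Complex x y2) \<Longrightarrow> \<exists>s. w = Complex x s \<and> y1 \<le> s \<and> s \<le> y2" for w
      using y by (auto simp: closed_segment_same_Re closed_segment_eq_real_ivl complex_eq_iff)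
    have sub: "closed_segment (Complex x y1) (Complex x y2) \<subseteq> S - pts"
      using seg x n0 nn y by (force simp: S_def)
    have "norm (contour_integral (linepath (Complex x y1) (Complex x y2)) f) \<le> (\<bar>C\<bar> * exp (- c * real n)) * norm (Complex x y2 - Complex x y1)"
    proof (rule contour_integral_bound_linepath)
      show "f contour_integrable_on linepath (Complex x y1) (Complex x y2)"
        by (intro contour_integrable_continuous_linepath continuous_on_subset[OF cont] sub)
      fix w assume "w \<in> closed_segment (Complex x y1) (Complex x y2)"
      then obtain s where s: "w = Complex x s" "y1 \<le> s" "s \<le> y2" using seg by blast
      have "norm (f w) \<le> C * exp (- c * \<bar>x\<bar>)" using dec[of x s] s x n0 nn by auto
      also have "\<dots> \<le> \<bar>C\<bar> * exp (- c * real n)" using x by (intro mult_mono) auto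
      finally show "norm (f w) \<le> \<bar>C\<bar> * exp (- c * real n)" .
    qed auto
    moreover have "norm (Complex x y2 - Complex x y1) = y2 - y1" using y by (simp add: cmod_def)
    ultimately show ?thesis by simp
  qed
  have "V \<longlonglongrightarrow> 0"
  proof (rule Lim_null_comparison)
    show "\<forall>\<^sub>F n in sequentially. norm (V n) \<le> 2 * (\<bar>C\<bar> * exp (- c * real n) * (y2 - y1))"
      using eventually_ge_at_top[of n0]
    proof eventually_elim
      case (elim n)
      then show ?case unfolding V_def using bnd[of n "real n"] bnd[of n "- real n"]
        by (intro order_trans[OF norm_triangle_ineq4]) auto
    qed
    have "(\<lambda>n. exp (- c * real n)) \<longlonglongrightarrow> 0" using c by real_asymp
    then have "(\<lambda>n. 2 * (\<bar>C\<bar> * exp (- c * real n) * (y2 - y1))) \<longlonglongrightarrow> 2 * (\<bar>C\<bar> * 0 * (y2 - y1))"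
      by (intro tendsto_intros)
    then show "(\<lambda>n. 2 * (\<bar>C\<bar> * exp (- c * real n) * (y2 - y1))) \<longlonglongrightarrow> 0" by simp
  qed
  then have "(\<lambda>n. integral {- real n..real n} (\<lambda>t. f (Complex t y1)) - integral {- real n..real n} (\<lambda>t. f (Complex t y2)) + V n)
      \<longlonglongrightarrow> integral UNIV (\<lambda>t. f (Complex t y1)) - integral UNIV (\<lambda>t. f (Complex t y2)) + 0"
    by (intro tendsto_add tendsto_diff integral_symmetric_tendsto_UNIV int filterlim_real_sequentially) auto
  moreover have "(\<lambda>n. integral {- real n..real n} (\<lambda>t. f (Complex t y1)) - integral {- real n..real n} (\<lambda>t. f (Complex t y2)) + V n)
      \<longlonglongrightarrow> 2 * of_real pi * \<i> * (\<Sum>p\<in>pts. residue f p)"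
    by (intro tendsto_eventually eventually_mono[OF eventually_ge_at_top[of n0]] eq)
  ultimately show ?thesis using LIMSEQ_unique by fastforce
qed

text \<open>Affine substitution on symmetric intervals, followed by the limit. It carries out the
  change of variable between Faddeev's integral and the one with \<open>hyp_kernel\<close>, with s =
  sqrt N.\<close>

lemma integral_UNIV_stretch:
  fixes f :: "real \<Rightarrow> complex"
  assumes "s > 0" "f integrable_on UNIV" "(\<lambda>t. f (t / s)) integrable_on UNIV"
  shows "integral UNIV (\<lambda>t. f (t / s)) = of_real s * integral UNIV f"
proof -
  have eq: "integral {- (real n)..real n} (\<lambda>t. f (t / s)) = of_real s * integral {- (real n / s)..real n / s} f" for n
  proof -
    have int: "f integrable_on cbox (- (real n / s)) (real n / s)"
      by (rule integrable_on_subcbox[OF assms(2)]) auto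
    have "((\<lambda>x. f ((1 / s) *\<^sub>R x + 0)) has_integral integral (cbox (- (real n / s)) (real n / s)) f /\<^sub>R (1 / s) ^ DIM(real))
        (cbox ((- (real n / s) - 0) /\<^sub>R (1 / s)) ((real n / s - 0) /\<^sub>R (1 / s)))"
      using has_integral_affinity_iff[of "1 / s" f 0 _ "- (real n / s)" "real n / s"] int assms(1) by (simp add: integrable_integral)
    then have "((\<lambda>x. f (x / s)) has_integral of_real s * integral {- (real n / s)..real n / s} f) {- real n..real n}"
      using assms(1) by (simp add: scaleR_conv_of_real)
    then show ?thesis by (rule integral_unique)
  qed
  have "filterlim (\<lambda>n. real n / s) at_top sequentially" using assms(1) by real_asymp
  then have "(\<lambda>n. of_real s * integral {- (real n / s)..real n / s} f) \<longlonglongrightarrow> of_real s * integral UNIV f"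
    by (intro tendsto_intros integral_symmetric_tendsto_UNIV assms)
  moreover have "(\<lambda>n. integral {- (real n)..real n} (\<lambda>t. f (t / s))) \<longlonglongrightarrow> integral UNIV (\<lambda>t. f (t / s))"
    by (intro integral_symmetric_tendsto_UNIV assms filterlim_real_sequentially)
  ultimately show ?thesis unfolding eq using LIMSEQ_unique by blast
qed

section \<open>Two-sided Laplace transforms along a horizontal line\<close>

text \<open>\<open>h\<close> is a kernel already restricted to the line Im u = e. The decay rate
  \<open>a\<close> fixes the strip |Re z| < a of convergence, and the second bound, on the kernel
  times the variable, makes the differentiated integral converge on the same strip.\<close>

locale laplace_line =
  fixes h :: "real \<Rightarrow> complex" and e a B :: real
  assumes cont_h: "continuous_on UNIV h" and B_pos: "B > 0"
    and h_bound: "\<And>t. norm (h t) \<le> B * exp (- a * \<bar>t\<bar>)"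
    and h'_bound: "\<And>t. norm (Complex t e * h t) \<le> B * exp (- a * \<bar>t\<bar>)"
begin

definition lap :: "complex \<Rightarrow> complex" where
  "lap z = integral UNIV (\<lambda>t. exp (z * Complex t e) * h t)"

definition lap' :: "complex \<Rightarrow> complex" where
  "lap' z = integral UNIV (\<lambda>t. Complex t e * exp (z * Complex t e) * h t)"

lemma norm_kernel:
  assumes "norm k \<le> B * exp (- a * \<bar>t\<bar>)"
  shows "norm (exp (z * Complex t e) * k) \<le> B * exp (- e * Im z) * exp (- (a - \<bar>Re z\<bar>) * \<bar>t\<bar>)"
proof -
  have "norm (exp (z * Complex t e) * k) \<le> exp (Re z * t - Im z * e) * (B * exp (- a * \<bar>t\<bar>))"
    unfolding norm_mult using assms by (intro mult_mono) auto
  also have "Re z * t \<le> \<bar>Re z\<bar> * \<bar>t\<bar>" by (metis abs_ge_self abs_mult)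
  then have "exp (Re z * t - Im z * e) \<le> exp (\<bar>Re z\<bar> * \<bar>t\<bar> - Im z * e)" by simp
  then have "exp (Re z * t - Im z * e) * (B * exp (- a * \<bar>t\<bar>)) \<le> exp (\<bar>Re z\<bar> * \<bar>t\<bar> - Im z * e) * (B * exp (- a * \<bar>t\<bar>))"
    using B_pos by (intro mult_right_mono) auto
  also have "\<dots> = B * exp (- e * Im z) * exp (- (a - \<bar>Re z\<bar>) * \<bar>t\<bar>)"
    by (simp add: algebra_simps flip: exp_add)
  finally show ?thesis .
qed

lemma cont_Complex: "continuous_on A (\<lambda>t. Complex t e)"
  by (simp add: Complex_eq continuous_intros)

lemma integrable_lap:
  assumes "\<bar>Re z\<bar> < a"
  shows "(\<lambda>t. exp (z * Complex t e) * h t) integrable_on UNIV"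
    and "(\<lambda>t. Complex t e * exp (z * Complex t e) * h t) integrable_on UNIV"
proof -
  show "(\<lambda>t. exp (z * Complex t e) * h t) integrable_on UNIV"
    by (rule integrable_on_UNIV_decay[OF _ _ norm_kernel[OF h_bound]])
       (use assms in \<open>auto intro!: continuous_intros cont_h cont_Complex\<close>)
  have "(\<lambda>t. exp (z * Complex t e) * (Complex t e * h t)) integrable_on UNIV"
    by (rule integrable_on_UNIV_decay[OF _ _ norm_kernel[OF h'_bound]])
       (use assms in \<open>auto intro!: continuous_intros cont_h cont_Complex\<close>)
  then show "(\<lambda>t. Complex t e * exp (z * Complex t e) * h t) integrable_on UNIV"
    by (simp add: mult_ac)
qed

lemma norm_lap_le:
  assumes "\<bar>Re z\<bar> < a"
  shows "norm (lap z) \<le> exp (- e * Im z) * (B * integral UNIV (\<lambda>t. exp (- (a - \<bar>Re z\<bar>) * \<bar>t\<bar>)))"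
proof -
  have i: "(\<lambda>t. exp (- (a - \<bar>Re z\<bar>) * \<bar>t\<bar>)) integrable_on UNIV"
    using assms by (intro integrable_exp_neg_abs) auto
  have "norm (lap z) \<le> integral UNIV (\<lambda>t. B * exp (- e * Im z) * exp (- (a - \<bar>Re z\<bar>) * \<bar>t\<bar>))"
    unfolding lap_def using integrable_lap(1)[OF assms] norm_kernel[OF h_bound]
    by (intro integral_norm_bound_integral integrable_on_mult_right i) auto
  then show ?thesis by (simp add: mult_ac)
qed

text \<open>On the line the exponential has size exp (Re z * t - e * Im z). Since the line lies
  above the real axis, the whole integral carries the decaying factor exp (- e * Im z).\<close>

lemma lap_tendsto_0:
  assumes "\<bar>x\<bar> < a" "e > 0"
  shows "((\<lambda>y. lap (Complex x y)) \<longlongrightarrow> 0) at_top"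
proof (rule Lim_null_comparison)
  define J where "J = B * integral UNIV (\<lambda>t. exp (- (a - \<bar>x\<bar>) * \<bar>t\<bar>))"
  show "\<forall>\<^sub>F y in at_top. norm (lap (Complex x y)) \<le> exp (- e * y) * J"
    using norm_lap_le[of "Complex x y" for y] assms by (intro always_eventually) (auto simp: J_def)
  have "((\<lambda>y. exp (- e * y)) \<longlongrightarrow> 0) at_top" using assms(2) by real_asymp
  then show "((\<lambda>y. exp (- e * y) * J) \<longlongrightarrow> 0) at_top" by (rule tendsto_mult_left_zero)
qed

text \<open>Truncated integrals are differentiated under the integral sign over a compact interval.
  They converge uniformly on a disc, so by Weierstrass the limit is holomorphic and the derivatives
  converge too; their limit is \<open>lap'\<close>.\<close>

lemma lap_has_field_derivative:
  assumes z0: "\<bar>Re z0\<bar> < a"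
  shows "(lap has_field_derivative lap' z0) (at z0)"
proof -
  \<comment> \<open>Half the distance to the edge of the strip, so that the integrand decays at
    least at rate \<open>r\<close> for every z in the closed disc.\<close>
  define r where "r = (a - \<bar>Re z0\<bar>) / 2"
  have r: "r > 0" "a - \<bar>Re z0\<bar> = 2 * r" using z0 by (auto simp: r_def)
  define f where "f = (\<lambda>n z. integral (cbox (- real n) (real n)) (\<lambda>t. exp (z * Complex t e) * h t))"
  define f' where "f' = (\<lambda>n z. integral (cbox (- real n) (real n)) (\<lambda>t. Complex t e * exp (z * Complex t e) * h t))"
  have cm: "continuous_on UNIV (\<lambda>p::complex \<times> real. Complex (snd p) e)" "continuous_on A (\<lambda>p::complex \<times> real. h (snd p))" for A
    by (auto simp: Complex_eq intro!: continuous_intros continuous_on_compose2[OF cont_h])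
  have der: "(f n has_field_derivative f' n z) (at z)" for n z
  proof -
    have "(f n has_field_derivative f' n z) (at z within UNIV)"
      unfolding f_def f'_def
    proof (rule leibniz_rule_field_derivative)
      show "((\<lambda>z. exp (z * Complex t e) * h t) has_field_derivative Complex t e * exp (z * Complex t e) * h t) (at z within UNIV)" for z t
        by (auto intro!: derivative_eq_intros)
      show "(\<lambda>t. exp (z * Complex t e) * h t) integrable_on cbox (- real n) (real n)" for z
        by (intro integrable_continuous continuous_intros continuous_on_subset[OF cont_h] cont_Complex) auto
      show "continuous_on (UNIV \<times> cbox (- real n) (real n)) (\<lambda>(z, t). Complex t e * exp (z * Complex t e) * h t)"
        unfolding case_prod_unfold by (intro continuous_intros continuous_on_subset[OF cm(1)] cm(2)) auto
    qed auto
    then show ?thesis by simp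
  qed
  have Re_le: "\<bar>Re z\<bar> \<le> a - r" "- e * Im z \<le> \<bar>e\<bar> * (\<bar>Im z0\<bar> + r)" if "z \<in> cball z0 r" for z
  proof -
    have "norm (z - z0) \<le> r" using that by (simp add: dist_norm norm_minus_commute)
    then have 1: "\<bar>Re z - Re z0\<bar> \<le> r" "\<bar>Im z - Im z0\<bar> \<le> r"
      using abs_Re_le_cmod[of "z - z0"] abs_Im_le_cmod[of "z - z0"] by auto
    then show "\<bar>Re z\<bar> \<le> a - r" using r by auto
    have "- e * Im z \<le> \<bar>e\<bar> * \<bar>Im z\<bar>" by (metis abs_ge_self abs_minus_cancel abs_mult mult_minus_left)
    also have "\<dots> \<le> \<bar>e\<bar> * (\<bar>Im z0\<bar> + r)" using 1 by (intro mult_left_mono) auto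
    finally show "- e * Im z \<le> \<bar>e\<bar> * (\<bar>Im z0\<bar> + r)" .
  qed
  \<comment> \<open>A majorant common to all z in the disc; its tail integral bounds the truncation
    error uniformly.\<close>
  define D where "D = (\<lambda>t::real. B * exp (\<bar>e\<bar> * (\<bar>Im z0\<bar> + r)) * exp (- r * \<bar>t\<bar>))"
  have D_int: "D integrable_on UNIV" unfolding D_def using r by (intro integrable_on_mult_right integrable_exp_neg_abs)
  have bound: "norm (exp (z * Complex t e) * h t) \<le> D t" if "z \<in> cball z0 r" for z t
  proof -
    have "norm (exp (z * Complex t e) * h t) \<le> B * exp (- e * Im z) * exp (- (a - \<bar>Re z\<bar>) * \<bar>t\<bar>)"
      by (rule norm_kernel[OF h_bound])
    also have "\<dots> \<le> D t"
    proof -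
      have "- (a - \<bar>Re z\<bar>) * \<bar>t\<bar> \<le> - r * \<bar>t\<bar>" using Re_le(1)[OF that] by (intro mult_right_mono) auto
      then have 1: "exp (- (a - \<bar>Re z\<bar>) * \<bar>t\<bar>) \<le> exp (- r * \<bar>t\<bar>)" by (simp only: exp_le_cancel_iff)
      have 2: "exp (- e * Im z) \<le> exp (\<bar>e\<bar> * (\<bar>Im z0\<bar> + r))" using Re_le(2)[OF that] by (simp only: exp_le_cancel_iff)
      show ?thesis unfolding D_def by (rule mult_mono[OF mult_left_mono[OF 2] 1]) (use B_pos in auto)
    qed
    finally show ?thesis .
  qed
  define tail where "tail = (\<lambda>n. integral UNIV D - integral {- real n..real n} D)"
  have tail0: "tail \<longlonglongrightarrow> 0"
  proof -
    have "tail \<longlonglongrightarrow> integral UNIV D - integral UNIV D" unfolding tail_def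
      by (intro tendsto_intros integral_symmetric_tendsto_UNIV D_int filterlim_real_sequentially)
    then show ?thesis by simp
  qed
  have close: "norm (f n z - lap z) \<le> tail n" if z: "z \<in> cball z0 r" for n z
  proof -
    define q where "q = (\<lambda>t. exp (z * Complex t e) * h t)"
    define A where "A = {- real n..real n}"
    have q: "q integrable_on UNIV" unfolding q_def using Re_le(1)[OF z] r by (intro integrable_lap) auto
    have sub: "integral UNIV (\<lambda>t. g t - (if t \<in> A then g t else 0)) = integral UNIV g - integral A g"
      "(\<lambda>t. g t - (if t \<in> A then g t else 0)) integrable_on UNIV"
      if "g integrable_on UNIV" for g :: "real \<Rightarrow> 'a::euclidean_space"
    proof -
      have "g integrable_on A" using integrable_on_subcbox[OF that, of "- real n" "real n"] by (simp add: A_def)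
      then have "(\<lambda>t. if t \<in> A then g t else 0) integrable_on UNIV" by (simp only: integrable_restrict_UNIV)
      from Henstock_Kurzweil_Integration.integral_diff[OF that this] integrable_diff[OF that this]
      show "integral UNIV (\<lambda>t. g t - (if t \<in> A then g t else 0)) = integral UNIV g - integral A g"
        "(\<lambda>t. g t - (if t \<in> A then g t else 0)) integrable_on UNIV"
        by (simp_all only: integral_restrict_UNIV)
    qed
    have "lap z - f n z = integral UNIV (\<lambda>t. q t - (if t \<in> A then q t else 0))"
      unfolding sub(1)[OF q] by (simp add: lap_def f_def q_def A_def)
    also have "norm \<dots> \<le> integral UNIV (\<lambda>t. D t - (if t \<in> A then D t else 0))"
      using bound[OF z] by (intro integral_norm_bound_integral sub(2) q D_int) (auto simp: q_def)
    also have "\<dots> = tail n"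
      unfolding sub(1)[OF D_int] by (simp add: tail_def A_def)
    finally show ?thesis by (simp add: norm_minus_commute)
  qed
  have ul: "uniform_limit (cball z0 r) f lap sequentially"
  proof (rule uniform_limitI)
    fix d :: real assume "d > 0"
    then have "\<forall>\<^sub>F n in sequentially. tail n < d" using tail0 by (auto dest: order_tendstoD)
    then show "\<forall>\<^sub>F n in sequentially. \<forall>z\<in>cball z0 r. dist (f n z) (lap z) < d"
    proof eventually_elim
      case (elim n)
      show ?case
      proof
        fix z assume "z \<in> cball z0 r"
        from close[OF this, of n] elim show "dist (f n z) (lap z) < d" by (simp add: dist_norm)
      qed
    qed
  qed
  have "\<forall>\<^sub>F n in sequentially. continuous_on (cball z0 r) (f n) \<and> (\<forall>w\<in>ball z0 r. (f n has_field_derivative f' n w) (at w))"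
    using der by (intro always_eventually) (auto intro!: continuous_at_imp_continuous_on intro: DERIV_isCont)
  then obtain g' where "\<And>w. w \<in> ball z0 r \<Longrightarrow> (lap has_field_derivative g' w) (at w) \<and> (\<lambda>n. f' n w) \<longlonglongrightarrow> g' w"
    using has_complex_derivative_uniform_limit[of z0 r f f' sequentially lap] ul r(1) by auto
  from this[of z0] have g: "(lap has_field_derivative g' z0) (at z0)" "(\<lambda>n. f' n z0) \<longlonglongrightarrow> g' z0" using r(1) by auto
  have "(\<lambda>n. f' n z0) \<longlonglongrightarrow> lap' z0"
    unfolding f'_def lap'_def cbox_interval
    by (intro integral_symmetric_tendsto_UNIV integrable_lap z0 filterlim_real_sequentially)
  then show ?thesis using g LIMSEQ_unique by metis
qed

end

section \<open>Roots of unity and circulant determinants\<close>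

locale primitive_root_of_unity =
  fixes N :: nat and w :: complex
  assumes N_pos: "N > 0" and power_N: "w ^ N = 1"
    and primitive: "\<And>j. 0 < j \<Longrightarrow> j < N \<Longrightarrow> w ^ j \<noteq> 1"
begin

lemma w_nonzero: "w \<noteq> 0"
  using power_N N_pos by (metis power_0_left zero_neq_one less_numeral_extra(3))

lemma inj_powers: "inj_on (\<lambda>k. w ^ k) {..<N}"
proof (rule linorder_inj_onI')
  fix i j assume ij: "i \<in> {..<N}" "j \<in> {..<N}" "i < j"
  then have "w ^ j = w ^ i * w ^ (j - i)" by (simp flip: power_add)
  then show "w ^ i \<noteq> w ^ j" using primitive[of "j - i"] ij w_nonzero by auto
qed

lemma power_mod_N: "w ^ (k mod N) = w ^ k"
  by (metis div_mult_mod_eq mult.commute mult_1_left power_N power_add power_mult power_one)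

lemma sum_powers:
  assumes "0 < s" "s < N"
  shows "(\<Sum>i<N. w ^ (i * s)) = 0"
proof -
  have "(\<Sum>i<N. (w ^ s) ^ i) = ((w ^ s) ^ N - 1) / (w ^ s - 1)"
    using primitive[OF assms] by (rule geometric_sum)
  also have "(w ^ s) ^ N = 1" by (metis mult.commute power_N power_mult power_one)
  finally show ?thesis by (simp add: mult.commute flip: power_mult)
qed

text \<open>Multiplication by y - 1 is a summation by parts that leaves N minus a multiple of the
  full sum of powers, which is zero.\<close>

lemma sum_index_powers:
  assumes "0 < s" "s < N"
  shows "(\<Sum>i<N. of_nat i * w ^ (i * s)) = of_nat N / (w ^ s - 1)"
proof -
  define y where "y = w ^ s"
  have y: "y \<noteq> 1" "y ^ N = 1" using primitive[OF assms] unfolding y_def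
    by (auto simp: ) (metis mult.commute power_N power_mult power_one)
  have "(\<Sum>i<n. of_nat i * y ^ i) * (y - 1) = of_nat n * y ^ n - (\<Sum>i<n. y ^ Suc i)" for n
    by (induction n) (auto simp: algebra_simps)
  from this[of N] have "(\<Sum>i<N. of_nat i * y ^ i) * (y - 1) = of_nat N - y * (\<Sum>i<N. y ^ i)"
    using y by (simp add: sum_distrib_left)
  also have "(\<Sum>i<N. y ^ i) = 0" using geometric_sum[OF y(1), of N] y by simp
  finally show ?thesis using y unfolding y_def
    by (simp add: field_simps flip: power_mult)
qed

text \<open>Pairing s with N - s replaces w^s by its inverse, and 1 / (1 - y) + 1 / (1 - 1 / y) =
  1.\<close>

lemma sum_reciprocals: "(\<Sum>s=1..<N. 1 / (1 - w ^ s)) = (of_nat N - 1) / 2"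
proof -
  have "(\<Sum>s=1..<N. 1 / (1 - w ^ s)) = (\<Sum>s=1..<N. 1 / (1 - w ^ (N - s)))"
    by (rule sum.reindex_bij_witness[of _ "\<lambda>s. N - s" "\<lambda>s. N - s"]) auto
  then have "2 * (\<Sum>s=1..<N. 1 / (1 - w ^ s)) = (\<Sum>s=1..<N. 1 / (1 - w ^ s) + 1 / (1 - w ^ (N - s)))"
    by (simp add: sum.distrib)
  also have "\<dots> = (\<Sum>s=1..<N. 1)"
  proof (rule sum.cong[OF refl])
    fix s assume s: "s \<in> {1..<N}"
    have "w ^ s * w ^ (N - s) = 1" using s power_N by (simp flip: power_add)
    then have *: "w ^ (N - s) = 1 / w ^ s" using w_nonzero by (simp add: field_simps)
    show "1 / (1 - w ^ s) + 1 / (1 - w ^ (N - s)) = 1"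
      unfolding * using primitive[of s] s w_nonzero by (simp add: divide_simps) (simp add: algebra_simps)
  qed
  finally show ?thesis using N_pos by (simp add: of_nat_diff mult.commute)
qed

section \<open>Polynomial identities in u, proved by evaluation at the powers of w\<close>

lemma poly_eq_via_powers:
  fixes p q :: "complex poly"
  assumes "degree p < N" "degree q < N" "\<And>k. k < N \<Longrightarrow> poly p (w ^ k) = poly q (w ^ k)"
  shows "p = q"
  by (rule poly_eqI_degree[of "(\<lambda>k. w ^ k) ` {..<N}"]) (use assms inj_powers in \<open>auto simp: card_image\<close>)

text \<open>Both sides are polynomials in u of degree at most N that agree at N + 1 points: at 0,
  and at the N powers of w, where both vanish.\<close>

lemma prod_one_minus: "(\<Prod>i<N. 1 - w ^ i * u) = 1 - u ^ N"
proof -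
  define p where "p = (\<Prod>i<N. [:1, - (w ^ i):])"
  define q where "q = 1 - monom (1::complex) N"
  have "degree p \<le> (\<Sum>i<N. degree [:1, - (w ^ i):])"
    unfolding p_def using degree_prod_sum_le[of "{..<N}" "\<lambda>i. [:1, - (w ^ i):]"] by (simp add: o_def)
  also have "\<dots> \<le> (\<Sum>i<N. 1)" by (intro sum_mono) auto
  finally have dp: "degree p \<le> N" by simp
  have dq: "degree q \<le> N" unfolding q_def by (intro degree_diff_le) (auto simp: degree_monom_le)
  have pp: "poly p u = (\<Prod>i<N. 1 - w ^ i * u)" for u by (simp add: p_def poly_prod algebra_simps)
  have pq: "poly q u = 1 - u ^ N" for u by (simp add: q_def poly_monom)
  have "p = q"
  proof (rule poly_eqI_degree[of "insert 0 ((\<lambda>k. w ^ k) ` {..<N})"])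
    show "poly p u = poly q u" if "u \<in> insert 0 ((\<lambda>k. w ^ k) ` {..<N})" for u
    proof (cases "u = 0")
      case True then show ?thesis using N_pos by (simp add: pp pq)
    next
      case False
      then obtain k where k: "k < N" "u = w ^ k" using \<open>u \<in> _\<close> by auto
      have "u ^ N = 1" by (metis k(2) mult.commute power_N power_mult power_one)
      moreover have "1 - w ^ ((N - k) mod N) * u = 0"
        using k power_N by (simp add: power_mod_N flip: power_add)
      then have "poly p u = 0" unfolding pp using N_pos by (intro prod_zero) auto
      ultimately show ?thesis by (simp add: pq)
    qed
    have "card (insert 0 ((\<lambda>k. w ^ k) ` {..<N})) = Suc N"
      using inj_powers w_nonzero by (subst card_insert_disjoint) (auto simp: card_image)
    then show "degree p < card (insert 0 ((\<lambda>k. w ^ k) ` {..<N}))" "degree q < card (insert 0 ((\<lambda>k. w ^ k) ` {..<N}))"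
      using dp dq by auto
  qed
  then show ?thesis using pp pq by metis
qed

text \<open>The q-Pochhammer symbol (u; q)_k at q = w.\<close>

definition qpoch :: "nat \<Rightarrow> complex \<Rightarrow> complex" where
  "qpoch k u = (\<Prod>i<k. 1 - w ^ i * u)"

lemma qpoch_Suc: "qpoch (Suc k) u = qpoch k u * (1 - w ^ k * u)"
  by (simp add: qpoch_def)

lemma qpoch_Suc_shift: "qpoch (Suc k) u = (1 - u) * qpoch k (w * u)"
  unfolding qpoch_def by (subst prod.lessThan_Suc_shift) (simp add: algebra_simps)

text \<open>The left side is a polynomial in u of degree below N. Replacing u by w u does not change
  it when u differs from 1, so it takes one value at all N powers of w and is constant. At u = 1
  every \<open>qpoch j u\<close> with j > 0 vanishes, and the sum of reciprocals remains.\<close>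

lemma partial_fraction_identity:
  "(\<Sum>s=1..<N. u ^ s / (1 - w ^ s)) - (\<Sum>j=1..<N. w ^ j * qpoch j u / (1 - w ^ j)) = (of_nat N - 1) / 2"
proof -
  define f where "f u = (\<Sum>s=1..<N. u ^ s / (1 - w ^ s)) - (\<Sum>j=1..<N. w ^ j * qpoch j u / (1 - w ^ j))" for u
  have step: "f (w * u) = f u" if False: "u \<noteq> 1" for u
  proof -
    \<comment> \<open>Each term is the drop from \<open>qpoch j (w * u)\<close> to
      \<open>qpoch (Suc j) (w * u)\<close>.\<close>
    have tel: "(\<Sum>j<n. w ^ Suc j * u * qpoch j (w * u)) = 1 - qpoch n (w * u)" for n
      by (induction n) (auto simp: qpoch_Suc, auto simp: qpoch_def algebra_simps)
    have "f u - f (w * u) = (\<Sum>s=1..<N. (u ^ s - (w * u) ^ s) / (1 - w ^ s)) - (\<Sum>j=1..<N. w ^ j * (qpoch j u - qpoch j (w * u)) / (1 - w ^ j))"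
      by (simp add: f_def sum_subtractf diff_divide_distrib right_diff_distrib)
    also have "(\<Sum>s=1..<N. (u ^ s - (w * u) ^ s) / (1 - w ^ s)) = (\<Sum>s=1..<N. u ^ s)"
    proof (rule sum.cong[OF refl])
      fix s assume s: "s \<in> {1..<N}"
      have "u ^ s - (w * u) ^ s = u ^ s * (1 - w ^ s)" by (simp add: algebra_simps power_mult_distrib)
      then show "(u ^ s - (w * u) ^ s) / (1 - w ^ s) = u ^ s" using primitive[of s] s by simp
    qed
    also have "(\<Sum>j=1..<N. w ^ j * (qpoch j u - qpoch j (w * u)) / (1 - w ^ j)) = (\<Sum>j=1..<N. - (w ^ j * u * qpoch (j - 1) (w * u)))"
    proof (rule sum.cong[OF refl])
      fix j assume j: "j \<in> {1..<N}"
      then obtain k where k: "j = Suc k" by (cases j) auto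
      have "qpoch j u - qpoch j (w * u) = qpoch k (w * u) * ((1 - u) - (1 - w ^ k * (w * u)))"
        unfolding k by (subst qpoch_Suc_shift, subst qpoch_Suc) (simp add: algebra_simps)
      also have "\<dots> = - (u * qpoch k (w * u)) * (1 - w ^ j)" unfolding k by (simp add: algebra_simps)
      finally show "w ^ j * (qpoch j u - qpoch j (w * u)) / (1 - w ^ j) = - (w ^ j * u * qpoch (j - 1) (w * u))"
        using primitive[of j] j k by simp
    qed
    also have "(\<Sum>j=1..<N. - (w ^ j * u * qpoch (j - 1) (w * u))) = - (\<Sum>j<N-1. w ^ Suc j * u * qpoch j (w * u))"
      unfolding sum_negf by (intro arg_cong[where f=uminus] sum.reindex_bij_witness[of _ Suc "\<lambda>j. j - 1"]) auto
    also have "\<dots> = - (1 - qpoch (N - 1) (w * u))" unfolding tel ..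
    finally have "f u - f (w * u) = (\<Sum>s=1..<N. u ^ s) + 1 - qpoch (N - 1) (w * u)" by simp
    moreover have "(\<Sum>s=1..<N. u ^ s) + 1 = (\<Sum>s<N. u ^ s)"
      using N_pos by (simp add: lessThan_atLeast0 sum.atLeast_Suc_lessThan)
    moreover have "\<dots> = (1 - u ^ N) / (1 - u)" using False by (simp add: sum_gp_strict)
    moreover have "(1 - u) * qpoch (N - 1) (w * u) = 1 - u ^ N"
      using qpoch_Suc_shift[of "N - 1" u] N_pos prod_one_minus[of u] by (simp add: qpoch_def)
    then have "qpoch (N - 1) (w * u) = (1 - u ^ N) / (1 - u)" using False by (simp add: nonzero_eq_divide_eq mult.commute)
    ultimately show ?thesis by simp
  qed
  have val: "f (w ^ k) = f 1" if "k < N" for k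
  proof (cases "k = 0")
    case False
    have "f (w ^ k) = f (w ^ N)"
      using less_imp_le[OF that]
    proof (induction rule: inc_induct)
      case (step n)
      then show ?case using \<open>\<And>u. u \<noteq> 1 \<Longrightarrow> f (w * u) = f u\<close>[of "w ^ n"] primitive[of n] False by auto
    qed auto
    then show ?thesis by (simp add: power_N)
  qed auto
  define p where "p = (\<Sum>s=1..<N. Polynomial.smult (1 / (1 - w ^ s)) (monom 1 s)) - (\<Sum>j=1..<N. Polynomial.smult (w ^ j / (1 - w ^ j)) (\<Prod>i<j. [:1, - (w ^ i):]))"
  have pf: "poly p u = f u" for u
    by (simp add: p_def f_def poly_sum poly_monom poly_prod qpoch_def algebra_simps)
  have "degree p \<le> N - 1"
    unfolding p_def
  proof (intro degree_diff_le degree_sum_le)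
    fix s assume "s \<in> {1..<N}"
    then show "degree (Polynomial.smult (1 / (1 - w ^ s)) (monom 1 s)) \<le> N - 1"
      by (intro order_trans[OF degree_smult_le] order_trans[OF degree_monom_le]) auto
  next
    fix j assume "j \<in> {1..<N}"
    have "degree (\<Prod>i<j. [:1, - (w ^ i):]) \<le> (\<Sum>i<j. degree [:1, - (w ^ i):])"
      using degree_prod_sum_le[of "{..<j}" "\<lambda>i. [:1, - (w ^ i):]"] by (simp add: o_def)
    also have "\<dots> \<le> (\<Sum>i<j. 1)" by (intro sum_mono) auto
    finally show "degree (Polynomial.smult (w ^ j / (1 - w ^ j)) (\<Prod>i<j. [:1, - (w ^ i):])) \<le> N - 1"
      using \<open>j \<in> _\<close> by (intro order_trans[OF degree_smult_le]) auto
  qed auto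
  then have "p = [:f 1:]"
    using N_pos by (intro poly_eq_via_powers) (auto simp: pf val)
  then have "f u = f 1" using pf[of u] by simp
  also have "f 1 = (\<Sum>s=1..<N. 1 / (1 - w ^ s))"
  proof -
    have "qpoch j 1 = 0" if "j \<in> {1..<N}" for j
      using that unfolding qpoch_def by (intro prod_zero bexI[of _ 0]) auto
    then show ?thesis by (simp add: f_def)
  qed
  finally show ?thesis using sum_reciprocals by (simp add: f_def)
qed

text \<open>Up to sign, the sum on the right is \<open>u\<close> times the logarithmic derivative of \<open>\<Prod>i<N. (1 - w ^ i * u) ^ i\<close>.\<close>
lemma log_derivative_identity:
  assumes nz: "u ^ N \<noteq> 1"
  shows "of_nat N * ((\<Sum>j=1..<N. - (w ^ j) / (1 - w ^ j) * qpoch j u) - (of_nat N - 1) / 2 * (1 - u ^ N))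
     = (1 - u ^ N) * (\<Sum>i<N. of_nat i * (w ^ i * u) / (1 - w ^ i * u))"
proof -
  have fac: "1 - w ^ i * u \<noteq> 0" if "i < N" for i
  proof
    assume "1 - w ^ i * u = 0"
    then have "(w ^ i * u) ^ N = 1" by simp
    then have "u ^ N = 1" by (metis mult.commute mult_1 power_N power_mult power_mult_distrib power_one)
    then show False using nz by simp
  qed
  \<comment> \<open>Since (w^i u)^N = u^N, each quotient (1 - u^N) / (1 - w^i u) is a finite
    geometric sum, which clears the denominators.\<close>
  have "(1 - u ^ N) * (\<Sum>i<N. of_nat i * (w ^ i * u) / (1 - w ^ i * u))
      = (\<Sum>i<N. of_nat i * (\<Sum>m<N. (w ^ i * u) ^ Suc m))"
    unfolding sum_distrib_left
  proof (rule sum.cong[OF refl])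
    fix i assume i: "i \<in> {..<N}"
    have "(w ^ i) ^ N = 1" by (metis mult.commute power_N power_mult power_one)
    then have "1 - u ^ N = 1 - (w ^ i * u) ^ N" by (simp add: power_mult_distrib)
    moreover have "(1 - (w ^ i * u) ^ N) / (1 - w ^ i * u) = (\<Sum>m<N. (w ^ i * u) ^ m)"
      using fac[of i] i by (subst sum_gp_strict) auto
    ultimately have "(1 - u ^ N) * (of_nat i * (w ^ i * u) / (1 - w ^ i * u)) = of_nat i * (w ^ i * u) * (\<Sum>m<N. (w ^ i * u) ^ m)"
      by (metis (no_types, lifting) mult.commute times_divide_eq_left times_divide_eq_right)
    then show "(1 - u ^ N) * (of_nat i * (w ^ i * u) / (1 - w ^ i * u)) = (\<Sum>m<N. of_nat i * (w ^ i * u) ^ Suc m)"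
      by (simp add: sum_distrib_left algebra_simps)
  qed
  also have "\<dots> = (\<Sum>m<N. u ^ Suc m * (\<Sum>i<N. of_nat i * w ^ (i * Suc m)))"
    by (subst sum_distrib_left, subst sum.swap)
       (auto simp: sum_distrib_left power_mult_distrib algebra_simps simp flip: power_mult simp del: power_Suc intro!: sum.cong)
  also have "\<dots> = (\<Sum>m=1..<Suc N. u ^ m * (\<Sum>i<N. of_nat i * w ^ (i * m)))"
    by (rule sum.reindex_bij_witness[of _ "\<lambda>j. j - 1" Suc]) auto
  \<comment> \<open>The exponent m = N is split off: there w^(i m) = 1 and the inner sum is N (N -
    1) / 2 instead of N / (w^m - 1).\<close>
  also have "\<dots> = (\<Sum>m=1..<N. u ^ m * (\<Sum>i<N. of_nat i * w ^ (i * m))) + u ^ N * (\<Sum>i<N. of_nat i * w ^ (i * N))"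
    using N_pos by simp
  also have "(\<Sum>m=1..<N. u ^ m * (\<Sum>i<N. of_nat i * w ^ (i * m))) = (\<Sum>m=1..<N. u ^ m * (of_nat N / (w ^ m - 1)))"
    by (rule sum.cong) (auto simp: sum_index_powers)
  also have "\<dots> = - of_nat N * (\<Sum>m=1..<N. u ^ m / (1 - w ^ m))"
    unfolding sum_distrib_left
  proof (rule sum.cong[OF refl])
    fix m assume "m \<in> {1..<N}"
    then have "1 - w ^ m \<noteq> 0" "w ^ m - 1 \<noteq> 0" using primitive[of m] by auto
    then show "u ^ m * (of_nat N / (w ^ m - 1)) = - of_nat N * (u ^ m / (1 - w ^ m))" by (simp add: field_simps)
  qed
  also have "(\<Sum>i<N. of_nat i * w ^ (i * N)) = of_nat N * (of_nat N - 1) / 2"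
  proof -
    have "w ^ (i * N) = 1" for i by (metis mult.commute power_N power_mult power_one)
    moreover have "2 * (\<Sum>i<n. of_nat i :: complex) = of_nat n * (of_nat n - 1)" for n
      by (induction n) (auto simp: algebra_simps)
    ultimately show ?thesis by (simp add: field_simps)
  qed
  finally have R: "(1 - u ^ N) * (\<Sum>i<N. of_nat i * (w ^ i * u) / (1 - w ^ i * u))
     = - of_nat N * (\<Sum>m=1..<N. u ^ m / (1 - w ^ m)) + u ^ N * (of_nat N * (of_nat N - 1) / 2)" .
  have "(\<Sum>j=1..<N. - (w ^ j) / (1 - w ^ j) * qpoch j u) = - (\<Sum>j=1..<N. w ^ j * qpoch j u / (1 - w ^ j))"
    by (simp add: sum_negf)
  also have "\<dots> = (of_nat N - 1) / 2 - (\<Sum>m=1..<N. u ^ m / (1 - w ^ m))"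
    using partial_fraction_identity[of u] by (simp add: algebra_simps)
  finally have L: "(\<Sum>j=1..<N. - (w ^ j) / (1 - w ^ j) * qpoch j u) = (of_nat N - 1) / 2 - (\<Sum>m=1..<N. u ^ m / (1 - w ^ m))" .
  show ?thesis unfolding R L by (simp add: field_simps)
qed

section \<open>Circulant matrices and the discrete Fourier basis\<close>

lemma sum_int_periodic:
  fixes g :: "int \<Rightarrow> complex"
  assumes per: "\<And>n. g (n + int N) = g n"
  shows "(\<Sum>j<N. g (i - int j)) = (\<Sum>n<N. g (int n))"
proof -
  have per': "g (n + int N * k) = g n" for n k
  proof (induction k rule: int_induct[where k = 0])
    case (step1 i) then show ?case using per[of "n + int N * i"] by (simp add: algebra_simps)
  next
    case (step2 i) then show ?case using per[of "n + int N * (i - 1)"] by (simp add: algebra_simps)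
  qed auto
  have gmod: "g (n mod int N) = g n" for n
    using per'[of "n mod int N" "n div int N"] by simp
  show ?thesis
    by (rule sum.reindex_bij_witness[of _ "\<lambda>n. nat ((i - int n) mod int N)" "\<lambda>j. nat ((i - int j) mod int N)"])
       (use N_pos in \<open>auto simp: gmod nat_less_iff mod_diff_right_eq nat_eq_iff zmod_int\<close>)
qed

text \<open>The Fourier vectors with entries w^(- j k) are eigenvectors, so Z V = V D with D
  diagonal. V is invertible because W V is N times the identity, W having the entries w^(j
  k).\<close>

lemma det_circulant:
  fixes a :: "int \<Rightarrow> complex"
  assumes per: "\<And>n. a (n + int N) = a n"
  shows "det (mat N N (\<lambda>(i, j). a (int i - int j))) = (\<Prod>k<N. \<Sum>n<N. w ^ (k * n) * a (int n))"
proof -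
  define S where "S k = (\<Sum>n<N. w ^ (k * n) * a (int n))" for k
  define Z where "Z = mat N N (\<lambda>(i, j). a (int i - int j))"
  define V where "V = mat N N (\<lambda>(j, k). inverse w ^ (j * k))"
  define W where "W = mat N N (\<lambda>(j, k). w ^ (j * k))"
  define D where "D = mat N N (\<lambda>(j, k). if j = k then S k else 0)"
  have car: "Z \<in> carrier_mat N N" "V \<in> carrier_mat N N" "W \<in> carrier_mat N N" "D \<in> carrier_mat N N"
    by (auto simp: Z_def V_def W_def D_def)
  have "Z * V = V * D"
  proof (rule eq_matI)
    fix i k assume ik: "i < dim_row (V * D)" "k < dim_col (V * D)"
    then have ik: "i < N" "k < N" by (auto simp: V_def D_def)
    define g where "g n = a n * (w ^ k) powi n" for n
    have "(w ^ k) powi (int N) = 1" by (simp flip: power_mult) (metis mult.commute power_N power_mult power_one)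
    then have "g (n + int N) = g n" for n
      using w_nonzero by (simp add: g_def per power_int_add)
    then have *: "(\<Sum>j<N. g (int i - int j)) = (\<Sum>n<N. g (int n))" by (rule sum_int_periodic)
    have "(Z * V) $$ (i, k) = (\<Sum>j<N. a (int i - int j) * inverse w ^ (j * k))"
      using ik by (auto simp: Z_def V_def scalar_prod_def lessThan_atLeast0 intro!: sum.cong)
    also have "\<dots> = (\<Sum>j<N. inverse w ^ (i * k) * g (int i - int j))"
    proof (rule sum.cong[OF refl])
      fix j
      have "(w ^ k) powi (int i - int j) = (w ^ k) ^ i / (w ^ k) ^ j"
        using w_nonzero by (simp add: power_int_diff)
      then show "a (int i - int j) * inverse w ^ (j * k) = inverse w ^ (i * k) * g (int i - int j)"
        unfolding g_def using w_nonzero by (simp add: field_simps power_inverse flip: power_mult)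
    qed
    also have "\<dots> = inverse w ^ (i * k) * S k"
      unfolding sum_distrib_left[symmetric] * by (simp add: S_def g_def mult.commute flip: power_mult)
    also have "\<dots> = (V * D) $$ (i, k)"
    proof -
      have "(V * D) $$ (i, k) = (\<Sum>j<N. inverse w ^ (i * j) * (if j = k then S k else 0))"
        using ik by (auto simp: V_def D_def scalar_prod_def lessThan_atLeast0 intro!: sum.cong)
      then show ?thesis using ik by (simp add: sum.delta if_distrib cong: if_cong)
    qed
    finally show "(Z * V) $$ (i, k) = (V * D) $$ (i, k)" .
  qed (auto simp: Z_def V_def D_def)
  then have "det Z * det V = det V * det D" using car by (metis det_mult)
  moreover have "det V \<noteq> 0"
  proof -
    have "W * V = of_nat N \<cdot>\<^sub>m 1\<^sub>m N"
    proof (rule eq_matI)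
      fix i k assume "i < dim_row (of_nat N \<cdot>\<^sub>m 1\<^sub>m N :: complex mat)" "k < dim_col (of_nat N \<cdot>\<^sub>m 1\<^sub>m N :: complex mat)"
      then have ik: "i < N" "k < N" by auto
      have "(W * V) $$ (i, k) = (\<Sum>j<N. w ^ (i * j) * inverse w ^ (j * k))"
        using ik by (auto simp: W_def V_def scalar_prod_def lessThan_atLeast0 intro!: sum.cong)
      \<comment> \<open>Reduction modulo N puts the exponent below N, where any nonzero value makes
        the sum of powers vanish.\<close>
      also have "\<dots> = (\<Sum>j<N. w ^ (j * ((i + (N - k)) mod N)))"
      proof (rule sum.cong[OF refl])
        fix j
        have "w ^ (N - k) * w ^ k = 1" using ik power_N by (simp flip: power_add)
        then have "inverse w ^ k = w ^ (N - k)" using w_nonzero by (simp add: field_simps power_inverse)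
        then have "inverse w ^ (j * k) = (w ^ (N - k)) ^ j" by (metis mult.commute power_mult)
        then have "w ^ (i * j) * inverse w ^ (j * k) = (w ^ (i + (N - k))) ^ j"
          by (simp add: power_add power_mult power_mult_distrib)
        also have "\<dots> = (w ^ ((i + (N - k)) mod N)) ^ j" by (simp only: power_mod_N)
        finally show "w ^ (i * j) * inverse w ^ (j * k) = w ^ (j * ((i + (N - k)) mod N))" by (simp add: mult.commute flip: power_mult)
      qed
      also have "\<dots> = (if i = k then of_nat N else 0)"
      proof (cases "i = k")
        case False
        have "(i + (N - k)) mod N \<noteq> 0"
        proof (cases "i < k")
          case True then show ?thesis using ik by (subst mod_less) auto
        next
          case F: False
          then have "(i + (N - k)) mod N = (i - k) mod N" using ik by (metis (no_types, lifting) Nat.add_diff_assoc2 Nat.diff_add_assoc add.commute leI less_imp_le_nat mod_add_self1)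
          then show ?thesis using F False ik by (simp)
        qed
        then show ?thesis using False sum_powers[of "(i + (N - k)) mod N"] N_pos by simp
      qed (use ik in simp)
      also have "\<dots> = (of_nat N \<cdot>\<^sub>m 1\<^sub>m N) $$ (i, k)" using ik by simp
      finally show "(W * V) $$ (i, k) = (of_nat N \<cdot>\<^sub>m 1\<^sub>m N) $$ (i, k)" .
    qed (auto simp: W_def V_def)
    then have "det W * det V = of_nat N ^ N" using car by (metis det_mult det_smult det_one mult.right_neutral carrier_matD(1) one_carrier_mat carrier_matD(2))
    then show ?thesis using N_pos by auto
  qed
  ultimately have "det Z = det D" by simp
  also have "det D = (\<Prod>k<N. S k)"
  proof -
    have "upper_triangular D" by (auto simp: D_def upper_triangular_def)
    then have "det D = prod_list (diag_mat D)" using car(4) by (rule det_upper_triangular)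
    also have "diag_mat D = map S [0..<N]" by (auto simp: diag_mat_def D_def intro: map_cong)
    finally show ?thesis by (simp add: prod.distinct_set_conv_list[symmetric] lessThan_atLeast0)
  qed
  finally show ?thesis by (simp add: Z_def S_def)
qed

end

section \<open>The hyperbolic kernel\<close>

lemma sinh_eq_0_iff_complex: "sinh (u::complex) = 0 \<longleftrightarrow> (\<exists>n::int. u = \<i> * of_real (of_int n * pi))"
proof -
  have "sinh u = 0 \<longleftrightarrow> sin (\<i> * u) = 0" by (simp add: sinh_conv_sin)
  also have "\<dots> \<longleftrightarrow> (\<exists>n::int. \<i> * u = of_real (of_int n * pi))" by (simp add: sin_eq_0)
  also have "\<dots> \<longleftrightarrow> (\<exists>n::int. u = \<i> * of_real (of_int n * pi))"
  proof
    assume "\<exists>n::int. \<i> * u = of_real (of_int n * pi)"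
    then obtain n :: int where n: "\<i> * u = of_real (of_int n * pi)" by blast
    have "u = - \<i> * (\<i> * u)" by simp
    also have "\<dots> = \<i> * of_real (of_int (- n) * pi)" unfolding n by simp
    finally show "\<exists>n::int. u = \<i> * of_real (of_int n * pi)" by blast
  next
    assume "\<exists>n::int. u = \<i> * of_real (of_int n * pi)"
    then obtain n :: int where n: "u = \<i> * of_real (of_int n * pi)" by blast
    have "\<i> * u = of_real (of_int (- n) * pi)" unfolding n mult.assoc[symmetric] by simp
    then show "\<exists>n::int. \<i> * u = of_real (of_int n * pi)" by blast
  qed
  finally show ?thesis .
qed

lemma sinh_nonzero_strip:
  assumes "0 < Im u" "Im u < pi"
  shows "sinh u \<noteq> 0"
proof
  assume "sinh u = 0"
  then obtain n :: int where "u = \<i> * of_real (of_int n * pi)" unfolding sinh_eq_0_iff_complex by blast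
  then have "Im u = of_int n * pi" by simp
  then have "0 < real_of_int n * pi" "real_of_int n * pi < 1 * pi" using assms by auto
  then have "0 < n" "real_of_int n < 1" by (auto simp: zero_less_mult_iff mult_less_cancel_right)
  then show False by simp
qed

text \<open>For |Re u| >= 1 the smaller exponential is at most half of the larger one, because exp
  (2 r) >= 2. Half of what remains is a quarter.\<close>

lemma norm_sinh_ge:
  fixes u :: complex
  assumes "\<bar>Re u\<bar> \<ge> 1"
  shows "norm (sinh u) \<ge> exp \<bar>Re u\<bar> / 4"
proof -
  define r where "r = \<bar>Re u\<bar>"
  have "exp (2 * r) \<ge> 1 + 2 * r" by (rule exp_ge_add_one_self)
  then have "exp (2 * r) \<ge> 2" using assms unfolding r_def by linarith
  then have "exp r * exp r \<ge> 2" by (simp flip: exp_add)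
  then have "exp (- r) \<le> exp r / 2" by (simp add: exp_minus field_simps)
  moreover have "norm (exp u - exp (- u)) \<ge> \<bar>norm (exp u) - norm (exp (- u))\<bar>" by (rule norm_triangle_ineq3)
  moreover have "\<bar>norm (exp u) - norm (exp (- u))\<bar> = exp r - exp (- r)"
    unfolding r_def by (cases "Re u \<ge> 0") (auto simp: abs_if)
  moreover have "norm (sinh u) = norm (exp u - exp (- u)) / 2" by (simp add: sinh_field_def norm_divide)
  ultimately show ?thesis unfolding r_def by linarith
qed

lemma sinh_holomorphic: "sinh holomorphic_on (A :: complex set)"
  unfolding sinh_field_def[abs_def] by (intro holomorphic_intros) auto

text \<open>Faddeev's kernel for b = sqrt N in the rescaled variable u = w / b, where w b = N u and
  w / b = u.\<close>

definition hyp_kernel :: "nat \<Rightarrow> complex \<Rightarrow> complex" where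
  "hyp_kernel N u = 1 / (4 * sinh (of_nat N * u) * sinh u)"

lemma norm_hyp_kernel_le:
  assumes "N \<ge> 1" "\<bar>t\<bar> \<ge> 1"
  shows "norm (hyp_kernel N (Complex t y)) \<le> 4 * exp (- (real N + 1) * \<bar>t\<bar>)"
proof -
  define u where "u = Complex t y"
  have "real N * \<bar>t\<bar> \<ge> 1 * 1" using assms by (intro mult_mono) auto
  then have "exp \<bar>Re (of_nat N * u)\<bar> / 4 \<le> norm (sinh (of_nat N * u))"
    by (intro norm_sinh_ge) (auto simp: u_def abs_mult)
  then have 1: "exp (real N * \<bar>t\<bar>) / 4 \<le> norm (sinh (of_nat N * u))" by (simp add: u_def abs_mult)
  have 2: "exp \<bar>t\<bar> / 4 \<le> norm (sinh u)" using norm_sinh_ge[of u] assms by (simp add: u_def)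
  have "exp (real N * \<bar>t\<bar>) / 4 * (exp \<bar>t\<bar> / 4) \<le> norm (sinh (of_nat N * u)) * norm (sinh u)"
    using 1 2 by (intro mult_mono) auto
  then have 3: "1 / (4 * (norm (sinh (of_nat N * u)) * norm (sinh u))) \<le> 1 / (4 * (exp (real N * \<bar>t\<bar>) / 4 * (exp \<bar>t\<bar> / 4)))"
    by (intro frac_le mult_left_mono) auto
  have "norm (hyp_kernel N u) = 1 / (4 * (norm (sinh (of_nat N * u)) * norm (sinh u)))"
    by (simp add: hyp_kernel_def norm_divide norm_mult)
  also have "\<dots> \<le> 1 / (4 * (exp (real N * \<bar>t\<bar>) / 4 * (exp \<bar>t\<bar> / 4)))" by (rule 3)
  also have "\<dots> = 4 * exp (- (real N + 1) * \<bar>t\<bar>)"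
    by (simp add: exp_minus field_simps flip: exp_add)
  finally show ?thesis by (simp add: u_def)
qed

lemma sinh_nonzero_low_strip:
  assumes "N \<ge> 1" "0 < Im u" "Im u < pi / real N"
  shows "sinh (of_nat N * u) \<noteq> 0" "sinh u \<noteq> 0" "u \<noteq> 0"
proof -
  show "sinh (of_nat N * u) \<noteq> 0" using assms by (intro sinh_nonzero_strip) (auto simp: field_simps)
  have "pi / real N \<le> pi / 1" using assms by (intro divide_left_mono) auto
  then show "sinh u \<noteq> 0" using assms by (intro sinh_nonzero_strip) auto
  show "u \<noteq> 0" using assms by auto
qed

text \<open>The line runs between the poles 0 and pi i / N. The decay rate N + 1 is the sum of the
  rates of the two sinh factors. The kernel divided by u serves the integral itself, the undivided
  kernel its derivative.\<close>

lemma laplace_line_hyp_kernel: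
  assumes "N \<ge> 1" "0 < e" "e < pi / real N"
  shows "\<exists>B. laplace_line (\<lambda>t. hyp_kernel N (Complex t e) / Complex t e) e (real N + 1) B"
proof -
  define h where "h = (\<lambda>t. hyp_kernel N (Complex t e) / Complex t e)"
  note nz = sinh_nonzero_low_strip[OF assms(1), of "Complex _ e"]
  have nz': "Complex t e \<noteq> 0" for t using nz(3) assms by auto
  have cc: "continuous_on UNIV (\<lambda>t. Complex t e)" by (simp add: Complex_eq continuous_intros)
  have csinh: "continuous_on UNIV (\<lambda>t. sinh (of_nat N * Complex t e))" "continuous_on UNIV (\<lambda>t. sinh (Complex t e))"
    by (auto simp: sinh_field_def intro!: continuous_intros cc)
  have c1: "continuous_on UNIV (\<lambda>t. hyp_kernel N (Complex t e))"
    unfolding hyp_kernel_def using nz assms by (intro continuous_intros csinh) auto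
  have c2: "continuous_on UNIV h"
    unfolding h_def using nz' by (intro continuous_intros cc c1) auto
  obtain B1 where B1: "B1 > 0" "\<And>t. norm (hyp_kernel N (Complex t e)) \<le> B1 * exp (- (real N + 1) * \<bar>t\<bar>)"
    using continuous_decay_bound[OF c1, of 1 4 "real N + 1"] norm_hyp_kernel_le[OF assms(1)] by blast
  have b2: "norm (h t) \<le> 4 * exp (- (real N + 1) * \<bar>t\<bar>)" if "\<bar>t\<bar> \<ge> 1" for t
  proof -
    have "norm (Complex t e) \<ge> 1" using that abs_Re_le_cmod[of "Complex t e"] by simp
    then have "norm (h t) \<le> norm (hyp_kernel N (Complex t e)) / 1"
      unfolding h_def norm_divide by (intro divide_left_mono) auto
    then show ?thesis using norm_hyp_kernel_le[OF assms(1) that, of e] by simp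
  qed
  obtain B2 where B2: "B2 > 0" "\<And>t. norm (h t) \<le> B2 * exp (- (real N + 1) * \<bar>t\<bar>)"
    using continuous_decay_bound[OF c2 b2] by blast
  have le: "B1 * exp x \<le> max B1 B2 * exp x" "B2 * exp x \<le> max B1 B2 * exp x" for x :: real
    by (intro mult_right_mono; simp)+
  have "laplace_line h e (real N + 1) (max B1 B2)"
  proof
    show "norm (h t) \<le> max B1 B2 * exp (- (real N + 1) * \<bar>t\<bar>)" for t
      by (rule order_trans[OF B2(2) le(2)])
    show "norm (Complex t e * h t) \<le> max B1 B2 * exp (- (real N + 1) * \<bar>t\<bar>)" for t
      using order_trans[OF B1(2)[of t] le(1)] nz'[of t] by (simp add: h_def)
  qed (use c2 B1 in auto)
  then show ?thesis unfolding h_def by blast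
qed

text \<open>The height pi / (2 N) is halfway between the poles 0 and pi i / N. The exponent is -2 i
  times Faddeev's argument times w = u sqrt N, and the rate N + 1 of the kernel gives convergence
  for -1 < Re z < N.\<close>

definition log_qdl :: "nat \<Rightarrow> complex \<Rightarrow> complex" where
  "log_qdl N z = integral UNIV (\<lambda>t. exp ((2 * z + 1 - of_nat N) * Complex t (pi / (2 * real N))) *
     (hyp_kernel N (Complex t (pi / (2 * real N))) / Complex t (pi / (2 * real N))))"

text \<open>The derivative of \<open>log_qdl\<close>: differentiation brings down 2 u, which cancels
  the 1 / u and leaves an integrand quasi-periodic under u -> u + pi i.\<close>

definition dlog_qdl :: "nat \<Rightarrow> complex \<Rightarrow> complex" where
  "dlog_qdl N z = 2 * integral UNIV (\<lambda>t. exp ((2 * z + 1 - of_nat N) * Complex t (pi / (2 * real N))) *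
     hyp_kernel N (Complex t (pi / (2 * real N))))"

lemma abs_Re_less_iff: "\<bar>Re (2 * z + 1 - of_nat N)\<bar> < real N + 1 \<longleftrightarrow> - 1 < Re z \<and> Re z < real N"
  by auto

lemma log_qdl_has_field_derivative:
  assumes "N \<ge> 1" "- 1 < Re z" "Re z < real N"
  shows "(log_qdl N has_field_derivative dlog_qdl N z) (at z)"
proof -
  define e where "e = pi / (2 * real N)"
  have e: "0 < e" "e < pi / real N" using assms by (auto simp: e_def field_simps)
  obtain B where B: "laplace_line (\<lambda>t. hyp_kernel N (Complex t e) / Complex t e) e (real N + 1) B"
    using laplace_line_hyp_kernel[OF assms(1) e] by blast
  interpret laplace_line "\<lambda>t. hyp_kernel N (Complex t e) / Complex t e" e "real N + 1" B by (rule B)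
  have eq: "log_qdl N = (\<lambda>z. lap (2 * z + 1 - of_nat N))" unfolding fun_eq_iff log_qdl_def lap_def e_def[symmetric] by simp
  have nz: "Complex t e \<noteq> 0" for t using e by (auto simp: complex_eq_iff)
  have eq': "dlog_qdl N z = lap' (2 * z + 1 - of_nat N) * 2"
    unfolding dlog_qdl_def lap'_def e_def[symmetric] using nz by (simp add: mult_ac)
  have "((\<lambda>z. lap (2 * z + 1 - of_nat N)) has_field_derivative lap' (2 * z + 1 - of_nat N) * 2) (at z)"
    by (rule DERIV_chain2[OF lap_has_field_derivative])
       (use assms abs_Re_less_iff[of z N] in \<open>auto intro!: derivative_eq_intros simp del: minus_complex.sel plus_complex.sel\<close>)
  then show ?thesis by (simp add: eq eq')
qed

lemma log_qdl_tendsto_0: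
  assumes "N \<ge> 1" "- 1 < x" "x < real N"
  shows "((\<lambda>y. log_qdl N (Complex x y)) \<longlongrightarrow> 0) at_top"
proof -
  define e where "e = pi / (2 * real N)"
  have e: "0 < e" "e < pi / real N" using assms by (auto simp: e_def field_simps)
  obtain B where B: "laplace_line (\<lambda>t. hyp_kernel N (Complex t e) / Complex t e) e (real N + 1) B"
    using laplace_line_hyp_kernel[OF assms(1) e] by blast
  interpret laplace_line "\<lambda>t. hyp_kernel N (Complex t e) / Complex t e" e "real N + 1" B by (rule B)
  have eq: "log_qdl N (Complex x y) = lap (Complex (2 * x + 1 - real N) (2 * y))" for y
  proof -
    have "2 * Complex x y + 1 - of_nat N = Complex (2 * x + 1 - real N) (2 * y)" by (simp add: complex_eq_iff)
    then show ?thesis unfolding log_qdl_def lap_def e_def[symmetric] by simp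
  qed
  have "\<bar>2 * x + 1 - real N\<bar> < real N + 1" using assms by auto
  from lap_tendsto_0[OF this e(1)] have "((\<lambda>y. lap (Complex (2 * x + 1 - real N) y)) \<longlongrightarrow> 0) at_top" .
  moreover have "filterlim (\<lambda>y::real. 2 * y) at_top at_top" by real_asymp
  ultimately show ?thesis unfolding eq by (rule filterlim_compose)
qed

section \<open>Contour shift by one period\<close>

text \<open>sinh h / h with its removable singularity filled, used to split off the zeros of both
  sinh factors at pi i.\<close>

definition sinhc :: "complex \<Rightarrow> complex" where
  "sinhc h = (if h = 0 then 1 else sinh h / h)"

lemma sinhc_holomorphic: "sinhc holomorphic_on UNIV"
proof -
  have "(sinh has_field_derivative cosh 0) (at (0::complex))" by (auto intro!: derivative_eq_intros)
  then have d: "deriv sinh (0::complex) = 1" by (simp add: DERIV_imp_deriv)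
  have "(\<lambda>z::complex. if z = 0 then deriv sinh 0 else (sinh z - sinh 0) / (z - 0)) holomorphic_on UNIV"
    by (rule pole_lemma[OF sinh_holomorphic]) auto
  also have "(\<lambda>z::complex. if z = 0 then deriv sinh 0 else (sinh z - sinh 0) / (z - 0)) = sinhc"
    unfolding d by (auto simp: sinhc_def)
  finally show ?thesis .
qed

text \<open>\<open>sinhc\<close> is even, so its derivative at 0 equals its own negative.\<close>

lemma sinhc_deriv_0: "(sinhc has_field_derivative 0) (at 0)"
proof -
  obtain D where D: "(sinhc has_field_derivative D) (at 0)"
    using sinhc_holomorphic by (meson holomorphic_on_imp_differentiable_at open_UNIV UNIV_I field_differentiable_def)
  have D': "(sinhc has_field_derivative D) (at (- (0::complex)))" using D by simp
  have "((\<lambda>h. sinhc (- h)) has_field_derivative D * (- 1)) (at 0)"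
    by (rule DERIV_chain2[where f = sinhc and g = uminus and x = 0, OF D']) (auto intro!: derivative_eq_intros)
  moreover have "(\<lambda>h. sinhc (- h)) = sinhc" by (auto simp: sinhc_def)
  ultimately have "D = - D" using D DERIV_unique by fastforce
  then show ?thesis using D by simp
qed

lemma sinhc_nonzero:
  assumes "\<bar>Im h\<bar> < pi"
  shows "sinhc h \<noteq> 0"
proof (cases "h = 0")
  case False
  have "sinh h \<noteq> 0"
  proof
    assume "sinh h = 0"
    then obtain n :: int where n: "h = \<i> * of_real (of_int n * pi)" unfolding sinh_eq_0_iff_complex by blast
    then have "\<bar>real_of_int n\<bar> < 1" using assms by (simp add: abs_mult)
    then have "n = 0" by linarith
    then show False using n False by simp
  qed
  then show ?thesis using False by (simp add: sinhc_def)
qed (simp add: sinhc_def)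

lemma exp_i_pi_nat: "exp (\<i> * of_real pi * of_nat k) = (- 1) ^ k"
  by (simp add: exp_of_nat2_mult[symmetric] mult.commute exp_of_nat_mult)

lemma exp_minus_i_pi_nat: "exp (- (\<i> * of_real pi * of_nat k)) = (- 1) ^ k"
  unfolding exp_minus exp_i_pi_nat by (simp add: power_inverse flip: power_inverse)

lemma sinh_add_i_pi_nat: "sinh (u + \<i> * of_real pi * of_nat k) = (- 1) ^ k * sinh (u::complex)"
  unfolding sinh_field_def minus_add_distrib exp_add exp_i_pi_nat exp_minus_i_pi_nat by (simp add: field_simps)

text \<open>Both sinh factors vanish at p = pi i, so the integrand is F(u) / (u - p)^2 and the
  residue is F'(p). The \<open>sinhc\<close> factors have derivative 0 at p, so only the exponential
  contributes.\<close>

lemma residue_double_pole: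
  fixes c :: complex
  assumes N: "N \<ge> 1"
  shows "residue (\<lambda>u. 2 * (exp (c * u) * hyp_kernel N u)) (\<i> * of_real pi)
     = - ((- 1) ^ N) * c * exp (c * (\<i> * of_real pi)) / (2 * of_nat N)"
proof -
  define p where "p = \<i> * of_real pi"
  \<comment> \<open>In this strip |Im (N (u - p))| < pi, so neither \<open>sinhc\<close> factor
    vanishes.\<close>
  define A where "A = {u. Im u > pi - pi / real N} \<inter> {u. Im u < pi + pi / real N}"
  \<comment> \<open>\<open>K\<close> collects the 4 of the kernel against the prefactor 2, the signs
    (-1)^N and -1 of the two shifted sinh factors, and the N from sinh (N h) = N h sinhc (N
    h).\<close>
  define K where "K = - (2 * (- 1) ^ N * of_nat N :: complex)"
  have K: "K \<noteq> 0" using N by (auto simp: K_def)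
  define F where "F u = exp (c * u) / (K * sinhc (of_nat N * (u - p)) * sinhc (u - p))" for u
  have A: "open A" "p \<in> A" using N by (auto simp: A_def p_def open_halfspace_Im_gt open_halfspace_Im_lt)
  have nzN: "sinhc (of_nat N * (u - p)) \<noteq> 0" if "u \<in> A" for u
    using that N by (intro sinhc_nonzero) (auto simp: A_def p_def abs_mult abs_if field_simps)
  have nz1: "sinhc (u - p) \<noteq> 0" if "u \<in> A" for u
  proof (rule sinhc_nonzero)
    have "pi / real N \<le> pi / 1" using N by (intro divide_left_mono) auto
    then show "\<bar>Im (u - p)\<bar> < pi" using that by (auto simp: A_def p_def)
  qed
  have hF: "F holomorphic_on A"
    unfolding F_def using nzN nz1 K
    by (intro holomorphic_intros holomorphic_on_compose_gen[OF _ sinhc_holomorphic, unfolded o_def]) auto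
  have dF: "(F has_field_derivative c * exp (c * p) / K) (at p)"
  proof -
    have 1: "((\<lambda>u. sinhc (of_nat N * (u - p))) has_field_derivative 0 * of_nat N) (at p)"
      by (rule DERIV_chain2[of sinhc]) (use sinhc_deriv_0 in \<open>auto intro!: derivative_eq_intros\<close>)
    have 2: "((\<lambda>u. sinhc (u - p)) has_field_derivative 0 * 1) (at p)"
      by (rule DERIV_chain2[of sinhc]) (use sinhc_deriv_0 in \<open>auto intro!: derivative_eq_intros\<close>)
    show ?thesis unfolding F_def
      by (rule derivative_eq_intros 1 2 refl)+ (use K in \<open>auto simp: sinhc_def field_simps\<close>)
  qed
  have "residue (\<lambda>u. 2 * (exp (c * u) * hyp_kernel N u)) p = residue (\<lambda>u. F u / (u - p) ^ Suc 1) p"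
  proof (rule residue_cong)
    show "\<forall>\<^sub>F u in at p. 2 * (exp (c * u) * hyp_kernel N u) = F u / (u - p) ^ Suc 1"
    proof -
      have "2 * (exp (c * u) * hyp_kernel N u) = F u / (u - p) ^ Suc 1" if "u \<noteq> p" for u
      proof -
        have "of_nat N * u = of_nat N * (u - p) + \<i> * of_real pi * of_nat N" by (simp add: p_def algebra_simps)
        then have 1: "sinh (of_nat N * u) = (- 1) ^ N * sinh (of_nat N * (u - p))" by (simp only: sinh_add_i_pi_nat)
        have "u = (u - p) + \<i> * of_real pi * of_nat 1" by (simp add: p_def)
        then have 2: "sinh u = - sinh (u - p)" by (metis sinh_add_i_pi_nat power_one_right mult_minus1)
        have 3: "2 * (E * (1 / (4 * (m * a) * (- b)))) = E / (- (2 * m * n) * (a / (n * h)) * (b / h)) / h ^ Suc 1"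
          if "h \<noteq> 0" "n \<noteq> 0" for E m a b n h :: complex
          using that by (simp add: divide_simps power2_eq_square)
        have h: "u - p \<noteq> 0" "of_nat N * (u - p) \<noteq> 0" "of_nat N \<noteq> (0::complex)" using that N by auto
        show ?thesis unfolding hyp_kernel_def 1 2 F_def K_def sinhc_def if_not_P[OF h(1)] if_not_P[OF h(2)]
          by (rule 3[OF h(1) h(3)])
      qed
      then show ?thesis by (simp add: eventually_at_filter)
    qed
  qed auto
  also have "\<dots> = (deriv ^^ 1) F p / fact 1"
    using A hF by (rule residue_holomorphic_over_power)
  also have "\<dots> = c * exp (c * p) / K" using dF by (simp add: DERIV_imp_deriv)
  also have "\<dots> = - ((- 1) ^ N) * c * exp (c * p) / (2 * of_nat N)"
    unfolding K_def using N by (cases "even N") (simp_all add: field_simps)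
  finally show ?thesis by (simp add: p_def)
qed

lemma omega_pow_power: "omega_pow N z ^ k = omega_pow N (of_nat k * z)"
  unfolding omega_pow_def by (simp add: exp_of_nat_mult[symmetric] algebra_simps)

lemma omega_pow_add: "omega_pow N (a + b) = omega_pow N a * omega_pow N b"
  unfolding omega_pow_def by (simp add: algebra_simps add_divide_distrib exp_add)

lemma omega_pow_N: "N \<ge> 1 \<Longrightarrow> omega_pow N (of_nat N * z) = exp2pi z"
  unfolding omega_pow_def by (simp add: mult_ac)

lemma omega_pow_1_primitive: "N \<ge> 1 \<Longrightarrow> primitive_root_of_unity N (omega_pow N 1)"
proof
  assume N: "N \<ge> 1"
  show "0 < N" using N by simp
  show "omega_pow N 1 ^ N = 1" unfolding omega_pow_power omega_pow_N[OF N] by (simp add: exp_two_pi_i)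
  fix j assume j: "0 < j" "j < N"
  show "omega_pow N 1 ^ j \<noteq> 1"
  proof
    assume "omega_pow N 1 ^ j = 1"
    then have "exp (2 * of_real pi * \<i> * of_nat j / of_nat N) = 1" by (simp add: omega_pow_power, simp add: omega_pow_def)
    then obtain n :: int where "2 * pi * real j / real N = of_int (2 * n) * pi"
      unfolding exp_eq_1 by auto
    then have "real j = real_of_int n * real N" using N by (simp add: field_simps)
    then have "int j = n * int N" by (metis of_int_eq_iff of_int_mult of_int_of_nat_eq)
    then show False using j by (metis dvd_triv_right nat_dvd_not_less of_nat_dvd_iff)
  qed
qed

text \<open>Here only sinh (N u) vanishes, so the pole is simple. With E = exp p one has E^2 = w^k,
  which turns E / (2 sinh p) into the stated rational expression in w^k.\<close>

lemma residue_simple_poles: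
  assumes N: "N \<ge> 1" and k: "0 < k" "k < N"
  shows "residue (\<lambda>u. 2 * (exp ((2 * z + 1 - of_nat N) * u) * hyp_kernel N u)) (\<i> * of_real (pi * real k / real N))
     = 1 / of_nat N * (- (omega_pow N 1 ^ k) / (1 - omega_pow N 1 ^ k) * omega_pow N z ^ k)"
proof -
  define c where "c = 2 * z + 1 - of_nat N"
  define p where "p = \<i> * of_real (pi * real k / real N)"
  define S where "S = {u. Im u > 0} \<inter> {u. Im u < pi}"
  have S: "open S" "connected S"
    by (auto simp: S_def intro!: open_halfspace_Im_gt open_halfspace_Im_lt convex_connected convex_Int convex_halfspace_Im_gt convex_halfspace_Im_lt)
  have p: "p \<in> S" using k N by (auto simp: S_def p_def field_simps)
  have nz: "sinh u \<noteq> 0" if "u \<in> S" for u using that by (intro sinh_nonzero_strip) (auto simp: S_def)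
  have Np: "of_nat N * p = \<i> * of_real pi * of_nat k" using N by (simp add: p_def)
  have cosh: "cosh (of_nat N * p) = (- 1) ^ k"
    unfolding Np cosh_field_def exp_i_pi_nat exp_minus_i_pi_nat by simp
  have "residue (\<lambda>u. exp (c * u) / (2 * sinh u) / sinh (of_nat N * u)) p
     = exp (c * p) / (2 * sinh p) / (of_nat N * cosh (of_nat N * p))"
  proof (rule residue_simple_pole_deriv[OF _ _ S p])
    show "(\<lambda>u. exp (c * u) / (2 * sinh u)) holomorphic_on S"
      using nz by (intro holomorphic_intros sinh_holomorphic) auto
    show "(\<lambda>u. sinh (of_nat N * u)) holomorphic_on S"
      by (intro holomorphic_on_compose_gen[OF _ sinh_holomorphic, of _ _ UNIV, unfolded o_def] holomorphic_intros) auto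
    show "((\<lambda>u. sinh (of_nat N * u)) has_field_derivative of_nat N * cosh (of_nat N * p)) (at p)"
      by (auto intro!: derivative_eq_intros)
    show "sinh (of_nat N * p) = 0"
      unfolding Np sinh_field_def exp_i_pi_nat exp_minus_i_pi_nat by simp
  qed (use nz[OF p] N cosh in auto)
  also have "(\<lambda>u. exp (c * u) / (2 * sinh u) / sinh (of_nat N * u)) = (\<lambda>u. 2 * (exp (c * u) * hyp_kernel N u))"
    by (auto simp: hyp_kernel_def fun_eq_iff field_simps)
  finally have 1: "residue (\<lambda>u. 2 * (exp (c * u) * hyp_kernel N u)) p = exp (c * p) / (2 * sinh p) / (of_nat N * (- 1) ^ k)"
    unfolding cosh .
  define E where "E = exp p"
  have E: "E \<noteq> 0" "E * E = omega_pow N 1 ^ k"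
    unfolding E_def omega_pow_power by (auto simp: p_def omega_pow_def exp_add[symmetric] field_simps)
  \<comment> \<open>The three summands give omega^(k z), E and (-1)^k; the sign cancels against cosh
    (N p) = (-1)^k.\<close>
  have "c * p = of_nat k * (2 * of_real pi * \<i> * z / of_nat N) + p + (- (\<i> * of_real pi * of_nat k))"
    using N by (simp add: c_def p_def field_simps)
  then have ec: "exp (c * p) = omega_pow N z ^ k * E * (- 1) ^ k"
    unfolding E_def by (simp only: exp_add exp_minus_i_pi_nat omega_pow_def exp_of_nat_mult)
  have sp: "2 * sinh p = E - 1 / E" unfolding sinh_field_def E_def by (simp add: exp_minus field_simps)
  have ne: "1 - E * E \<noteq> 0"
    using primitive_root_of_unity.primitive[OF omega_pow_1_primitive[OF N] k] E by simp
  then have ne2: "E - 1 / E \<noteq> 0" using E by (simp add: field_simps)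
  have "exp (c * p) / (2 * sinh p) / (of_nat N * (- 1) ^ k) = 1 / of_nat N * (omega_pow N z ^ k * (E / (E - 1 / E)))"
    unfolding ec sp by simp
  also have "E / (E - 1 / E) = - (E * E) / (1 - E * E)" using ne ne2 E(1) by (simp add: divide_simps) (simp add: algebra_simps)
  finally show ?thesis using 1 unfolding E(2) c_def p_def by (simp add: mult_ac)
qed

text \<open>Adding pi i to u multiplies the kernel by -(-1)^N and the exponential by x times the
  same sign, so the integrals along the two lines differ by the factor x. Between them lie the
  points pi i k / N with 1 <= k <= N: those with k < N give the sum, and the double pole k = N gives
  the term linear in z.\<close>

theorem dlog_qdl_closed_form:
  assumes N: "N \<ge> 1" and z: "- 1 < Re z" "Re z < real N"
  defines "x \<equiv> exp2pi z"
  shows "(1 - x) * dlog_qdl N z = 2 * of_real pi * \<i> / of_nat N * ((z - (of_nat N - 1) / 2) * x +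
     (\<Sum>j=1..<N. - (omega_pow N 1 ^ j) / (1 - omega_pow N 1 ^ j) * omega_pow N z ^ j))"
proof -
  define e where "e = pi / (2 * real N)"
  define c where "c = 2 * z + 1 - of_nat N"
  define f where "f = (\<lambda>u. 2 * (exp (c * u) * hyp_kernel N u))"
  define P where "P = (\<lambda>k. \<i> * of_real (pi * real k / real N))"
  define pts where "pts = P ` {1..N}"
  have e: "0 < e" "e < pi / real N" using N by (auto simp: e_def field_simps)
  have c: "\<bar>Re c\<bar> < real N + 1" unfolding c_def abs_Re_less_iff using z by simp
  have K: "dlog_qdl N z = integral UNIV (\<lambda>t. f (Complex t e))"
    unfolding dlog_qdl_def f_def c_def e_def by simp
  have per: "f (Complex t (e + pi)) = x * f (Complex t e)" for t
  proof -
    define u where "u = Complex t e"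
    have u: "Complex t (e + pi) = u + \<i> * of_real pi * of_nat 1" by (simp add: u_def complex_eq_iff)
    have "of_nat N * (u + \<i> * of_real pi * of_nat 1) = of_nat N * u + \<i> * of_real pi * of_nat N" by (simp add: algebra_simps)
    then have h: "hyp_kernel N (u + \<i> * of_real pi * of_nat 1) = - ((- 1) ^ N) * hyp_kernel N u"
      unfolding hyp_kernel_def by (cases "even N") (simp_all only: sinh_add_i_pi_nat, simp_all)
    have "c * (u + \<i> * of_real pi * of_nat 1) = c * u + 2 * of_real pi * \<i> * z + \<i> * of_real pi * of_nat 1 + - (\<i> * of_real pi * of_nat N)"
      by (simp add: c_def algebra_simps)
    then have "exp (c * (u + \<i> * of_real pi * of_nat 1)) = exp (c * u) * x * (- 1) ^ 1 * (- 1) ^ N"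
      unfolding x_def by (simp only: exp_add exp_i_pi_nat exp_minus_i_pi_nat)
    then show ?thesis unfolding f_def u u_def[symmetric] h by (simp add: flip: power_mult_distrib)
  qed
  \<comment> \<open>The bounds 0 and pi + pi / N are the heights of the nearest poles outside the
    rectangle.\<close>
  have "integral UNIV (\<lambda>t. f (Complex t e)) - integral UNIV (\<lambda>t. f (Complex t (e + pi)))
      = 2 * of_real pi * \<i> * (\<Sum>p\<in>pts. residue f p)"
  proof (rule horizontal_line_shift[where \<alpha> = 0 and \<beta> = "pi + pi / real N" and T = 1])
    fix p assume "p \<in> pts"
    then obtain k where k: "p = P k" "1 \<le> k" "k \<le> N" by (auto simp: pts_def)
    then have "pi * real k / real N \<le> pi" "pi * real k / real N \<ge> pi / real N" using N by (auto simp: field_simps)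
    then show "e < Im p \<and> Im p < e + pi" using e k by (simp add: P_def)
  next
    have "sinh (of_nat N * u) \<noteq> 0" "sinh u \<noteq> 0" if u: "0 < Im u" "Im u < pi + pi / real N" "u \<notin> pts" for u
    proof -
      show "sinh (of_nat N * u) \<noteq> 0"
      proof
        assume "sinh (of_nat N * u) = 0"
        then obtain n :: int where n: "of_nat N * u = \<i> * of_real (of_int n * pi)" unfolding sinh_eq_0_iff_complex by blast
        have i: "real N * Im u = of_int n * pi" using arg_cong[OF n, of Im] by simp
        have "0 < real N * Im u" using u N by simp
        then have n0: "n > 0" unfolding i by (simp add: zero_less_mult_iff)
        have "real N * Im u < (real N + 1) * pi" using u N by (simp add: field_simps)
        then have "real_of_int n < real N + 1" unfolding i by (simp only: mult_less_cancel_right_pos[OF pi_gt_zero])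
        then have "nat n \<in> {1..N}" using n0 by auto
        moreover have "u = P (nat n)" using n n0 N by (simp add: P_def field_simps)
        ultimately show False using u by (auto simp: pts_def)
      qed
      show "sinh u \<noteq> 0"
      proof
        assume "sinh u = 0"
        then obtain n :: int where n: "u = \<i> * of_real (of_int n * pi)" unfolding sinh_eq_0_iff_complex by blast
        have i: "Im u = of_int n * pi" using arg_cong[OF n, of Im] by simp
        have n0: "n > 0" using u unfolding i by (simp add: zero_less_mult_iff)
        have "pi / real N \<le> pi / 1" using N by (intro divide_left_mono) auto
        then have "Im u < 2 * pi" using u by simp
        then have "real_of_int n < 2" unfolding i by (simp only: mult_less_cancel_right_pos[OF pi_gt_zero])
        then have "n = 1" using n0 by linarith
        then have "u = P N" using n N by (simp add: P_def)
        then show False using u N by (auto simp: pts_def)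
      qed
    qed
    then show "f holomorphic_on {z. 0 < Im z \<and> Im z < pi + pi / real N} - pts"
      unfolding f_def hyp_kernel_def
      by (intro holomorphic_intros holomorphic_on_compose_gen[OF _ sinh_holomorphic, of _ _ UNIV, unfolded o_def] sinh_holomorphic) auto
  next
    fix t y :: real assume t: "1 \<le> \<bar>t\<bar>" and y: "e \<le> y" "y \<le> e + pi"
    have "norm (f (Complex t y)) = 2 * (exp (Re c * t - Im c * y) * norm (hyp_kernel N (Complex t y)))"
      by (simp add: f_def norm_mult)
    also have "\<dots> \<le> 2 * (exp (\<bar>Re c\<bar> * \<bar>t\<bar> + \<bar>Im c\<bar> * (e + pi)) * (4 * exp (- (real N + 1) * \<bar>t\<bar>)))"
    proof (intro mult_left_mono mult_mono norm_hyp_kernel_le N t)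
      have "Re c * t \<le> \<bar>Re c\<bar> * \<bar>t\<bar>" by (metis abs_ge_self abs_mult)
      moreover have "- Im c * y \<le> \<bar>Im c\<bar> * (e + pi)" using y e by (intro mult_mono) auto
      ultimately show "exp (Re c * t - Im c * y) \<le> exp (\<bar>Re c\<bar> * \<bar>t\<bar> + \<bar>Im c\<bar> * (e + pi))" by simp
    qed auto
    also have "\<dots> = 8 * exp (\<bar>Im c\<bar> * (e + pi)) * exp (- (real N + 1 - \<bar>Re c\<bar>) * \<bar>t\<bar>)"
      by (simp add: algebra_simps flip: exp_add)
    finally show "norm (f (Complex t y)) \<le> 8 * exp (\<bar>Im c\<bar> * (e + pi)) * exp (- (real N + 1 - \<bar>Re c\<bar>) * \<bar>t\<bar>)" .
  qed (use e c in \<open>auto simp: pts_def\<close>)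
  then have "(1 - x) * dlog_qdl N z = 2 * of_real pi * \<i> * (\<Sum>p\<in>pts. residue f p)"
    unfolding K per by (simp add: algebra_simps)
  also have "(\<Sum>p\<in>pts. residue f p) = (\<Sum>k=1..N. residue f (P k))"
    unfolding pts_def using N by (intro sum.reindex[unfolded o_def] inj_onI) (auto simp: P_def)
  also have "\<dots> = (\<Sum>k=1..<N. residue f (P k)) + residue f (P N)"
    using N by (metis sum.last_plus add.commute)
  also have "(\<Sum>k=1..<N. residue f (P k)) = (\<Sum>k=1..<N. 1 / of_nat N * (- (omega_pow N 1 ^ k) / (1 - omega_pow N 1 ^ k) * omega_pow N z ^ k))"
    unfolding f_def P_def c_def using N by (intro sum.cong refl residue_simple_poles) auto
  also have "residue f (P N) = 1 / of_nat N * ((z - (of_nat N - 1) / 2) * x)"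
  proof -
    have "c * (\<i> * of_real pi) = 2 * of_real pi * \<i> * z + \<i> * of_real pi * of_nat 1 + - (\<i> * of_real pi * of_nat N)"
      by (simp add: c_def algebra_simps)
    then have e: "exp (c * (\<i> * of_real pi)) = x * (- 1) ^ 1 * (- 1) ^ N"
      unfolding x_def by (simp only: exp_add exp_i_pi_nat exp_minus_i_pi_nat)
    have "P N = \<i> * of_real pi" using N by (simp add: P_def)
    then have "residue f (P N) = - ((- 1) ^ N) * c * exp (c * (\<i> * of_real pi)) / (2 * of_nat N)"
      unfolding f_def using residue_double_pole[OF N] by simp
    also have "\<dots> = c * x / (2 * of_nat N)" unfolding e by (cases "even N") simp_all
    finally show ?thesis by (simp add: c_def field_simps)
  qed
  finally have *: "(1 - x) * dlog_qdl N z = 2 * of_real pi * \<i> * (1 / of_nat N * (\<Sum>k=1..<N. - (omega_pow N 1 ^ k) / (1 - omega_pow N 1 ^ k) * omega_pow N z ^ k)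
      + 1 / of_nat N * ((z - (of_nat N - 1) / 2) * x))"
    unfolding sum_distrib_left .
  have gen: "a * (1 / n * s + 1 / n * t) = a / n * (t + s)" for a n s t :: complex
    by (simp add: divide_inverse algebra_simps)
  show ?thesis unfolding * gen ..
qed

section \<open>The integral formula in the strip\<close>

lemma not_Ints_between:
  fixes r :: real
  assumes "of_int m < r" "r < of_int m + 1"
  shows "r \<notin> \<int>"
proof
  assume "r \<in> \<int>"
  then obtain n :: int where "r = of_int n" by (elim Ints_cases)
  then have "real_of_int m < real_of_int n" "real_of_int n < real_of_int (m + 1)" using assms by auto
  then have "m < n" "n < m + 1" by (simp_all only: of_int_less_iff)
  then show False by simp
qed

text \<open>The integrand is holomorphic for 0 < Im u < pi / N, so moving the line meets no residue.
  This is what relates the fixed height in \<open>log_qdl\<close> to the heights tending to 0 in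
  Faddeev's integral.\<close>

lemma log_qdl_line_independent:
  assumes N: "N \<ge> 1" and z: "- 1 < Re z" "Re z < real N" and e: "0 < e" "e < pi / real N"
  defines "g \<equiv> \<lambda>u. exp ((2 * z + 1 - of_nat N) * u) * (hyp_kernel N u / u)"
  shows "integral UNIV (\<lambda>t. g (Complex t e)) = log_qdl N z"
proof -
  define c where "c = 2 * z + 1 - of_nat N"
  have c: "\<bar>Re c\<bar> < real N + 1" unfolding c_def abs_Re_less_iff using z by simp
  have aux: "integral UNIV (\<lambda>t. g (Complex t y1)) - integral UNIV (\<lambda>t. g (Complex t y2)) = 0"
    if y: "0 < y1" "y1 < y2" "y2 < pi / real N" for y1 y2
  proof -
    have "integral UNIV (\<lambda>t. g (Complex t y1)) - integral UNIV (\<lambda>t. g (Complex t y2))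
      = 2 * of_real pi * \<i> * (\<Sum>p\<in>{}. residue g p)"
    proof (rule horizontal_line_shift[where \<alpha> = 0 and \<beta> = "pi / real N" and T = 1])
      show "g holomorphic_on {z. 0 < Im z \<and> Im z < pi / real N} - {}"
        unfolding g_def hyp_kernel_def using sinh_nonzero_low_strip[OF N]
        by (intro holomorphic_intros holomorphic_on_compose_gen[OF _ sinh_holomorphic, of _ _ UNIV, unfolded o_def] sinh_holomorphic) auto
      show "0 < real N + 1 - \<bar>Re c\<bar>" using c by simp
      fix t y :: real assume t: "1 \<le> \<bar>t\<bar>" and y': "y1 \<le> y" "y \<le> y2"
      have "norm (Complex t y) \<ge> 1" using t abs_Re_le_cmod[of "Complex t y"] by simp
      then have "norm (hyp_kernel N (Complex t y)) / norm (Complex t y) \<le> norm (hyp_kernel N (Complex t y)) / 1"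
        by (intro divide_left_mono) auto
      then have h: "norm (hyp_kernel N (Complex t y) / Complex t y) \<le> 4 * exp (- (real N + 1) * \<bar>t\<bar>)"
        using norm_hyp_kernel_le[OF N t, of y] by (simp add: norm_divide)
      have "norm (g (Complex t y)) = exp (Re c * t - Im c * y) * norm (hyp_kernel N (Complex t y) / Complex t y)"
        unfolding g_def norm_mult c_def by simp
      also have "\<dots> \<le> exp (\<bar>Re c\<bar> * \<bar>t\<bar> + \<bar>Im c\<bar> * y2) * (4 * exp (- (real N + 1) * \<bar>t\<bar>))"
      proof (intro mult_mono h)
        have "Re c * t \<le> \<bar>Re c\<bar> * \<bar>t\<bar>" by (metis abs_ge_self abs_mult)
        moreover have "- Im c * y \<le> \<bar>Im c\<bar> * y2" using y y' by (intro mult_mono) auto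
        ultimately show "exp (Re c * t - Im c * y) \<le> exp (\<bar>Re c\<bar> * \<bar>t\<bar> + \<bar>Im c\<bar> * y2)" by simp
      qed auto
      also have "\<dots> = 4 * exp (\<bar>Im c\<bar> * y2) * exp (- (real N + 1 - \<bar>Re c\<bar>) * \<bar>t\<bar>)"
        by (simp add: algebra_simps flip: exp_add)
      finally show "norm (g (Complex t y)) \<le> 4 * exp (\<bar>Im c\<bar> * y2) * exp (- (real N + 1 - \<bar>Re c\<bar>) * \<bar>t\<bar>)" .
    qed (use y in auto)
    then show ?thesis by simp
  qed
  define e0 where "e0 = pi / (2 * real N)"
  have e0: "0 < e0" "e0 < pi / real N" using N by (auto simp: e0_def field_simps)
  have "integral UNIV (\<lambda>t. g (Complex t e)) = integral UNIV (\<lambda>t. g (Complex t e0))"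
    using aux[of e e0] aux[of e0 e] e e0 by (cases e e0 rule: linorder_cases) auto
  then show ?thesis unfolding log_qdl_def e0_def[symmetric] g_def by simp
qed

definition qdl :: "nat \<Rightarrow> complex \<Rightarrow> complex" where
  "qdl N z = exp (log_qdl N z)"

text \<open>The point at which \<open>Lambda N z\<close> evaluates Faddeev's function. The map
  carries -1 < Re z < N onto the strip |Im| < c_b of the integral formula.\<close>

definition qdl_arg :: "nat \<Rightarrow> complex \<Rightarrow> complex" where
  "qdl_arg N z = \<i> * z / of_real (sqrt (real N))
       - \<i> / 2 * of_real (sqrt (real N) + 1 / sqrt (real N))
       + \<i> / of_real (sqrt (real N))"

text \<open>With s = sqrt N, rescaling turns the line at height eps into the one at height eps / s.
  Once eps < pi / s its integral already equals \<open>log_qdl N z\<close>, so the one-sided limit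
  is that of an eventually constant function.\<close>

lemma faddeev_strip_qdl_arg:
  assumes N: "N \<ge> 1" and z: "- 1 < Re z" "Re z < real N"
  shows "faddeev_strip (sqrt (real N)) (qdl_arg N z) = qdl N z"
proof -
  define s where "s = sqrt (real N)"
  have s: "s > 0" "s * s = real N" using N by (auto simp: s_def)
  have sc: "complex_of_real s \<noteq> 0" "complex_of_real s * complex_of_real s = of_nat N"
    using s by (auto simp flip: of_real_mult)
  define g where "g = (\<lambda>u. exp ((2 * z + 1 - of_nat N) * u) * (hyp_kernel N u / u))"
  have I: "integral UNIV (\<lambda>t. faddeev_integrand s (qdl_arg N z) (of_real t + \<i> * of_real eps)) = log_qdl N z"
    if eps: "0 < eps" "eps < pi / s" for eps
  proof -
    define e where "e = eps / s"
    have e: "0 < e" "e < pi / real N" using eps s unfolding s(2)[symmetric] by (auto simp: e_def field_simps)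
    obtain B where B: "laplace_line (\<lambda>t. hyp_kernel N (Complex t e) / Complex t e) e (real N + 1) B"
      using laplace_line_hyp_kernel[OF N e] by blast
    interpret laplace_line "\<lambda>t. hyp_kernel N (Complex t e) / Complex t e" e "real N + 1" B by (rule B)
    have c: "\<bar>Re (2 * z + 1 - of_nat N)\<bar> < real N + 1" unfolding abs_Re_less_iff using z by simp
    have int: "(\<lambda>t. g (Complex t e)) integrable_on UNIV"
      unfolding g_def by (rule integrable_lap(1)[OF c])
    have int': "(\<lambda>t. g (Complex (t / s) e)) integrable_on UNIV"
    proof (rule integrable_on_UNIV_decay)
      have "continuous_on UNIV (\<lambda>t. g (Complex t e))"
        unfolding g_def by (intro continuous_intros cont_h cont_Complex)
      then show "continuous_on UNIV (\<lambda>t. g (Complex (t / s) e))"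
        by (rule continuous_on_compose2) (use s in \<open>auto intro!: continuous_intros\<close>)
      show "0 < (real N + 1 - \<bar>Re (2 * z + 1 - of_nat N)\<bar>) / s" using c s by simp
      show "norm (g (Complex (t / s) e)) \<le> B * exp (- e * Im (2 * z + 1 - of_nat N)) *
         exp (- ((real N + 1 - \<bar>Re (2 * z + 1 - of_nat N)\<bar>) / s) * \<bar>t\<bar>)" for t
      proof -
        have eq: "- (A / s) * \<bar>t\<bar> = - A * \<bar>t / s\<bar>" for A using s(1) by simp
        show ?thesis unfolding eq g_def by (rule norm_kernel[OF h_bound])
      qed
    qed
    have pt: "faddeev_integrand s (qdl_arg N z) (of_real t + \<i> * of_real eps) = g (Complex (t / s) e) / of_real s" for t
    proof -
      define u where "u = Complex (t / s) e"
      have w: "of_real t + \<i> * of_real eps = u * of_real s"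
        using s by (simp add: u_def e_def complex_eq_iff)
      have un: "u \<noteq> 0" using e by (auto simp: u_def complex_eq_iff)
      have 1: "- 2 * \<i> * qdl_arg N z * (u * of_real s) = (2 * z + 1 - of_nat N) * u"
      proof -
        have "qdl_arg N z = \<i> / of_real s * (z + 1 - (of_real s * of_real s + 1) / 2)"
          unfolding qdl_arg_def s_def[symmetric] using sc(1) by (simp add: field_simps)
        then have "- 2 * \<i> * qdl_arg N z * (u * of_real s) = 2 * (z + 1 - (of_real s * of_real s + 1) / 2) * u * (- (\<i> * \<i>))"
          using sc(1) by (simp add: mult_ac)
        moreover have "2 * (z + 1 - (n + 1) / 2) * u * (- (\<i> * \<i>)) = (2 * z + 1 - n) * u" for n
          by (simp add: field_simps)
        ultimately show ?thesis unfolding sc(2) by simp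
      qed
      have 2: "u * of_real s * of_real s = of_nat N * u" "u * of_real s / of_real s = u" using sc by (auto simp: mult_ac)
      show ?thesis unfolding faddeev_integrand_def w 1 2 g_def hyp_kernel_def u_def[symmetric]
        by simp
    qed
    have "integral UNIV (\<lambda>t. faddeev_integrand s (qdl_arg N z) (of_real t + \<i> * of_real eps))
       = integral UNIV (\<lambda>t. g (Complex (t / s) e)) / of_real s"
      unfolding pt by simp
    also have "\<dots> = integral UNIV (\<lambda>t. g (Complex t e))"
      using integral_UNIV_stretch[OF s(1) int int'] sc by simp
    also have "\<dots> = log_qdl N z"
      unfolding g_def by (rule log_qdl_line_independent[OF N z e])
    finally show ?thesis .
  qed
  have "((\<lambda>eps. integral UNIV (\<lambda>t. faddeev_integrand s (qdl_arg N z) (of_real t + \<i> * of_real eps))) \<longlongrightarrow> log_qdl N z) (at_right 0)"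
  proof (rule tendsto_eventually)
    have "\<forall>\<^sub>F eps in at_right 0. 0 < eps \<and> eps < pi / s"
      using s by (intro eventually_conj eventually_at_right_less) (auto simp: eventually_at_right_field intro!: exI[of _ "pi / s"])
    then show "\<forall>\<^sub>F eps in at_right 0. integral UNIV (\<lambda>t. faddeev_integrand s (qdl_arg N z) (of_real t + \<i> * of_real eps)) = log_qdl N z"
      by eventually_elim (use I in auto)
  qed
  then have "Lim (at_right 0) (\<lambda>eps. integral UNIV (\<lambda>t. faddeev_integrand s (qdl_arg N z) (of_real t + \<i> * of_real eps))) = log_qdl N z"
    by (intro tendsto_Lim) auto
  then show ?thesis unfolding faddeev_strip_def qdl_def s_def[symmetric] by simp
qed

section \<open>Functional equations\<close>

lemma qdl_has_field_derivative:
  assumes "N \<ge> 1" "- 1 < Re z" "Re z < real N"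
  shows "(qdl N has_field_derivative qdl N z * dlog_qdl N z) (at z)"
  unfolding qdl_def[abs_def] using log_qdl_has_field_derivative[OF assms]
  by (auto intro!: derivative_eq_intros)

lemma qdl_tendsto_1:
  assumes "N \<ge> 1" "- 1 < x" "x < real N"
  shows "((\<lambda>y. qdl N (Complex x y)) \<longlongrightarrow> 1) at_top"
  using tendsto_exp[OF log_qdl_tendsto_0[OF assms]] by (simp add: qdl_def)

lemma exp_2pi_i_eq_1_iff: "exp2pi z = 1 \<longleftrightarrow> z \<in> \<int>"
proof
  assume "exp2pi z = 1"
  then obtain n :: int where n: "Re (2 * of_real pi * \<i> * z) = 0" "Im (2 * of_real pi * \<i> * z) = of_int (2 * n) * pi"
    unfolding exp_eq_1 by auto
  then have "z = of_int n" by (simp add: complex_eq_iff)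
  then show "z \<in> \<int>" by simp
next
  assume "z \<in> \<int>"
  then obtain n :: int where "z = of_int n" by (auto elim: Ints_cases)
  then show "exp2pi z = 1"
    unfolding exp_eq_1 by (auto intro!: exI[of _ n])
qed

lemma Re_not_int_imp:
  assumes "Re z \<notin> \<int>"
  shows "exp2pi z \<noteq> 1"
  using assms unfolding exp_2pi_i_eq_1_iff by (auto elim!: Ints_cases)

lemma omega_pow_tendsto_0:
  assumes "N \<ge> 1"
  shows "((\<lambda>y. omega_pow N (Complex x y)) \<longlongrightarrow> 0) at_top"
proof (rule tendsto_norm_zero_cancel)
  have "norm (omega_pow N (Complex x y)) = exp (- (2 * pi / real N) * y)" for y
    by (simp add: omega_pow_def)
  moreover have "((\<lambda>y. exp (- (2 * pi / real N) * y)) \<longlongrightarrow> 0) at_top" using assms by real_asymp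
  ultimately show "((\<lambda>y. norm (omega_pow N (Complex x y))) \<longlongrightarrow> 0) at_top" by simp
qed

lemma omega_pow_has_field_derivative:
  "(omega_pow N has_field_derivative 2 * of_real pi * \<i> / of_nat N * omega_pow N z) (at z)"
  unfolding omega_pow_def[abs_def] by (cases "N = 0") (auto intro!: derivative_eq_intros)

text \<open>Integrates an identity between derivatives: zero derivative on a convex strip forces a
  constant, which is read off along the vertical ray above z.\<close>

lemma vertical_strip_constant:
  fixes f :: "complex \<Rightarrow> complex"
  assumes "\<And>z. a < Re z \<Longrightarrow> Re z < b \<Longrightarrow> (f has_field_derivative 0) (at z)"
    and z: "a < Re z" "Re z < b" and lim: "((\<lambda>y. f (Complex (Re z) y)) \<longlongrightarrow> c) at_top"
  shows "f z = c"
proof -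
  define S where "S = {z. Re z > a} \<inter> {z. Re z < b}"
  have "convex S" by (auto simp: S_def intro!: convex_Int convex_halfspace_Re_gt convex_halfspace_Re_lt)
  moreover have "(f has_field_derivative 0) (at w within S)" if "w \<in> S" for w
    using assms(1)[of w] that by (auto simp: S_def intro: has_field_derivative_at_within)
  ultimately obtain d where d: "\<And>w. w \<in> S \<Longrightarrow> f w = d"
    using has_field_derivative_zero_constant[of S f] by auto
  have "((\<lambda>y. f (Complex (Re z) y)) \<longlongrightarrow> d) at_top"
    using d z by (intro tendsto_eventually always_eventually) (auto simp: S_def)
  then have "d = c" using lim tendsto_unique trivial_limit_at_top_linorder by blast
  then show ?thesis using d[of z] z by (simp add: S_def)
qed

text \<open>The exponential x has period 1 in z, so both closed forms share the factor 1 - x. In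
  their difference the factors 1 - w^j cancel and leave a geometric sum in w v. The last step
  cancels 1 - x, whence the condition on Re z.\<close>

lemma dlog_qdl_shift:
  assumes N: "N \<ge> 1" and z: "- 1 < Re z" "Re z < real N - 1" "Re z \<notin> \<int>"
  shows "(1 - omega_pow N (z + 1)) * (dlog_qdl N (z + 1) - dlog_qdl N z) = 2 * of_real pi * \<i> / of_nat N * omega_pow N (z + 1)"
proof -
  interpret primitive_root_of_unity N "omega_pow N 1" using N by (rule omega_pow_1_primitive)
  define x where "x = exp2pi z"
  define w where "w = omega_pow N 1"
  define v where "v = omega_pow N z"
  define q where "q = 2 * of_real pi * \<i> / of_nat N"
  have x1: "exp2pi (z + 1) = x" by (simp add: x_def distrib_left exp_add exp_two_pi_i)
  have x: "x \<noteq> 1" unfolding x_def using z by (intro Re_not_int_imp)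
  have v1: "omega_pow N (z + 1) = w * v" by (simp add: omega_pow_add w_def v_def)
  have vN: "v ^ N = x" using N by (simp add: v_def omega_pow_power omega_pow_N x_def)
  have wN: "w ^ N = 1" using power_N by (simp add: w_def)
  have "(1 - x) * dlog_qdl N (z + 1) = q * ((z + 1 - (of_nat N - 1) / 2) * x + (\<Sum>j=1..<N. - (w ^ j) / (1 - w ^ j) * (w * v) ^ j))"
    using dlog_qdl_closed_form[OF N, of "z + 1"] z unfolding x1 v1 w_def q_def by simp
  moreover have "(1 - x) * dlog_qdl N z = q * ((z - (of_nat N - 1) / 2) * x + (\<Sum>j=1..<N. - (w ^ j) / (1 - w ^ j) * v ^ j))"
    using dlog_qdl_closed_form[OF N, of z] z unfolding x_def v_def w_def q_def by simp
  moreover have "(1 - x) * (K1 - K0) = q * (x + (S1 - S0))"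
    if "(1 - x) * K1 = q * ((z + 1 - r) * x + S1)" "(1 - x) * K0 = q * ((z - r) * x + S0)" for K1 K0 S1 S0 r
  proof -
    have "(1 - x) * (K1 - K0) = (1 - x) * K1 - (1 - x) * K0" by (simp add: algebra_simps)
    then show ?thesis unfolding that by (simp add: algebra_simps)
  qed
  ultimately have "(1 - x) * (dlog_qdl N (z + 1) - dlog_qdl N z) = q * (x + (\<Sum>j=1..<N. - (w ^ j) / (1 - w ^ j) * (w * v) ^ j - - (w ^ j) / (1 - w ^ j) * v ^ j))"
    unfolding sum_subtractf by blast
  also have "(\<Sum>j=1..<N. - (w ^ j) / (1 - w ^ j) * (w * v) ^ j - - (w ^ j) / (1 - w ^ j) * v ^ j) = (\<Sum>j=1..<N. (w * v) ^ j)"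
  proof (rule sum.cong[OF refl])
    fix j assume "j \<in> {1..<N}"
    then have "1 - w ^ j \<noteq> 0" using primitive[of j] by (auto simp: w_def)
    then show "- (w ^ j) / (1 - w ^ j) * (w * v) ^ j - - (w ^ j) / (1 - w ^ j) * v ^ j = (w * v) ^ j"
      by (simp add: power_mult_distrib divide_simps) (simp add: algebra_simps)
  qed
  \<comment> \<open>As (w v)^N = x, the lone x is the missing term j = N of the geometric
    sum.\<close>
  also have "x + (\<Sum>j=1..<N. (w * v) ^ j) = (\<Sum>j=1..<Suc N. (w * v) ^ j)"
    using N vN wN by (simp add: power_mult_distrib)
  also have "\<dots> = w * v * (\<Sum>j<N. (w * v) ^ j)"
    unfolding sum_distrib_left by (rule sum.reindex_bij_witness[of _ Suc "\<lambda>j. j - 1"]) (auto simp flip: power_Suc)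
  finally have "(1 - x) * (dlog_qdl N (z + 1) - dlog_qdl N z) = q * (w * v * (\<Sum>j<N. (w * v) ^ j))" .
  then have "(1 - x) * ((1 - w * v) * (dlog_qdl N (z + 1) - dlog_qdl N z)) = q * (w * v) * ((1 - w * v) * (\<Sum>j<N. (w * v) ^ j))"
    by (simp add: mult_ac)
  also have "(1 - w * v) * (\<Sum>j<N. (w * v) ^ j) = 1 - x"
    using one_diff_power_eq[of "w * v" N] vN wN by (simp add: power_mult_distrib)
  finally have "(1 - x) * ((1 - w * v) * (dlog_qdl N (z + 1) - dlog_qdl N z)) = (1 - x) * (q * (w * v))" by (simp add: mult_ac)
  then have "(1 - w * v) * (dlog_qdl N (z + 1) - dlog_qdl N z) = q * (w * v)"
    using x by (simp only: mult_cancel_left) auto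
  then show ?thesis unfolding v1 q_def .
qed

text \<open>The quotient of the two sides has derivative 0 by \<open>dlog_qdl_shift\<close> and
  tends to 1 upwards. The argument runs in the open unit strip around z, since the derivative
  identity excludes integral real parts.\<close>

lemma qdl_shift:
  assumes N: "N \<ge> 1" and z: "- 1 < Re z" "Re z < real N - 1" "Re z \<notin> \<int>"
  shows "qdl N z = (1 - omega_pow N (z + 1)) * qdl N (z + 1)"
proof -
  define m where "m = \<lfloor>Re z\<rfloor>"
  have m: "of_int m < Re z" "Re z < of_int m + 1"
    using z(3) unfolding m_def by (metis Ints_of_int floor_correct order_le_less, linarith)
  have "- 1 < of_int m + (1::real)" "of_int m < real N - 1" using m z by linarith+
  then have mb: "- 1 \<le> m" "m + 1 \<le> int N - 1" by linarith+
  then have mb': "- 1 \<le> real_of_int m" "real_of_int m + 1 \<le> real N - 1" by linarith+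
  define f where "f z = exp (log_qdl N (z + 1) - log_qdl N z) * (1 - omega_pow N (z + 1))" for z
  have "f z = 1"
  proof (rule vertical_strip_constant[where a = "of_int m" and b = "of_int m + 1" and f = f and z = z])
    fix z assume zs: "of_int m < Re z" "Re z < of_int m + 1"
    have ni: "Re z \<notin> \<int>" using zs by (rule not_Ints_between)
    have z': "- 1 < Re z" "Re z < real N - 1" using zs mb' by linarith+
    have d1: "(log_qdl N has_field_derivative dlog_qdl N z) (at z)"
      using z' N by (intro log_qdl_has_field_derivative) auto
    have d2: "((\<lambda>z. log_qdl N (z + 1)) has_field_derivative dlog_qdl N (z + 1) * 1) (at z)"
      by (rule DERIV_chain2[OF log_qdl_has_field_derivative]) (use z' N in \<open>auto intro!: derivative_eq_intros\<close>)
    have d3: "((\<lambda>z. omega_pow N (z + 1)) has_field_derivative (2 * of_real pi * \<i> / of_nat N * omega_pow N (z + 1)) * 1) (at z)"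
      by (rule DERIV_chain2[OF omega_pow_has_field_derivative]) (auto intro!: derivative_eq_intros)
    have "(f has_field_derivative (exp (log_qdl N (z + 1) - log_qdl N z) * (dlog_qdl N (z + 1) - dlog_qdl N z)) * (1 - omega_pow N (z + 1))
       + - (2 * of_real pi * \<i> / of_nat N * omega_pow N (z + 1)) * exp (log_qdl N (z + 1) - log_qdl N z)) (at z)"
      unfolding f_def[abs_def] by (rule derivative_eq_intros d1 d2 d3 refl | simp)+
    also have "(exp (log_qdl N (z + 1) - log_qdl N z) * (dlog_qdl N (z + 1) - dlog_qdl N z)) * (1 - omega_pow N (z + 1))
       + - (2 * of_real pi * \<i> / of_nat N * omega_pow N (z + 1)) * exp (log_qdl N (z + 1) - log_qdl N z)
       = exp (log_qdl N (z + 1) - log_qdl N z) * ((1 - omega_pow N (z + 1)) * (dlog_qdl N (z + 1) - dlog_qdl N z) - 2 * of_real pi * \<i> / of_nat N * omega_pow N (z + 1))"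
      by (simp add: algebra_simps)
    also have "\<dots> = 0" unfolding dlog_qdl_shift[OF N z' ni] by simp
    finally show "(f has_field_derivative 0) (at z)" .
  next
    have a: "Complex (Re z) y + 1 = Complex (Re z + 1) y" for y by (simp add: complex_eq_iff)
    have "((\<lambda>y. f (Complex (Re z) y)) \<longlongrightarrow> exp (0 - 0) * (1 - 0)) at_top"
      unfolding f_def a using z N
      by (intro tendsto_intros log_qdl_tendsto_0 omega_pow_tendsto_0) auto
    then show "((\<lambda>y. f (Complex (Re z) y)) \<longlongrightarrow> 1) at_top" by simp
  qed (use m in auto)
  then have "exp (log_qdl N z) * f z = exp (log_qdl N z)" by simp
  then show ?thesis by (simp add: f_def qdl_def exp_diff mult_ac)
qed

text \<open>N-fold iteration of \<open>qdl_shift\<close>; the factors 1 - omega^(z + i) for 1 <= i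
  <= N multiply to 1 - x by \<open>prod_one_minus\<close>. The bounds on Re z keep all of z, z + 1,
  ..., z + N in the strip of the integral.\<close>

lemma qdl_shift_N:
  assumes N: "N \<ge> 1" and z: "- 1 < Re z" "Re z < 0"
  shows "qdl N z = (1 - exp2pi z) * qdl N (z + of_nat N)"
proof -
  interpret primitive_root_of_unity N "omega_pow N 1" using N by (rule omega_pow_1_primitive)
  have ni: "Re z + real n \<notin> \<int>" for n using z not_Ints_between[of "int n - 1" "Re z + real n"] by simp
  have "qdl N z = (\<Prod>i<n. 1 - omega_pow N (z + of_nat (Suc i))) * qdl N (z + of_nat n)" if "n \<le> N" for n
    using that
  proof (induction n)
    case (Suc n)
    have "qdl N (z + of_nat n) = (1 - omega_pow N (z + of_nat n + 1)) * qdl N (z + of_nat n + 1)"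
      using Suc.prems z ni[of n] by (intro qdl_shift N) auto
    then have "qdl N z = (\<Prod>i<n. 1 - omega_pow N (z + of_nat (Suc i))) * ((1 - omega_pow N (z + of_nat n + 1)) * qdl N (z + of_nat n + 1))"
      using Suc by simp
    also have "z + of_nat n + 1 = z + of_nat (Suc n)" by simp
    finally show ?case by (simp only: prod.lessThan_Suc mult.assoc)
  qed simp
  from this[of N] have "qdl N z = (\<Prod>i<N. 1 - omega_pow N (z + of_nat (Suc i))) * qdl N (z + of_nat N)" by simp
  also have "(\<Prod>i<N. 1 - omega_pow N (z + of_nat (Suc i))) = (\<Prod>i<N. 1 - omega_pow N 1 ^ i * (omega_pow N 1 * omega_pow N z))"
    by (intro prod.cong refl) (simp add: omega_pow_power add_ac flip: omega_pow_add)
  also have "\<dots> = 1 - exp2pi z"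
    unfolding prod_one_minus using N power_N by (simp add: power_mult_distrib omega_pow_power[of N z] omega_pow_N)
  finally show ?thesis .
qed

section \<open>Meromorphic continuation\<close>

text \<open>With its singularities removed, the difference vanishes identically. So f and g agree
  around every point, and there either both have a pole, with the conventional value 0, or both take
  their common limit. This is the uniqueness behind the definite description in
  \<open>faddeev\<close>.\<close>

lemma nicely_meromorphic_identity:
  assumes f: "f nicely_meromorphic_on UNIV" and g: "g nicely_meromorphic_on UNIV"
    and A: "open A" "z0 \<in> A" "\<And>z. z \<in> A \<Longrightarrow> f z = g z"
  shows "f = g"
proof
  fix z
  define d where "d = remove_sings (\<lambda>z. f z - g z)"
  have fm: "f meromorphic_on UNIV" "g meromorphic_on UNIV" using f g by (auto simp: nicely_meromorphic_on_def)
  have dm: "(\<lambda>z. f z - g z) meromorphic_on UNIV" by (intro meromorphic_intros fm)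
  have dn: "d nicely_meromorphic_on UNIV" unfolding d_def by (rule remove_sings_nicely_meromorphic[OF dm])
  have iso: "isolated_singularity_at (\<lambda>z. f z - g z) w" for w
    by (rule meromorphic_on_isolated_singularity) (rule meromorphic_on_subset[OF dm], simp)
  have ev: "\<forall>\<^sub>F w in at w. d w = f w - g w" for w
    unfolding d_def by (rule eventually_remove_sings_eq_at[OF iso])
  have "\<forall>\<^sub>F w in at z0. w \<in> A" using A eventually_at_topological by blast
  with ev[of z0] have "\<forall>\<^sub>F w in at z0. d w = 0" by eventually_elim (use A in auto)
  then have "\<exists>\<^sub>F w in at z0. d w = 0" by (intro eventually_frequently) auto
  then have d0: "d w = 0" for w
    using frequently_eq_meromorphic_imp_constant[OF _ dn, of 0 z0 w] by auto
  have eq: "\<forall>\<^sub>F w in at z. f w = g w" using ev[of z] by eventually_elim (simp add: d0)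
  have pc: "is_pole f z = is_pole g z" using eq by (intro is_pole_cong) auto
  have lc: "f \<midarrow>z\<rightarrow> l \<longleftrightarrow> g \<midarrow>z\<rightarrow> l" for l using eq by (rule tendsto_cong)
  have F: "is_pole f z \<and> f z = 0 \<or> f \<midarrow>z\<rightarrow> f z" "is_pole g z \<and> g z = 0 \<or> g \<midarrow>z\<rightarrow> g z"
    using f g by (auto simp: nicely_meromorphic_on_def)
  have np: "\<not> (is_pole f z \<and> f \<midarrow>z\<rightarrow> l)" for l
    using not_tendsto_and_filterlim_at_infinity[of "at z" f l] unfolding is_pole_def by auto
  show "f z = g z"
    using F pc lc np by (metis LIM_unique)
qed

text \<open>The continuation dictated by \<open>qdl_shift_N\<close>: the floor moves z into 0 <= Re
  z < N, and each translation by N contributes a factor 1 / (1 - x), x itself being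
  unchanged.\<close>

definition qdl_ext :: "nat \<Rightarrow> complex \<Rightarrow> complex" where
  "qdl_ext N z = qdl N (z - of_int (\<lfloor>Re z / real N\<rfloor> * int N)) *
     (1 - exp2pi z) powi (- \<lfloor>Re z / real N\<rfloor>)"

text \<open>On the overlap -1 < Re z - m N < 0 the piece with index m - 1 agrees with the piece m by
  \<open>qdl_shift_N\<close>. Hence a single analytic formula is valid around the seams Re z = m N,
  where the floor jumps.\<close>

lemma qdl_ext_eq:
  assumes N: "N \<ge> 1" and z: "- 1 < Re z - of_int (m * int N)" "Re z - of_int (m * int N) < real N"
  shows "qdl_ext N z = qdl N (z - of_int (m * int N)) * (1 - exp2pi z) powi (- m)"
proof (cases "Re z - of_int (m * int N) \<ge> 0")
  case True
  have "\<lfloor>Re z / real N\<rfloor> = m"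
    using True z N by (intro floor_unique) (auto simp: field_simps)
  then show ?thesis by (simp add: qdl_ext_def)
next
  case False
  define z' where "z' = z - of_int (m * int N)"
  have "1 \<le> real N" using N by simp
  then have fl: "\<lfloor>Re z / real N\<rfloor> = m - 1"
    using False z N by (intro floor_unique) (auto simp: field_simps)
  have "z - of_int ((m - 1) * int N) = z' + of_nat N" by (simp add: z'_def algebra_simps)
  moreover have "exp2pi z' = exp2pi z"
  proof -
    have "2 * of_real pi * \<i> * z = 2 * of_real pi * \<i> * z' + 2 * of_real pi * \<i> * of_int (m * int N)"
      by (simp add: z'_def algebra_simps)
    moreover have "exp (2 * of_real pi * \<i> * of_int (m * int N)) = 1" unfolding exp_2pi_i_eq_1_iff by simp
    ultimately show ?thesis by (simp add: exp_add)
  qed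
  moreover have "qdl N z' = (1 - exp2pi z') * qdl N (z' + of_nat N)"
    using False z by (intro qdl_shift_N N) (auto simp: z'_def)
  moreover have "1 - exp2pi z' \<noteq> 0"
  proof -
    have "Re z' \<notin> \<int>" using False z not_Ints_between[of "- 1" "Re z'"] by (auto simp: z'_def)
    then show ?thesis using Re_not_int_imp by simp
  qed
  ultimately show ?thesis unfolding qdl_ext_def fl z'_def[symmetric]
    by (simp add: power_int_add power_int_diff power_int_minus field_simps)
qed

lemma qdl_strip_open: "open {z. a < Re z - c \<and> Re z - c < b}"
proof -
  have "{z. a < Re z - c \<and> Re z - c < b} = {z. Re z > a + c} \<inter> {z. Re z < b + c}" by auto
  then show ?thesis by (auto intro!: open_Int open_halfspace_Re_gt open_halfspace_Re_lt)
qed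

lemma qdl_holomorphic: "N \<ge> 1 \<Longrightarrow> (\<lambda>z. qdl N (z - of_int c)) holomorphic_on {z. - 1 < Re z - of_int c \<and> Re z - of_int c < real N}"
proof -
  assume N: "N \<ge> 1"
  have "qdl N holomorphic_on {z. - 1 < Re z - 0 \<and> Re z - 0 < real N}"
    using qdl_has_field_derivative[OF N] by (subst holomorphic_on_open[OF qdl_strip_open]) auto
  then have "qdl N \<circ> (\<lambda>z. z - of_int c) holomorphic_on {z. - 1 < Re z - of_int c \<and> Re z - of_int c < real N}"
    by (rule holomorphic_on_compose_gen[rotated]) (auto intro!: holomorphic_intros)
  then show ?thesis by (simp add: o_def)
qed

lemma floor_strip:
  assumes "N \<ge> 1"
  shows "- 1 < Re z - of_int (\<lfloor>Re z / real N\<rfloor> * int N)" "Re z - of_int (\<lfloor>Re z / real N\<rfloor> * int N) < real N"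
proof -
  have N: "real N > 0" using assms by simp
  have "of_int \<lfloor>Re z / real N\<rfloor> * real N \<le> Re z" "Re z < (of_int \<lfloor>Re z / real N\<rfloor> + 1) * real N"
    using floor_divide_lower[OF N] floor_divide_upper[OF N] by blast+
  then show "- 1 < Re z - of_int (\<lfloor>Re z / real N\<rfloor> * int N)" "Re z - of_int (\<lfloor>Re z / real N\<rfloor> * int N) < real N"
    by (auto simp: algebra_simps)
qed

lemma qdl_ext_meromorphic:
  assumes N: "N \<ge> 1"
  shows "qdl_ext N meromorphic_on UNIV"
proof -
  have "qdl_ext N meromorphic_on {z}" for z
  proof -
    define m where "m = \<lfloor>Re z / real N\<rfloor>"
    define A where "A = {z. - 1 < Re z - of_int (m * int N) \<and> Re z - of_int (m * int N) < real N}"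
    have A: "open A" "z \<in> A" unfolding A_def m_def using qdl_strip_open floor_strip[OF N, of z] by auto
    define g where "g = (\<lambda>z. qdl N (z - of_int (m * int N)) * (1 - exp2pi z) powi (- m))"
    have "(\<lambda>z. qdl N (z - of_int (m * int N))) analytic_on A"
      using qdl_holomorphic[OF N, of "m * int N"] A(1) by (simp add: analytic_on_open A_def)
    then have m1: "(\<lambda>z. qdl N (z - of_int (m * int N))) meromorphic_on A" by (rule analytic_on_imp_meromorphic_on)
    have m2: "(\<lambda>z. 1 - exp2pi z) meromorphic_on A"
      by (intro analytic_on_imp_meromorphic_on analytic_intros)
    have "g meromorphic_on A" unfolding g_def by (rule meromorphic_on_mult[OF m1]) (rule m2 meromorphic_intros)+
    then have "g meromorphic_on {z}" by (rule meromorphic_on_subset) (use A in auto)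
    moreover have "\<forall>\<^sub>F w in at z. qdl_ext N w = g w"
    proof -
      have "\<forall>\<^sub>F w in at z. w \<in> A" using A eventually_at_topological by blast
      then show ?thesis
        unfolding A_def g_def by (rule eventually_mono) (intro qdl_ext_eq N; blast)
    qed
    ultimately show ?thesis using meromorphic_on_cong[of "{z}" "qdl_ext N" g "{z}"] by auto
  qed
  then show ?thesis using meromorphic_on_meromorphic_at by blast
qed

lemma qdl_ext_analytic:
  assumes N: "N \<ge> 1" and z: "exp2pi z \<noteq> 1 \<or> - 1 < Re z \<and> Re z < real N"
  shows "qdl_ext N analytic_on {z}"
proof -
  \<comment> \<open>On the base strip m = 0, so the power of 1 - x is absent and x = 1 does no
    harm.\<close>
  define m where "m = (if - 1 < Re z \<and> Re z < real N then 0 else \<lfloor>Re z / real N\<rfloor>)"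
  define A where "A = {z. - 1 < Re z - of_int (m * int N) \<and> Re z - of_int (m * int N) < real N}"
  define A' where "A' = (if m = 0 then A else A \<inter> {z. exp2pi z \<noteq> 1})"
  have "open A" unfolding A_def by (rule qdl_strip_open)
  moreover have "open {z. exp2pi z \<noteq> 1}"
    by (intro open_Collect_neq continuous_intros)
  ultimately have oA': "open A'" by (auto simp: A'_def)
  have zA: "z \<in> A'" using z floor_strip[OF N, of z] by (auto simp: A'_def A_def m_def)
  have "A' \<subseteq> A" by (auto simp: A'_def)
  then have 1: "(\<lambda>z. qdl N (z - of_int (m * int N))) holomorphic_on A'"
    using qdl_holomorphic[OF N, of "m * int N"] holomorphic_on_subset unfolding A_def by blast
  have "(\<lambda>z. qdl N (z - of_int (m * int N)) * (1 - exp2pi z) powi (- m)) holomorphic_on A'"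
  proof (cases "m = 0")
    case False
    then show ?thesis by (intro holomorphic_intros 1) (auto simp: A'_def)
  qed (use 1 in simp)
  then have "qdl_ext N holomorphic_on A'"
  proof (rule holomorphic_transform)
    fix y assume "y \<in> A'"
    then have "y \<in> A" using \<open>A' \<subseteq> A\<close> by blast
    then show "qdl N (y - of_int (m * int N)) * (1 - exp2pi y) powi (- m) = qdl_ext N y"
      unfolding A_def by (intro qdl_ext_eq[symmetric] N) blast+
  qed
  then show ?thesis using oA' zA by (rule holomorphic_on_imp_analytic_at)
qed

definition qdl_arg_inv :: "nat \<Rightarrow> complex \<Rightarrow> complex" where
  "qdl_arg_inv N w = - \<i> * of_real (sqrt (real N)) * w + (of_nat N - 1) / 2"

lemma qdl_arg_inverse:
  assumes "N \<ge> 1"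
  shows "qdl_arg N (qdl_arg_inv N w) = w" "qdl_arg_inv N (qdl_arg N z) = z"
proof -
  define s where "s = complex_of_real (sqrt (real N))"
  have "sqrt (real N) * sqrt (real N) = real N" by simp
  then have "complex_of_real (sqrt (real N) * sqrt (real N)) = of_nat N" by (metis of_real_of_nat_eq)
  then have "of_nat N = s * s" unfolding s_def by (metis of_real_mult)
  moreover have "s \<noteq> 0" using assms by (simp add: s_def)
  ultimately have s: "s \<noteq> 0" "of_nat N = s * s" by auto
  have 1: "qdl_arg N z = \<i> / s * (z + 1 - (s * s + 1) / 2)" for z
  proof -
    have e: "complex_of_real (sqrt (real N) + 1 / sqrt (real N)) = s + 1 / s" by (simp add: s_def)
    show ?thesis unfolding qdl_arg_def e s_def[symmetric] using s(1) by (simp add: field_simps)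
  qed
  have 2: "qdl_arg_inv N w = - \<i> * s * w + (s * s - 1) / 2" for w
    unfolding qdl_arg_inv_def s_def[symmetric] s(2) ..
  show "qdl_arg N (qdl_arg_inv N w) = w" unfolding 1 2 using s(1) by (simp add: field_simps)
  show "qdl_arg_inv N (qdl_arg N z) = z" unfolding 1 2 using s(1) by (simp add: field_simps)
qed

text \<open>Existence in the definite description: the continued function is pulled back along
  \<open>qdl_arg_inv\<close>, and \<open>remove_sings\<close> gives it the values demanded at its
  singularities. In |Im w| < c_b it reduces to the integral formula. Uniqueness is
  \<open>nicely_meromorphic_identity\<close>.\<close>

lemma faddeev_eq:
  assumes N: "N \<ge> 1"
  shows "faddeev (sqrt (real N)) = remove_sings (\<lambda>w. qdl_ext N (qdl_arg_inv N w))"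
proof -
  define F0 where "F0 = remove_sings (\<lambda>w. qdl_ext N (qdl_arg_inv N w))"
  have "qdl_arg_inv N analytic_on UNIV" unfolding qdl_arg_inv_def[abs_def] by (intro analytic_intros) auto
  then have "(\<lambda>w. qdl_ext N (qdl_arg_inv N w)) meromorphic_on UNIV"
    by (intro meromorphic_on_compose[OF qdl_ext_meromorphic[OF N]]) auto
  then have F0: "F0 nicely_meromorphic_on UNIV" unfolding F0_def by (rule remove_sings_nicely_meromorphic)
  have F0_eq: "F0 w = faddeev_strip (sqrt (real N)) w" if w: "\<bar>Im w\<bar> < c_b (sqrt (real N))" for w
  proof -
    define s where "s = sqrt (real N)"
    have s: "s > 0" "s * s = real N" using N by (auto simp: s_def)
    define z where "z = qdl_arg_inv N w"
    have "\<bar>Im w\<bar> * s < c_b s * s" using w s unfolding s_def[symmetric] by simp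
    also have "c_b s * s = (real N + 1) / 2" using s by (simp add: c_b_def field_simps)
    finally have "\<bar>s * Im w\<bar> < (real N + 1) / 2" using s by (simp add: abs_mult mult.commute)
    moreover have "Re z = s * Im w + (real N - 1) / 2" by (simp add: z_def qdl_arg_inv_def s_def)
    ultimately have z: "- 1 < Re z" "Re z < real N" by (auto simp: abs_less_iff field_simps)
    have "(\<lambda>w. qdl_ext N (qdl_arg_inv N w)) analytic_on {w}"
      using analytic_on_compose_gen[of "qdl_arg_inv N" "{w}" "qdl_ext N" "{z}"] qdl_ext_analytic[OF N, of z] z
        analytic_on_subset[OF \<open>qdl_arg_inv N analytic_on UNIV\<close>] by (auto simp: o_def z_def)
    then have "F0 w = qdl_ext N z" by (simp add: F0_def z_def)
    also have "\<dots> = qdl N z" using qdl_ext_eq[OF N, of z 0] z by simp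
    also have "\<dots> = faddeev_strip (sqrt (real N)) (qdl_arg N z)" using faddeev_strip_qdl_arg[OF N z] by simp
    also have "qdl_arg N z = w" by (simp add: z_def qdl_arg_inverse[OF N])
    finally show ?thesis .
  qed
  have cb: "c_b (sqrt (real N)) > 0" using N by (auto simp: c_b_def intro!: divide_pos_pos add_pos_pos)
  have "faddeev (sqrt (real N)) = F0"
    unfolding faddeev_def
  proof (rule the_equality)
    show "F0 nicely_meromorphic_on UNIV \<and> (\<forall>z. \<bar>Im z\<bar> < c_b (sqrt (real N)) \<longrightarrow> F0 z = faddeev_strip (sqrt (real N)) z)"
      using F0 F0_eq by blast
  next
    fix F assume F: "F nicely_meromorphic_on UNIV \<and> (\<forall>z. \<bar>Im z\<bar> < c_b (sqrt (real N)) \<longrightarrow> F z = faddeev_strip (sqrt (real N)) z)"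
    define A where "A = {z. \<bar>Im z\<bar> < c_b (sqrt (real N))}"
    have oA: "open A" unfolding A_def by (intro open_Collect_less continuous_intros)
    show "F = F0"
    proof (rule nicely_meromorphic_identity[OF _ F0 oA])
      show "0 \<in> A" using cb by (simp add: A_def)
      show "\<And>z. z \<in> A \<Longrightarrow> F z = F0 z" using F F0_eq by (auto simp: A_def)
    qed (use F in auto)
  qed
  then show ?thesis by (simp add: F0_def)
qed

text \<open>The passage from the abstract continuation to explicit values: at points of analyticity
  \<open>remove_sings\<close> changes nothing.\<close>

lemma Lambda_eq_qdl_ext:
  assumes N: "N \<ge> 1" and z: "exp2pi z \<noteq> 1 \<or> - 1 < Re z \<and> Re z < real N"
  shows "Lambda N z = qdl_ext N z"
proof -
  have "Lambda N z = faddeev (sqrt (real N)) (qdl_arg N z)" by (simp add: Lambda_def qdl_arg_def)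
  also have "\<dots> = remove_sings (\<lambda>w. qdl_ext N (qdl_arg_inv N w)) (qdl_arg N z)" by (simp add: faddeev_eq[OF N])
  also have "\<dots> = qdl_ext N (qdl_arg_inv N (qdl_arg N z))"
  proof (rule remove_sings_at_analytic)
    have "qdl_arg_inv N analytic_on {qdl_arg N z}" unfolding qdl_arg_inv_def[abs_def] by (intro analytic_intros) auto
    then show "(\<lambda>w. qdl_ext N (qdl_arg_inv N w)) analytic_on {qdl_arg N z}"
      using analytic_on_compose_gen[of "qdl_arg_inv N" "{qdl_arg N z}" "qdl_ext N" "{z}"] qdl_ext_analytic[OF N z]
      by (auto simp: o_def qdl_arg_inverse[OF N])
  qed
  finally show ?thesis by (simp add: qdl_arg_inverse[OF N])
qed

lemma Lambda_strip:
  assumes "N \<ge> 1" "- 1 < Re z" "Re z < real N"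
  shows "Lambda N z = qdl N z"
  using Lambda_eq_qdl_ext[of N z] qdl_ext_eq[of N z 0] assms by simp

text \<open>z and z + N reduce to the same base point, with exponents of 1 - x that differ by
  one.\<close>

lemma Lambda_shift_N:
  assumes N: "N \<ge> 1" and z: "exp2pi z \<noteq> 1"
  shows "Lambda N z = (1 - exp2pi z) * Lambda N (z + of_nat N)"
proof -
  define m where "m = \<lfloor>Re z / real N\<rfloor>"
  have m: "- 1 < Re z - of_int (m * int N)" "Re z - of_int (m * int N) < real N"
    unfolding m_def using floor_strip[OF N, of z] by auto
  have "exp2pi (of_nat N) = 1" unfolding exp_2pi_i_eq_1_iff by simp
  then have x: "exp2pi (z + of_nat N) = exp2pi z"
    by (simp add: distrib_left exp_add)
  have a: "z + of_nat N - of_int ((m + 1) * int N) = z - of_int (m * int N)" by (simp add: algebra_simps)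
  have "Lambda N z = qdl N (z - of_int (m * int N)) * (1 - exp2pi z) powi (- m)"
    using Lambda_eq_qdl_ext[OF N, of z] qdl_ext_eq[OF N m] z by simp
  moreover have "Lambda N (z + of_nat N) = qdl N (z - of_int (m * int N)) * (1 - exp2pi z) powi (- (m + 1))"
    using Lambda_eq_qdl_ext[OF N, of "z + of_nat N"] qdl_ext_eq[OF N, of "z + of_nat N" "m + 1"] z m
    unfolding x a by (simp add: algebra_simps)
  moreover have "y powi (- m) = y * y powi (- (m + 1))" if "y \<noteq> 0" for y :: complex
    using power_int_add[of y 1 "- (m + 1)"] that by simp
  ultimately show ?thesis using z by simp
qed

section \<open>The dilogarithm\<close>

text \<open>The plane without the ray [1, infinity), on which Ln (1 - z) is holomorphic.\<close>

definition cut_plane :: "complex set" where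
  "cut_plane = {z. 1 - z \<notin> \<real>\<^sub>\<le>\<^sub>0}"

lemma open_cut_plane: "open cut_plane"
proof -
  have "cut_plane = (\<lambda>z. 1 - z) -` (- \<real>\<^sub>\<le>\<^sub>0)" by (auto simp: cut_plane_def)
  moreover have "open ((\<lambda>z::complex. 1 - z) -` (- \<real>\<^sub>\<le>\<^sub>0))"
    by (intro open_vimage open_Compl closed_nonpos_Reals_complex continuous_intros)
  ultimately show ?thesis by (simp only:)
qed

lemma cut_plane_scale:
  assumes "z \<in> cut_plane" "0 \<le> s" "s \<le> 1"
  shows "of_real s * z \<in> cut_plane"
proof (rule ccontr)
  assume "of_real s * z \<notin> cut_plane"
  then have "Im (of_real s * z) = 0" "Re (of_real s * z) \<ge> 1"
    by (auto simp: cut_plane_def complex_nonpos_Reals_iff)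
  then have h: "s * Im z = 0" "s * Re z \<ge> 1" by auto
  then have "s > 0" using assms(2) by (cases "s = 0") auto
  moreover have "0 < s * Re z" using h(2) by linarith
  ultimately have "Im z = 0" "Re z > 0" using h(1) zero_less_mult_pos by auto
  moreover have "s * Re z \<le> 1 * Re z" using assms(3) \<open>Re z > 0\<close> by (intro mult_right_mono) auto
  then have "Re z \<ge> 1" using h(2) by linarith
  ultimately show False using assms(1) by (auto simp: cut_plane_def complex_nonpos_Reals_iff)
qed

lemma starlike_cut_plane: "starlike cut_plane"
  unfolding starlike_def
proof (intro bexI ballI)
  show "0 \<in> cut_plane" by (simp add: cut_plane_def)
  fix z assume z: "z \<in> cut_plane"
  show "closed_segment 0 z \<subseteq> cut_plane"
  proof
    fix y assume "y \<in> closed_segment 0 z"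
    then obtain s where "0 \<le> s" "s \<le> 1" "y = of_real s * z" by (auto simp: in_segment scaleR_conv_of_real)
    then show "y \<in> cut_plane" using cut_plane_scale[OF z] by simp
  qed
qed

text \<open>Minus the derivative of \<open>Li2\<close>; the value -1 fills the removable singularity
  at 0.\<close>

definition dLi2 :: "complex \<Rightarrow> complex" where
  "dLi2 z = (if z = 0 then - 1 else Ln (1 - z) / z)"

lemma dLi2_holomorphic: "dLi2 holomorphic_on cut_plane"
proof -
  have h: "(\<lambda>z. Ln (1 - z)) holomorphic_on cut_plane"
    by (intro holomorphic_intros) (auto simp: cut_plane_def)
  have "((\<lambda>z. Ln (1 - z)) has_field_derivative - 1) (at 0)"
    by (auto intro!: derivative_eq_intros)
  then have d: "deriv (\<lambda>z. Ln (1 - z)) 0 = - 1" by (rule DERIV_imp_deriv)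
  have "(\<lambda>z. if z = 0 then deriv (\<lambda>z. Ln (1 - z)) 0 else (Ln (1 - z) - Ln (1 - 0)) / (z - 0)) holomorphic_on cut_plane"
    by (rule pole_lemma[OF h]) (simp add: interior_open[OF open_cut_plane], simp add: cut_plane_def)
  then show ?thesis unfolding d by (simp add: dLi2_def[abs_def] cong: if_cong)
qed

text \<open>An integral over a fixed interval, valid also for z on the cut, so that limits onto the
  cut become limits of integrands.\<close>

lemma Li2_integral: "Li2 z = - integral {0..1} (\<lambda>s. Ln (1 - of_real s * z) / of_real s)"
proof (cases "z = 0")
  case False
  have "contour_integral (linepath 0 z) (\<lambda>t. Ln (1 - t) / t) = integral {0..1} (\<lambda>s. Ln (1 - of_real s * z) / of_real s)"
    unfolding contour_integral_integral
    by (intro integral_cong) (use False in \<open>auto simp: linepath_def scaleR_conv_of_real\<close>)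
  then show ?thesis by (simp add: Li2_def)
qed (simp add: Li2_def)

lemma dLi2_segment_integrable:
  assumes "z \<in> cut_plane"
  shows "(\<lambda>s. Ln (1 - of_real s * z) / of_real s) integrable_on {0..1}"
proof -
  have "continuous_on {0..1} (\<lambda>s. dLi2 (of_real s * z) * z)"
    by (intro continuous_intros continuous_on_compose2[OF holomorphic_on_imp_continuous_on[OF dLi2_holomorphic]])
       (use cut_plane_scale[OF assms] in auto)
  then have "(\<lambda>s. dLi2 (of_real s * z) * z) integrable_on {0..1}" by (rule integrable_continuous_interval)
  then show ?thesis
    by (rule integrable_spike_finite[of "{0}", rotated 2]) (auto simp: dLi2_def)
qed

lemma Li2_0: "Li2 0 = 0"
  by (simp add: Li2_def)

lemma Li2_has_field_derivative:
  assumes "z \<in> cut_plane"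
  shows "(Li2 has_field_derivative - dLi2 z) (at z)"
proof -
  obtain F where F: "\<And>z. z \<in> cut_plane \<Longrightarrow> (F has_field_derivative dLi2 z) (at z)"
    using holomorphic_starlike_primitive[of cut_plane dLi2 "{}"] starlike_cut_plane open_cut_plane
      holomorphic_on_imp_continuous_on[OF dLi2_holomorphic] holomorphic_on_imp_differentiable_at[OF dLi2_holomorphic open_cut_plane]
    by auto
  have eq: "Li2 y = F 0 - F y" if y: "y \<in> cut_plane" for y
  proof -
    have sub: "closed_segment 0 y \<subseteq> cut_plane"
    proof
      fix t assume "t \<in> closed_segment 0 y"
      then obtain s where "0 \<le> s" "s \<le> 1" "t = of_real s * y" by (auto simp: in_segment scaleR_conv_of_real)
      then show "t \<in> cut_plane" using cut_plane_scale[OF y] by simp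
    qed
    have "(dLi2 has_contour_integral F (pathfinish (linepath 0 y)) - F (pathstart (linepath 0 y))) (linepath 0 y)"
    proof (rule contour_integral_primitive[where S = cut_plane])
      show "(F has_field_derivative dLi2 t) (at t within cut_plane)" if "t \<in> cut_plane" for t
        using F[OF that] by (rule has_field_derivative_at_within)
      show "path_image (linepath 0 y) \<subseteq> cut_plane" using sub by simp
    qed (rule valid_path_linepath)
    from contour_integral_unique[OF this] have "contour_integral (linepath 0 y) dLi2 = F y - F 0"
      by (simp only: pathfinish_linepath pathstart_linepath)
    moreover have "contour_integral (linepath 0 y) dLi2 = contour_integral (linepath 0 y) (\<lambda>t. Ln (1 - t) / t)"
      unfolding contour_integral_integral vector_derivative_linepath_at
      by (rule integral_spike[of "{0}"]) (auto simp: dLi2_def linepath_def)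
    ultimately show ?thesis by (simp add: Li2_def)
  qed
  have "((\<lambda>y. F 0 - F y) has_field_derivative - dLi2 z) (at z)"
    using F[OF assms] by (auto intro!: derivative_eq_intros)
  then show ?thesis
    by (rule has_field_derivative_transform_within_open[OF _ open_cut_plane assms]) (simp add: eq)
qed

section \<open>Boundary values of the logarithm and the dilogarithm on their cuts\<close>

lemma Ln_closed_upper_half_plane:
  assumes "Im w \<ge> 0" "w \<noteq> 0"
  shows "Ln w = Ln (- \<i> * w) + \<i> * of_real (pi / 2)"
proof (rule Ln_unique)
  have "exp (\<i> * of_real (pi / 2)) = \<i>" unfolding cis_conv_exp[symmetric] by (rule cis_pi_half)
  then have "exp (Ln (- \<i> * w) + \<i> * of_real (pi / 2)) = - \<i> * w * \<i>"
    using assms by (simp only: exp_add) (simp add: exp_Ln)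
  also have "\<dots> = w" by (simp add: complex_eq_iff)
  finally show "exp (Ln (- \<i> * w) + \<i> * of_real (pi / 2)) = w" .
  have "\<bar>Im (Ln (- \<i> * w))\<bar> \<le> pi / 2" using assms by (subst Re_Ln_pos_le) auto
  then show "- pi < Im (Ln (- \<i> * w) + \<i> * of_real (pi / 2))" "Im (Ln (- \<i> * w) + \<i> * of_real (pi / 2)) \<le> pi"
    using pi_gt_zero by (auto simp: abs_le_iff simp del: pi_gt_zero)
qed

text \<open>Rotation by -i carries the closed upper half plane without 0 off the cut of Ln. So the
  principal logarithm is continuous up to the negative axis when approached from above.\<close>

lemma tendsto_Ln_upper:
  assumes "(f \<longlongrightarrow> w) F" "w \<noteq> 0" "Im w \<ge> 0" "\<And>n. Im (f n) \<ge> 0" "\<And>n. f n \<noteq> 0"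
  shows "((\<lambda>n. Ln (f n)) \<longlongrightarrow> Ln w) F"
proof -
  have "- \<i> * w \<notin> \<real>\<^sub>\<le>\<^sub>0" using assms(2,3) by (auto simp: complex_nonpos_Reals_iff complex_eq_iff)
  then have "((\<lambda>n. Ln (- \<i> * f n) + \<i> * of_real (pi / 2)) \<longlongrightarrow> Ln (- \<i> * w) + \<i> * of_real (pi / 2)) F"
    by (intro tendsto_intros assms(1))
  then show ?thesis using Ln_closed_upper_half_plane assms by simp
qed

text \<open>In y = 1 - r s an antiderivative is y ln |y| - y, up to the factor -1 / r. It is
  continuous across y = 0, so the fundamental theorem applies with the exceptional point s = 1 /
  r.\<close>

lemma integrable_ln_abs_linear:
  fixes r :: real
  assumes "r > 0"
  shows "(\<lambda>s. ln \<bar>1 - r * s\<bar>) integrable_on {0..1}"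
proof -
  define A where "A = (\<lambda>y::real. y * ln \<bar>y\<bar> - y)"
  have "isCont A y" for y
  proof (cases "y = 0")
    case False
    then show ?thesis unfolding A_def by (intro continuous_intros) auto
  next
    case True
    have "((\<lambda>y::real. y * ln \<bar>y\<bar>) \<longlongrightarrow> 0) (at_right 0)" "((\<lambda>y::real. y * ln \<bar>y\<bar>) \<longlongrightarrow> 0) (at_left 0)"
      by real_asymp+
    then have "((\<lambda>y::real. y * ln \<bar>y\<bar>) \<longlongrightarrow> 0) (at 0)" by (simp add: filterlim_split_at)
    then have "(A \<longlongrightarrow> 0 - 0) (at 0)" unfolding A_def by (intro tendsto_intros)
    then show ?thesis using True by (simp add: isCont_def A_def)
  qed
  then have cA: "continuous_on UNIV A" by (simp add: continuous_at_imp_continuous_on)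
  have "((\<lambda>s. ln \<bar>1 - r * s\<bar>) has_integral (- A (1 - r * 1) / r - (- A (1 - r * 0) / r))) {0..1}"
  proof (rule fundamental_theorem_of_calculus_interior_strong[where S = "{1 / r}"])
    show "continuous_on {0..1} (\<lambda>s. - A (1 - r * s) / r)"
      using assms by (intro continuous_intros continuous_on_compose2[OF cA]) auto
    fix s assume s: "s \<in> {0<..<1} - {1 / r}"
    then have nz: "1 - r * s \<noteq> 0" using assms by (auto simp: field_simps)
    have dA: "(A has_real_derivative ln \<bar>y\<bar>) (at y)" if "y \<noteq> 0" for y
    proof (cases "y > 0")
      case True
      have "((\<lambda>y. y * ln y - y) has_real_derivative ln y) (at y)" using True by (auto intro!: derivative_eq_intros)
      then have "(A has_real_derivative ln y) (at y)"
        by (rule has_field_derivative_transform_within_open[of _ _ _ "{0<..}"]) (use True in \<open>auto simp: A_def\<close>)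
      then show ?thesis using True by simp
    next
      case False
      then have y: "y < 0" using that by simp
      have "((\<lambda>y. y * ln (- y) - y) has_real_derivative ln (- y)) (at y)" using y by (auto intro!: derivative_eq_intros)
      then have "(A has_real_derivative ln (- y)) (at y)"
        by (rule has_field_derivative_transform_within_open[of _ _ _ "{..<0}"]) (use y in \<open>auto simp: A_def\<close>)
      then show ?thesis using y by simp
    qed
    have "((\<lambda>s. A (1 - r * s)) has_real_derivative ln \<bar>1 - r * s\<bar> * (- r)) (at s)"
      by (rule DERIV_chain2[where f = A and g = "\<lambda>s. 1 - r * s" and x = s, OF dA[OF nz]]) (auto intro!: derivative_eq_intros)
    then have "((\<lambda>s. - A (1 - r * s) / r) has_real_derivative - (ln \<bar>1 - r * s\<bar> * (- r)) / r) (at s)"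
      by (intro DERIV_cdivide DERIV_minus)
    then show "((\<lambda>s. - A (1 - r * s) / r) has_vector_derivative ln \<bar>1 - r * s\<bar>) (at s)"
      using assms by (simp add: has_real_derivative_iff_has_vector_derivative)
  qed auto
  then show ?thesis by (rule has_integral_integrable)
qed

lemma norm_Ln_le_abs_ln:
  assumes "w \<noteq> 0"
  shows "norm (Ln w) \<le> \<bar>ln (norm w)\<bar> + pi"
proof -
  have "norm (Ln w) \<le> \<bar>Re (Ln w)\<bar> + \<bar>Im (Ln w)\<bar>" by (rule cmod_le)
  moreover have "\<bar>Im (Ln w)\<bar> \<le> pi" using mpi_less_Im_Ln[OF assms] Im_Ln_le_pi[OF assms] by auto
  ultimately show ?thesis using assms by simp
qed

text \<open>For r > 1 the limit point lies on the cut. The points X = r cis (- \<theta>) approach it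
  from below, so 1 - s X stays in the closed upper half plane, where Ln is continuous up to the
  negative axis. Dominated convergence transfers this to the integral.\<close>

lemma Li2_tendsto_from_below:
  fixes r :: real
  assumes r: "r > 0" "r \<noteq> 1" and th: "\<And>n. 0 < \<theta> n \<and> \<theta> n < pi" "\<theta> \<longlonglongrightarrow> 0"
  shows "(\<lambda>n. Li2 (of_real r * cis (- \<theta> n))) \<longlonglongrightarrow> Li2 (of_real r)"
    and "(\<lambda>n. Ln (1 - of_real r * cis (- \<theta> n))) \<longlonglongrightarrow> Ln (1 - of_real r)"
proof -
  define X where "X n = of_real r * cis (- \<theta> n)" for n
  have "(\<lambda>n. of_real r * cis (- \<theta> n)) \<longlonglongrightarrow> of_real r * cis (- 0)"
    by (intro tendsto_intros th(2))
  then have Xlim: "X \<longlonglongrightarrow> of_real r" unfolding X_def by simp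
  have ImX: "Im (X n) < 0" for n
    using th(1)[of n] r sin_gt_zero[of "\<theta> n"] by (auto simp: X_def mult_pos_pos)
  have Xcut: "X n \<in> cut_plane" for n using ImX[of n] by (auto simp: cut_plane_def complex_nonpos_Reals_iff)
  have nX: "norm (X n) = r" for n using r by (simp add: X_def norm_mult)
  show "(\<lambda>n. Ln (1 - of_real r * cis (- \<theta> n))) \<longlonglongrightarrow> Ln (1 - of_real r)"
    unfolding X_def[symmetric]
  proof (rule tendsto_Ln_upper)
    show "(\<lambda>n. 1 - X n) \<longlonglongrightarrow> 1 - of_real r" by (intro tendsto_intros Xlim)
    show "1 - complex_of_real r \<noteq> 0" using r(2) by (metis eq_iff_diff_eq_0 of_real_eq_1_iff)
    show "Im (1 - X n) \<ge> 0" "1 - X n \<noteq> 0" for n using ImX[of n] by (auto simp: complex_eq_iff)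
  qed auto
  \<comment> \<open>At s = 1 / r the limiting argument of Ln is 0; there both integrands are set to
    0, which changes them at one point only.\<close>
  define f where "f n s = (if s = 1 / r then 0 else Ln (1 - of_real s * X n) / of_real s)" for n and s :: real
  define g where "g s = (if s = 1 / r then 0 else Ln (1 - of_real s * of_real r) / of_real s)" for s :: real
  \<comment> \<open>The majorant. If r s < 1/2, then |Ln (1 - y)| <= 2 |y| bounds the quotient by 2
    r. Otherwise 1 / s <= 2 r, and |1 - r s| <= |w| <= 1 + r bounds |Ln w| by the bracket.\<close>
  define D where "D s = 2 * r * (pi + 2 * ln (1 + r) - ln \<bar>1 - r * s\<bar>)" for s
  have Dint: "D integrable_on {0..1}"
    unfolding D_def using integrable_ln_abs_linear[OF r(1)]
    by (intro integrable_on_mult_right integrable_diff integrable_const_ivl)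
  have lnle: "ln \<bar>1 - r * s\<bar> \<le> ln (1 + r)" if "0 \<le> s" "s \<le> 1" for s
  proof (cases "1 - r * s = 0")
    case False
    have "\<bar>1 - r * s\<bar> \<le> 1 + \<bar>r * s\<bar>" by (rule order_trans[OF abs_triangle_ineq4]) simp
    also have "\<bar>r * s\<bar> \<le> r * 1" using that r by (auto simp: abs_mult intro!: mult_left_mono)
    finally show ?thesis using False r by (subst ln_le_cancel_iff) auto
  qed (use r in simp)
  have ln0: "0 \<le> ln (1 + r)" using r by simp
  have two_le: "2 \<le> pi + 2 * ln (1 + r) - ln \<bar>1 - r * s\<bar>" if "s \<in> {0..1}" for s
  proof -
    have "ln \<bar>1 - r * s\<bar> \<le> ln (1 + r)" using that by (intro lnle) auto
    then show ?thesis using ln0 pi_ge_two by linarith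
  qed
  have bound: "norm (f n s) \<le> D s" if s: "s \<in> {0..1}" for n s
  proof (cases "s = 1 / r \<or> s = 0")
    case True
    have "D s \<ge> 0" unfolding D_def using two_le[OF s] r by (intro mult_nonneg_nonneg) linarith+
    then show ?thesis using True by (auto simp: f_def)
  next
    case False
    then have s': "s > 0" "s \<noteq> 1 / r" using s by auto
    define w where "w = 1 - of_real s * X n"
    have nsX: "norm (of_real s * X n) = r * s" using s' nX by (simp add: norm_mult)
    have w0: "w \<noteq> 0" using ImX[of n] s' by (auto simp: w_def complex_eq_iff)
    have fn: "norm (f n s) = norm (Ln w) / s" using s' by (simp add: f_def w_def norm_divide)
    show ?thesis
    proof (cases "r * s < 1 / 2")
      case True
      have "norm (Ln (1 + (- (of_real s * X n)))) \<le> 2 * norm (- (of_real s * X n))"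
        by (rule norm_Ln_le) (simp only: norm_minus_cancel nsX True)
      then have "norm (Ln w) \<le> 2 * (r * s)" by (simp only: norm_minus_cancel nsX) (simp add: w_def)
      then have "norm (f n s) \<le> 2 * r * 1" unfolding fn using s' by (simp add: field_simps)
      also have "\<dots> \<le> D s" unfolding D_def using two_le[OF s] r by (intro mult_left_mono) linarith+
      finally show ?thesis .
    next
      case F: False
      have lo: "\<bar>1 - r * s\<bar> \<le> norm w" using norm_triangle_ineq3[of 1 "of_real s * X n"] unfolding w_def nsX by simp
      have hi: "norm w \<le> 1 + r"
      proof -
        have "norm w \<le> 1 + r * s" using norm_triangle_ineq4[of 1 "of_real s * X n"] unfolding w_def nsX by simp
        also have "r * s \<le> r * 1" using s r by (intro mult_left_mono) auto
        finally show ?thesis by simp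
      qed
      have pos: "0 < \<bar>1 - r * s\<bar>" using s' r by (auto simp: field_simps)
      have "ln (norm w) \<le> ln (1 + r)" "ln \<bar>1 - r * s\<bar> \<le> ln (norm w)"
        using lo hi pos w0 r by (simp_all add: ln_le_cancel_iff)
      moreover have "ln \<bar>1 - r * s\<bar> \<le> ln (1 + r)" using s by (intro lnle) auto
      ultimately have "\<bar>ln (norm w)\<bar> \<le> 2 * ln (1 + r) - ln \<bar>1 - r * s\<bar>" using ln0 by linarith
      then have n: "norm (Ln w) \<le> pi + 2 * ln (1 + r) - ln \<bar>1 - r * s\<bar>" using norm_Ln_le_abs_ln[OF w0] by simp
      have "norm (f n s) = norm (Ln w) * (1 / s)" by (simp add: fn)
      also have "\<dots> \<le> (pi + 2 * ln (1 + r) - ln \<bar>1 - r * s\<bar>) * (2 * r)"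
      proof (rule mult_mono[OF n])
        show "1 / s \<le> 2 * r" using F s' by (simp add: field_simps)
        show "0 \<le> pi + 2 * ln (1 + r) - ln \<bar>1 - r * s\<bar>" using two_le[OF s] by linarith
      qed (use s' in simp)
      finally show ?thesis by (simp add: D_def mult_ac)
    qed
  qed
  have fint: "f n integrable_on {0..1}" for n
    using dLi2_segment_integrable[OF Xcut[of n]]
    by (rule integrable_spike_finite[of "{1 / r}", rotated 2]) (auto simp: f_def)
  have lim: "(\<lambda>n. f n s) \<longlonglongrightarrow> g s" if s: "s \<in> {0..1}" for s
  proof (cases "s = 1 / r \<or> s = 0")
    case True
    then show ?thesis by (auto simp: f_def g_def)
  next
    case False
    then have s': "s > 0" "s \<noteq> 1 / r" using s by auto
    have "(\<lambda>n. Ln (1 - of_real s * X n)) \<longlonglongrightarrow> Ln (1 - of_real s * of_real r)"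
    proof (rule tendsto_Ln_upper)
      show "(\<lambda>n. 1 - of_real s * X n) \<longlonglongrightarrow> 1 - of_real s * of_real r" by (intro tendsto_intros Xlim)
      have "s * r \<noteq> 1" using s' r by (auto simp: field_simps)
      then have "complex_of_real (s * r) \<noteq> 1" by (simp only: of_real_eq_1_iff not_False_eq_True)
      then show "1 - complex_of_real s * of_real r \<noteq> 0" by simp
      show "Im (1 - of_real s * X n) \<ge> 0" "1 - of_real s * X n \<noteq> 0" for n
        using ImX[of n] s' by (auto simp: complex_eq_iff mult_nonneg_nonpos)
    qed auto
    then show ?thesis using s' unfolding f_def g_def by (auto intro!: tendsto_intros)
  qed
  have "(\<lambda>n. integral {0..1} (f n)) \<longlonglongrightarrow> integral {0..1} g"
    by (rule dominated_convergence(2)[OF fint Dint bound lim])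
  moreover have "integral {0..1} (f n) = - Li2 (X n)" for n
    unfolding Li2_integral minus_minus by (rule integral_spike[of "{1 / r}"]) (auto simp: f_def)
  moreover have "integral {0..1} g = - Li2 (of_real r)"
    unfolding Li2_integral minus_minus by (rule integral_spike[of "{1 / r}"]) (auto simp: g_def)
  ultimately have "(\<lambda>n. - Li2 (X n)) \<longlonglongrightarrow> - Li2 (of_real r)" by simp
  from tendsto_minus[OF this] show "(\<lambda>n. Li2 (of_real r * cis (- \<theta> n))) \<longlonglongrightarrow> Li2 (of_real r)"
    by (simp add: X_def)
qed

section \<open>The discrete Fourier transform of the quantum dilogarithm\<close>

text \<open>The sum S_k of the overview with a general multiplier y in place of omega^k u.\<close>

definition qdl_dft :: "nat \<Rightarrow> complex \<Rightarrow> complex \<Rightarrow> complex" where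
  "qdl_dft N y z = (\<Sum>n<N. y ^ n * qdl N (z + of_nat n))"

text \<open>The condition on y matches \<open>qdl_shift_N\<close>: the terms n = 0 and n = N
  coincide, so the index may be shifted by one. Inserting \<open>qdl_shift\<close> into y times the
  sum then splits it into the transform at y minus omega^z times the transform at omega y.\<close>

lemma qdl_dft_step:
  assumes N: "N \<ge> 1" and z: "- 1 < Re z" "Re z < 0"
    and y: "y ^ N = 1 - exp2pi z"
  shows "omega_pow N z * qdl_dft N (omega_pow N 1 * y) z = (1 - y) * qdl_dft N y z"
proof -
  interpret primitive_root_of_unity N "omega_pow N 1" using N by (rule omega_pow_1_primitive)
  define w where "w = omega_pow N 1"
  define v where "v = omega_pow N z"
  have per: "(\<Sum>n<N. a ^ Suc n * qdl N (z + of_nat (Suc n))) = qdl_dft N a z" if a: "a ^ N = y ^ N" for a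
  proof -
    have "(\<Sum>n<Suc N. a ^ n * qdl N (z + of_nat n)) = qdl N z + (\<Sum>n<N. a ^ Suc n * qdl N (z + of_nat (Suc n)))"
      by (subst sum.lessThan_Suc_shift) simp
    moreover have "(\<Sum>n<Suc N. a ^ n * qdl N (z + of_nat n)) = qdl_dft N a z + a ^ N * qdl N (z + of_nat N)"
      by (simp add: qdl_dft_def)
    moreover have "a ^ N * qdl N (z + of_nat N) = qdl N z"
      using qdl_shift_N[OF N z] by (simp add: a y)
    ultimately show ?thesis by simp
  qed
  have FE: "qdl N (z + of_nat n) = (1 - w ^ Suc n * v) * qdl N (z + of_nat (Suc n))" if n: "n < N" for n
  proof -
    have "Re (z + of_nat n) \<notin> \<int>" using z not_Ints_between[of "int n - 1" "Re (z + of_nat n)"] by simp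
    then have "qdl N (z + of_nat n) = (1 - omega_pow N (z + of_nat n + 1)) * qdl N (z + of_nat n + 1)"
      using z n by (intro qdl_shift N) auto
    moreover have "z + of_nat n + 1 = of_nat (Suc n) * 1 + z" "z + of_nat n + 1 = z + of_nat (Suc n)" by simp_all
    ultimately show ?thesis
      unfolding w_def v_def omega_pow_power omega_pow_add[symmetric] by metis
  qed
  have "y * qdl_dft N y z = (\<Sum>n<N. y ^ Suc n * qdl N (z + of_nat n))"
    by (simp add: qdl_dft_def sum_distrib_left mult_ac)
  also have "\<dots> = (\<Sum>n<N. y ^ Suc n * qdl N (z + of_nat (Suc n)) - v * ((w * y) ^ Suc n * qdl N (z + of_nat (Suc n))))"
    by (rule sum.cong[OF refl]) (subst FE, auto simp: algebra_simps power_mult_distrib)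
  also have "\<dots> = qdl_dft N y z - v * qdl_dft N (w * y) z"
    unfolding sum_subtractf sum_distrib_left[symmetric]
    using per[of y] per[of "w * y"] power_N by (simp add: power_mult_distrib w_def)
  finally show ?thesis unfolding w_def v_def by (simp add: algebra_simps)
qed

lemma qdl_dft_qpoch:
  assumes N: "N \<ge> 1" and z: "- 1 < Re z" "Re z < 0"
    and y: "y ^ N = 1 - exp2pi z"
  shows "omega_pow N z ^ k * qdl_dft N (omega_pow N 1 ^ k * y) z
     = primitive_root_of_unity.qpoch (omega_pow N 1) k y * qdl_dft N y z"
proof -
  interpret primitive_root_of_unity N "omega_pow N 1" using N by (rule omega_pow_1_primitive)
  show ?thesis
  proof (induction k)
    case 0 then show ?case by (simp add: qpoch_def)
  next
    case (Suc k)
    have "(omega_pow N 1 ^ k) ^ N = 1" by (metis mult.commute power_N power_mult power_one)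
    then have yk: "(omega_pow N 1 ^ k * y) ^ N = 1 - exp2pi z" using y by (simp add: power_mult_distrib)
    have "omega_pow N z ^ Suc k * qdl_dft N (omega_pow N 1 ^ Suc k * y) z
      = omega_pow N z ^ k * (omega_pow N z * qdl_dft N (omega_pow N 1 * (omega_pow N 1 ^ k * y)) z)" by (simp add: mult_ac)
    also have "\<dots> = (1 - omega_pow N 1 ^ k * y) * (omega_pow N z ^ k * qdl_dft N (omega_pow N 1 ^ k * y) z)"
      unfolding qdl_dft_step[OF N z yk] by (simp add: mult_ac)
    also have "\<dots> = qpoch (Suc k) y * qdl_dft N y z" unfolding Suc by (simp add: qpoch_Suc mult_ac)
    finally show ?case .
  qed
qed

text \<open>For i < n the factor 1 - w^i u occurs n - 1 - i times in the first product, i times in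
  the second and once in \<open>qpoch n u\<close>, hence n times in all.\<close>

lemma (in primitive_root_of_unity) prod_qpoch:
  "(\<Prod>k<n. qpoch k u) * (\<Prod>i<n. (1 - w ^ i * u) ^ i) * qpoch n u = qpoch n u ^ n"
proof (induction n)
  case (Suc n)
  have "(\<Prod>k<Suc n. qpoch k u) * (\<Prod>i<Suc n. (1 - w ^ i * u) ^ i) * qpoch (Suc n) u
    = ((\<Prod>k<n. qpoch k u) * (\<Prod>i<n. (1 - w ^ i * u) ^ i) * qpoch n u) * qpoch n u * (1 - w ^ n * u) ^ Suc n"
    by (simp add: qpoch_Suc mult_ac)
  also have "\<dots> = qpoch (Suc n) u ^ Suc n" unfolding Suc by (simp add: qpoch_Suc power_mult_distrib mult_ac)
  finally show ?case .
qed (simp add: qpoch_def)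

lemma (in primitive_root_of_unity) prod_qpoch_N:
  assumes "u ^ N \<noteq> 1"
  shows "(\<Prod>k<N. qpoch k u) * (\<Prod>i<N. (1 - w ^ i * u) ^ i) = (1 - u ^ N) ^ (N - 1)"
proof -
  have "qpoch N u = 1 - u ^ N" unfolding qpoch_def by (rule prod_one_minus)
  then have "(\<Prod>k<N. qpoch k u) * (\<Prod>i<N. (1 - w ^ i * u) ^ i) * (1 - u ^ N) = (1 - u ^ N) ^ (N - 1) * (1 - u ^ N)"
    using prod_qpoch[where n = N and u = u] N_pos by (simp flip: power_Suc2)
  then show ?thesis using assms by simp
qed

text \<open>The relation f' = f a without a division, since S_0 is not known to be nonzero while its
  differential equation is derived.\<close>

definition log_deriv :: "(complex \<Rightarrow> complex) \<Rightarrow> complex \<Rightarrow> complex \<Rightarrow> bool" where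
  "log_deriv f a z \<longleftrightarrow> (f has_field_derivative f z * a) (at z)"

lemma log_deriv_mult: "log_deriv f a z \<Longrightarrow> log_deriv g b z \<Longrightarrow> log_deriv (\<lambda>z. f z * g z) (a + b) z"
  unfolding log_deriv_def by (auto intro!: derivative_eq_intros simp: algebra_simps)

lemma log_deriv_power: "log_deriv f a z \<Longrightarrow> log_deriv (\<lambda>z. f z ^ n) (of_nat n * a) z"
proof (induction n)
  case 0 then show ?case by (simp add: log_deriv_def)
next
  case (Suc n)
  from log_deriv_mult[OF Suc(2) Suc(1)[OF Suc(2)]] show ?case by (simp add: algebra_simps)
qed

lemma log_deriv_inverse: "log_deriv f a z \<Longrightarrow> f z \<noteq> 0 \<Longrightarrow> log_deriv (\<lambda>z. inverse (f z)) (- a) z"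
  unfolding log_deriv_def by (auto intro!: derivative_eq_intros simp: field_simps)

lemma log_deriv_prod:
  "(\<And>i. i \<in> A \<Longrightarrow> log_deriv (f i) (a i) z) \<Longrightarrow> log_deriv (\<lambda>z. \<Prod>i\<in>A. f i z) (\<Sum>i\<in>A. a i) z"
proof (induction A rule: infinite_finite_induct)
  case (insert i A)
  from log_deriv_mult[OF insert(4)[of i] insert(3)] insert(1,2,4) show ?case by auto
qed (auto simp: log_deriv_def)

lemma exp_2pi_i_pos_real_imp:
  assumes "Im (exp2pi z) = 0" "Re (exp2pi z) > 0"
  shows "Re z \<in> \<int>"
proof -
  define t where "t = 2 * pi * Re z"
  define m where "m = exp (- 2 * pi * Im z)"
  have e: "exp2pi z = of_real m * cis t"
    by (simp add: exp_eq_polar t_def m_def)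
  have "m > 0" by (simp add: m_def)
  then have "sin t = 0" "cos t > 0" using assms unfolding e by (auto simp: zero_less_mult_iff)
  then have "cos t = 1" using sin_cos_squared_add[of t] by (auto simp: power2_eq_1_iff)
  then have "exp (2 * of_real pi * \<i> * of_real (Re z)) = 1"
    using \<open>sin t = 0\<close> by (simp add: exp_eq_polar t_def complex_eq_iff)
  then have "complex_of_real (Re z) \<in> \<int>" unfolding exp_2pi_i_eq_1_iff .
  then obtain n :: int where "complex_of_real (Re z) = of_int n" by (elim Ints_cases)
  from arg_cong[OF this, of Re] show ?thesis by simp
qed

lemma exp_strip_cut_plane:
  assumes "Re z \<notin> \<int>"
  shows "exp2pi z \<in> cut_plane"
proof (rule ccontr)
  assume "exp2pi z \<notin> cut_plane"
  then have "Im (exp2pi z) = 0" "Re (exp2pi z) \<ge> 1"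
    unfolding cut_plane_def complex_nonpos_Reals_iff by auto
  then show False using exp_2pi_i_pos_real_imp[of z] assms by auto
qed

text \<open>The N-th power cancels the 1 / N in the exponent, after which exp undoes each
  Ln.\<close>

lemma D0_power:
  assumes N: "N \<ge> 1"
  shows "D0 N ^ N = (\<Prod>i<N. (1 - omega_pow N 1 ^ i) ^ i)"
proof -
  interpret primitive_root_of_unity N "omega_pow N 1" using N by (rule omega_pow_1_primitive)
  have "D0 N ^ N = exp (\<Sum>k=1..N-1. of_nat k * Ln (1 - omega_pow N (of_nat k)))"
    unfolding D0_def using N by (simp flip: exp_of_nat_mult)
  also have "\<dots> = (\<Prod>k=1..N-1. exp (of_nat k * Ln (1 - omega_pow N (of_nat k))))" by (rule exp_sum) auto
  also have "\<dots> = (\<Prod>k=1..N-1. (1 - omega_pow N 1 ^ k) ^ k)"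
  proof (rule prod.cong[OF refl])
    fix k assume k: "k \<in> {1..N-1}"
    have "omega_pow N (of_nat k) = omega_pow N 1 ^ k" by (simp add: omega_pow_power)
    moreover have "0 < k" "k < N" using k N by (simp_all, arith)
    then have "1 - omega_pow N 1 ^ k \<noteq> 0" using primitive[of k] by simp
    ultimately show "exp (of_nat k * Ln (1 - omega_pow N (of_nat k))) = (1 - omega_pow N 1 ^ k) ^ k"
      by (simp add: exp_of_nat_mult)
  qed
  \<comment> \<open>The added index i = 0 has base 0 and exponent 0, so it contributes 1.\<close>
  also have "\<dots> = (\<Prod>i<N. (1 - omega_pow N 1 ^ i) ^ i)"
  proof (rule prod.mono_neutral_left)
    show "{1..N - 1} \<subseteq> {..<N}" using N by (simp add: subset_iff) arith
    show "\<forall>i\<in>{..<N} - {1..N - 1}. (1 - omega_pow N 1 ^ i) ^ i = 1"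
    proof
      fix i assume "i \<in> {..<N} - {1..N - 1}"
      then have "i < N" "\<not> (1 \<le> i \<and> i \<le> N - 1)" by auto
      then have "i = 0" by arith
      then show "(1 - omega_pow N 1 ^ i) ^ i = 1" by simp
    qed
  qed simp
  finally show ?thesis .
qed

section \<open>The eigenvalue product\<close>

text \<open>The N-th root of 1 - x that is differentiable in z off the cut and tends to 1 for Im z
  -> infinity. Arbitrary roots enter with \<open>det_formula\<close>.\<close>

definition cut_root :: "nat \<Rightarrow> complex \<Rightarrow> complex" where
  "cut_root N z = exp (Ln (1 - exp2pi z) / of_nat N)"

lemma cut_root_power:
  assumes "N \<ge> 1" "exp2pi z \<noteq> 1"
  shows "cut_root N z ^ N = 1 - exp2pi z"
proof -
  have "cut_root N z ^ N = exp (of_nat N * (Ln (1 - exp2pi z) / of_nat N))"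
    unfolding cut_root_def by (rule exp_of_nat_mult[symmetric])
  also have "\<dots> = exp (Ln (1 - exp2pi z))" using assms(1) by simp
  finally show ?thesis using assms(2) by simp
qed

text \<open>The logarithmic derivatives of S_0^N, of the inverse product and of the exponential
  factor add up to 0. Here y stands for 2 pi i and c for (N - 1) / 2; the first hypothesis comes
  from \<open>log_derivative_identity\<close>.\<close>

lemma log_derivative_balance:
  fixes z x c S Q y n :: complex
  assumes id: "n * (S - c * x) = x * Q" and x: "1 - x \<noteq> 0" and n: "n \<noteq> 0"
  shows "n * (y / n / (1 - x) * ((z - c) * x + S)) + - (- (- (y * x / (1 - x)) / n) * Q) + z * (- (y * x / (1 - x))) = 0"
proof -
  define k where "k = y / (1 - x)"
  have S: "S = c * x + x * Q / n" using id n by (simp add: field_simps)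
  have 1: "n * (y / n / (1 - x) * A) = k * A" for A using n by (simp add: k_def)
  have 2: "y * x / (1 - x) = k * x" by (simp add: k_def)
  show ?thesis unfolding 1 2 S by (simp add: divide_inverse algebra_simps)
qed

text \<open>Differentiating u^n yields a term linear in n that cancels the one in the closed form of
  \<open>dlog_qdl\<close> at z + n. What remains depends on n only through the powers w^(j n), so
  summation over n gives transforms at w^j u, which \<open>qdl_dft_qpoch\<close> reduces to the one
  at u.\<close>

lemma qdl_dft_log_deriv:
  assumes N: "N \<ge> 1" and z: "- 1 < Re z" "Re z < 0"
  defines "x \<equiv> exp2pi z"
  shows "log_deriv (\<lambda>z. qdl_dft N (cut_root N z) z)
     (2 * of_real pi * \<i> / of_nat N / (1 - x) * ((z - (of_nat N - 1) / 2) * x +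
       (\<Sum>j=1..<N. - (omega_pow N 1 ^ j) / (1 - omega_pow N 1 ^ j) * primitive_root_of_unity.qpoch (omega_pow N 1) j (cut_root N z)))) z"
    and "log_deriv (cut_root N) (- (2 * of_real pi * \<i> * x / (1 - x)) / of_nat N) z"
    and "((\<lambda>z. Ln (1 - exp2pi z)) has_field_derivative - (2 * of_real pi * \<i> * x / (1 - x))) (at z)"
proof -
  interpret primitive_root_of_unity N "omega_pow N 1" using N by (rule omega_pow_1_primitive)
  define w where "w = omega_pow N 1"
  define v where "v = omega_pow N z"
  define u where "u = cut_root N z"
  define dL where "dL = - (2 * of_real pi * \<i> * x / (1 - x))"
  have nint: "Re z \<notin> \<int>" using z not_Ints_between[of "- 1" "Re z"] by simp
  have x1: "x \<noteq> 1" unfolding x_def by (rule Re_not_int_imp[OF nint])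
  have ncut: "1 - x \<notin> \<real>\<^sub>\<le>\<^sub>0" using exp_strip_cut_plane[OF nint] by (simp add: cut_plane_def x_def)
  show 1: "((\<lambda>z. Ln (1 - exp2pi z)) has_field_derivative - (2 * of_real pi * \<i> * x / (1 - x))) (at z)"
  proof -
    have "((\<lambda>z. 1 - exp2pi z) has_field_derivative - (2 * of_real pi * \<i> * x)) (at z)"
      unfolding x_def by (auto intro!: derivative_eq_intros)
    from DERIV_chain2[where f = Ln and g = "\<lambda>z. 1 - exp2pi z" and x = z, OF _ this, of "inverse (1 - x)"]
    show ?thesis using has_field_derivative_Ln[OF ncut] by (simp add: x_def field_simps)
  qed
  show 2: "log_deriv (cut_root N) (- (2 * of_real pi * \<i> * x / (1 - x)) / of_nat N) z"
    unfolding log_deriv_def cut_root_def[abs_def] by (rule DERIV_fun_exp[OF DERIV_cdivide[OF 1]])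
  have du: "(cut_root N has_field_derivative u * (dL / of_nat N)) (at z)"
    using 2 by (simp add: log_deriv_def u_def dL_def)
  have up: "((\<lambda>z. cut_root N z ^ n) has_field_derivative u ^ n * (of_nat n * (dL / of_nat N))) (at z)" for n
    using log_deriv_power[OF 2, of n] by (simp add: log_deriv_def u_def dL_def)
  have dG: "((\<lambda>z. qdl N (z + of_nat n)) has_field_derivative qdl N (z + of_nat n) * dlog_qdl N (z + of_nat n)) (at z)" if "n < N" for n
  proof -
    have "((\<lambda>z. qdl N (z + of_nat n)) has_field_derivative qdl N (z + of_nat n) * dlog_qdl N (z + of_nat n) * 1) (at z)"
      by (rule DERIV_chain2[where f = "qdl N" and g = "\<lambda>z. z + of_nat n" and x = z])
         (use z that in \<open>auto intro!: derivative_eq_intros qdl_has_field_derivative N\<close>)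
    then show ?thesis by simp
  qed
  have dT: "((\<lambda>z. qdl_dft N (cut_root N z) z) has_field_derivative
      (\<Sum>n<N. u ^ n * qdl N (z + of_nat n) * (of_nat n * (dL / of_nat N) + dlog_qdl N (z + of_nat n)))) (at z)"
    unfolding qdl_dft_def
  proof (rule DERIV_sum)
    fix n assume "n \<in> {..<N}"
    then have "((\<lambda>z. cut_root N z ^ n * qdl N (z + of_nat n)) has_field_derivative
       u ^ n * (of_nat n * (dL / of_nat N)) * qdl N (z + of_nat n) + qdl N (z + of_nat n) * dlog_qdl N (z + of_nat n) * cut_root N z ^ n) (at z)"
      by (intro DERIV_mult up dG) auto
    then show "((\<lambda>z. cut_root N z ^ n * qdl N (z + of_nat n)) has_field_derivative
       u ^ n * qdl N (z + of_nat n) * (of_nat n * (dL / of_nat N) + dlog_qdl N (z + of_nat n))) (at z)"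
      by (simp add: u_def algebra_simps)
  qed
  define q where "q = 2 * of_real pi * \<i> / of_nat N"
  define c :: complex where "c = (of_nat N - 1) / 2"
  define \<rho> where "\<rho> j = - (w ^ j) / (1 - w ^ j)" for j
  have summand: "of_nat n * (dL / of_nat N) + dlog_qdl N (z + of_nat n)
      = q / (1 - x) * ((z - c) * x + (\<Sum>j=1..<N. \<rho> j * v ^ j * (w ^ j) ^ n))" if "n < N" for n
  proof -
    have "exp2pi (of_nat n) = 1" unfolding exp_2pi_i_eq_1_iff by simp
    then have xn: "exp2pi (z + of_nat n) = x" by (simp add: distrib_left exp_add x_def)
    have "of_nat n = of_nat n * (1::complex)" by simp
    then have vn: "omega_pow N (z + of_nat n) = v * w ^ n"
      unfolding w_def v_def omega_pow_power omega_pow_add[symmetric] by metis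
    have "(1 - x) * dlog_qdl N (z + of_nat n) = q * ((z + of_nat n - c) * x + (\<Sum>j=1..<N. \<rho> j * (v * w ^ n) ^ j))"
      using dlog_qdl_closed_form[OF N, of "z + of_nat n"] z that unfolding xn vn q_def c_def \<rho>_def w_def by simp
    then have K: "dlog_qdl N (z + of_nat n) = q / (1 - x) * ((z + of_nat n - c) * x + (\<Sum>j=1..<N. \<rho> j * (v * w ^ n) ^ j))"
      using x1 by (simp add: nonzero_eq_divide_eq mult.commute)
    have S: "(\<Sum>j=1..<N. \<rho> j * (v * w ^ n) ^ j) = (\<Sum>j=1..<N. \<rho> j * v ^ j * (w ^ j) ^ n)"
      by (rule sum.cong[OF refl]) (simp add: power_mult_distrib mult.commute flip: power_mult)
    have "of_nat n * (dL / of_nat N) = - (q / (1 - x) * (of_nat n * x))"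
      by (simp add: dL_def q_def divide_inverse mult_ac)
    then show ?thesis unfolding K S by (simp add: algebra_simps)
  qed
  have uN: "u ^ N = 1 - exp2pi z" unfolding u_def using N x1 x_def by (intro cut_root_power) auto
  have "(\<Sum>n<N. u ^ n * qdl N (z + of_nat n) * (of_nat n * (dL / of_nat N) + dlog_qdl N (z + of_nat n)))
      = (\<Sum>n<N. u ^ n * qdl N (z + of_nat n) * (q / (1 - x) * ((z - c) * x + (\<Sum>j=1..<N. \<rho> j * v ^ j * (w ^ j) ^ n))))"
    by (rule sum.cong[OF refl]) (use summand in auto)
  also have "\<dots> = q / (1 - x) * ((z - c) * x * qdl_dft N u z + (\<Sum>n<N. \<Sum>j=1..<N. \<rho> j * v ^ j * ((w ^ j * u) ^ n * qdl N (z + of_nat n))))"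
    unfolding qdl_dft_def
  proof -
    have "u ^ n * qdl N (z + of_nat n) * (q / (1 - x) * ((z - c) * x + (\<Sum>j=1..<N. \<rho> j * v ^ j * (w ^ j) ^ n)))
       = q / (1 - x) * ((z - c) * x * (u ^ n * qdl N (z + of_nat n)) + (\<Sum>j=1..<N. \<rho> j * v ^ j * ((w ^ j * u) ^ n * qdl N (z + of_nat n))))" for n
    proof -
      have "(\<Sum>j=1..<N. \<rho> j * v ^ j * ((w ^ j * u) ^ n * qdl N (z + of_nat n)))
        = (\<Sum>j=1..<N. \<rho> j * v ^ j * (w ^ j) ^ n) * (u ^ n * qdl N (z + of_nat n))"
        unfolding sum_distrib_right by (rule sum.cong[OF refl]) (simp add: power_mult_distrib mult_ac)
      moreover have "g * (k * (a + S)) = k * (a * g + S * g)" for g k a S :: complex by (simp add: algebra_simps)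
      ultimately show ?thesis by (simp only:)
    qed
    then show "(\<Sum>n<N. u ^ n * qdl N (z + of_nat n) * (q / (1 - x) * ((z - c) * x + (\<Sum>j=1..<N. \<rho> j * v ^ j * (w ^ j) ^ n))))
       = q / (1 - x) * ((z - c) * x * (\<Sum>n<N. u ^ n * qdl N (z + of_nat n)) + (\<Sum>n<N. \<Sum>j=1..<N. \<rho> j * v ^ j * ((w ^ j * u) ^ n * qdl N (z + of_nat n))))"
      by (simp only: sum_distrib_left[symmetric] sum.distrib)
  qed
  also have "(\<Sum>n<N. \<Sum>j=1..<N. \<rho> j * v ^ j * ((w ^ j * u) ^ n * qdl N (z + of_nat n)))
     = (\<Sum>j=1..<N. \<rho> j * (v ^ j * qdl_dft N (w ^ j * u) z))"
    by (subst sum.swap) (simp add: qdl_dft_def sum_distrib_left mult_ac)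
  also have "\<dots> = (\<Sum>j=1..<N. \<rho> j * qpoch j u) * qdl_dft N u z"
    unfolding sum_distrib_right
    by (rule sum.cong[OF refl]) (use qdl_dft_qpoch[OF N z uN] in \<open>simp add: v_def w_def mult.assoc\<close>)
  also have "q / (1 - x) * ((z - c) * x * qdl_dft N u z + (\<Sum>j=1..<N. \<rho> j * qpoch j u) * qdl_dft N u z)
     = qdl_dft N u z * (q / (1 - x) * ((z - c) * x + (\<Sum>j=1..<N. \<rho> j * qpoch j u)))"
    by (simp add: algebra_simps)
  finally show "log_deriv (\<lambda>z. qdl_dft N (cut_root N z) z)
     (2 * of_real pi * \<i> / of_nat N / (1 - x) * ((z - (of_nat N - 1) / 2) * x +
       (\<Sum>j=1..<N. - (omega_pow N 1 ^ j) / (1 - omega_pow N 1 ^ j) * qpoch j (cut_root N z)))) z"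
    using dT unfolding log_deriv_def u_def q_def c_def \<rho>_def w_def by simp
qed

text \<open>By \<open>log_derivative_balance\<close> the left side is constant. Its value is the
  limit for Im z -> infinity, where x -> 0 and u -> 1: the transform tends to N, the product to
  D(0)^N and the exponential to 1.\<close>

lemma qdl_dft_strip:
  assumes N: "N \<ge> 1" and z: "- 1 < Re z" "Re z < 0"
  defines "x \<equiv> \<lambda>z. exp2pi z"
  shows "qdl_dft N (cut_root N z) z ^ N * inverse (\<Prod>i<N. (1 - omega_pow N 1 ^ i * cut_root N z) ^ i)
       * exp (Li2 (x z) / (2 * of_real pi * \<i>) + z * Ln (1 - x z)) = of_nat N ^ N / D0 N ^ N"
proof -
  interpret primitive_root_of_unity N "omega_pow N 1" using N by (rule omega_pow_1_primitive)
  define w where "w = omega_pow N 1"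
  define T where "T z = qdl_dft N (cut_root N z) z" for z
  define P where "P z = (\<Prod>i<N. (1 - w ^ i * cut_root N z) ^ i)" for z
  define X where "X z = exp (Li2 (x z) / (2 * of_real pi * \<i>) + z * Ln (1 - x z))" for z
  define f where "f z = T z ^ N * inverse (P z) * X z" for z
  have "f z = of_nat N ^ N / D0 N ^ N"
  proof (rule vertical_strip_constant[where a = "- 1" and b = 0 and f = f and z = z])
    fix z assume z: "- 1 < Re z" "Re z < 0"
    define u where "u = cut_root N z"
    define dL where "dL = - (2 * of_real pi * \<i> * x z / (1 - x z))"
    have nint: "Re z \<notin> \<int>" using z not_Ints_between[of "- 1" "Re z"] by simp
    have x1: "x z \<noteq> 1" unfolding x_def by (rule Re_not_int_imp[OF nint])
    have x0: "x z \<noteq> 0" by (simp add: x_def)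
    have uN: "u ^ N = 1 - x z" unfolding u_def x_def using N x1 by (intro cut_root_power) (auto simp: x_def)
    have uN1: "u ^ N \<noteq> 1" using uN x0 by simp
    have "(\<Prod>i<N. 1 - w ^ i * u) \<noteq> 0" unfolding w_def prod_one_minus using uN1 by simp
    then have fac: "1 - w ^ i * u \<noteq> 0" if "i < N" for i
      using that by (simp only: prod_zero_iff[OF finite_lessThan]) blast
    note ld = qdl_dft_log_deriv[OF N z]
    have ldT: "log_deriv (\<lambda>z. T z ^ N) (of_nat N * (2 * of_real pi * \<i> / of_nat N / (1 - x z) * ((z - (of_nat N - 1) / 2) * x z +
       (\<Sum>j=1..<N. - (w ^ j) / (1 - w ^ j) * qpoch j u)))) z"
      unfolding T_def u_def w_def x_def by (intro log_deriv_power ld(1))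
    have ldf: "log_deriv (\<lambda>z. 1 - w ^ i * cut_root N z) (- (dL / of_nat N) * (w ^ i * u / (1 - w ^ i * u))) z" if "i < N" for i
    proof -
      have "(cut_root N has_field_derivative u * (dL / of_nat N)) (at z)"
        using ld(2) by (simp add: log_deriv_def u_def dL_def x_def)
      then have "((\<lambda>z. 1 - w ^ i * cut_root N z) has_field_derivative - (w ^ i * (u * (dL / of_nat N)))) (at z)"
        by (auto intro!: derivative_eq_intros)
      then show ?thesis using fac[OF that] by (simp add: log_deriv_def u_def mult_ac)
    qed
    have ldP: "log_deriv (\<lambda>z. inverse (P z)) (- (\<Sum>i<N. of_nat i * (- (dL / of_nat N) * (w ^ i * u / (1 - w ^ i * u))))) z"
      unfolding P_def
    proof (rule log_deriv_inverse)
      show "log_deriv (\<lambda>z. \<Prod>i<N. (1 - w ^ i * cut_root N z) ^ i) (\<Sum>i<N. of_nat i * (- (dL / of_nat N) * (w ^ i * u / (1 - w ^ i * u)))) z"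
        by (intro log_deriv_prod log_deriv_power ldf) auto
      show "(\<Prod>i<N. (1 - w ^ i * cut_root N z) ^ i) \<noteq> 0"
        using fac by (auto simp: u_def)
    qed
    have ldX: "log_deriv X (z * dL) z"
    proof -
      have dx: "(x has_field_derivative 2 * of_real pi * \<i> * x z) (at z)"
        unfolding x_def by (auto intro!: derivative_eq_intros)
      have cut: "x z \<in> cut_plane" unfolding x_def by (rule exp_strip_cut_plane[OF nint])
      have "((\<lambda>z. Li2 (x z)) has_field_derivative - dLi2 (x z) * (2 * of_real pi * \<i> * x z)) (at z)"
        by (rule DERIV_chain2[where f = Li2 and g = x and x = z, OF Li2_has_field_derivative[OF cut] dx])
      then have d1: "((\<lambda>z. Li2 (x z)) has_field_derivative - (2 * of_real pi * \<i>) * Ln (1 - x z)) (at z)"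
        using x0 by (simp add: dLi2_def mult_ac)
      have d2: "((\<lambda>z. Ln (1 - x z)) has_field_derivative dL) (at z)"
        using ld(3) by (simp add: x_def dL_def)
      have "((\<lambda>z. Li2 (x z) / (2 * of_real pi * \<i>) + z * Ln (1 - x z)) has_field_derivative
         (- (2 * of_real pi * \<i>) * Ln (1 - x z)) / (2 * of_real pi * \<i>) + (1 * Ln (1 - x z) + dL * z)) (at z)"
        by (intro DERIV_add DERIV_cdivide d1 DERIV_mult d2 DERIV_ident)
      then have "((\<lambda>z. Li2 (x z) / (2 * of_real pi * \<i>) + z * Ln (1 - x z)) has_field_derivative z * dL) (at z)"
        by (simp add: mult.commute)
      then show ?thesis unfolding log_deriv_def X_def[abs_def]
        by (rule DERIV_fun_exp)
    qed
    define S where "S = (\<Sum>j=1..<N. - (w ^ j) / (1 - w ^ j) * qpoch j u)"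
    define Q where "Q = (\<Sum>i<N. of_nat i * (w ^ i * u) / (1 - w ^ i * u))"
    have id: "of_nat N * (S - (of_nat N - 1) / 2 * x z) = x z * Q"
      using log_derivative_identity[OF uN1] by (simp add: S_def Q_def w_def uN)
    have "log_deriv f (of_nat N * (2 * of_real pi * \<i> / of_nat N / (1 - x z) * ((z - (of_nat N - 1) / 2) * x z + S))
         + - (\<Sum>i<N. of_nat i * (- (dL / of_nat N) * (w ^ i * u / (1 - w ^ i * u)))) + z * dL) z"
      unfolding f_def[abs_def] S_def by (intro log_deriv_mult ldT ldP ldX)
    also have "(\<Sum>i<N. of_nat i * (- (dL / of_nat N) * (w ^ i * u / (1 - w ^ i * u)))) = - (dL / of_nat N) * Q"
      unfolding Q_def sum_distrib_left by (intro sum.cong refl) (simp add: mult_ac)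
    also have "of_nat N * (2 * of_real pi * \<i> / of_nat N / (1 - x z) * ((z - (of_nat N - 1) / 2) * x z + S))
         + - (- (dL / of_nat N) * Q) + z * dL = 0"
      using log_derivative_balance[OF id, of "2 * of_real pi * \<i>" z] x1 N by (simp add: dL_def)
    finally show "(f has_field_derivative 0) (at z)" by (simp add: log_deriv_def)
  next
    define s where "s = Re z"
    have s: "- 1 < s" "s < 0" using z by (auto simp: s_def)
    have xlim: "((\<lambda>y. x (Complex s y)) \<longlongrightarrow> 0) at_top"
    proof -
      have "omega_pow 1 (Complex s y) = x (Complex s y)" for y by (simp add: omega_pow_def x_def)
      then show ?thesis using omega_pow_tendsto_0[of 1 s] by simp
    qed
    have Llim: "((\<lambda>y. Ln (1 - x (Complex s y))) \<longlongrightarrow> Ln (1 - 0)) at_top"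
      by (intro tendsto_intros xlim) auto
    have ulim: "((\<lambda>y. cut_root N (Complex s y)) \<longlongrightarrow> 1) at_top"
    proof -
      have "((\<lambda>y. exp (Ln (1 - x (Complex s y)) / of_nat N)) \<longlongrightarrow> exp (Ln (1 - 0) / of_nat N)) at_top"
        using N by (intro tendsto_intros Llim) auto
      then show ?thesis by (simp add: cut_root_def x_def)
    qed
    have Tlim: "((\<lambda>y. T (Complex s y)) \<longlongrightarrow> (\<Sum>n<N. 1 ^ n * 1)) at_top"
      unfolding T_def qdl_dft_def
    proof (intro tendsto_sum tendsto_mult tendsto_power ulim)
      fix n assume "n \<in> {..<N}"
      moreover have "Complex s y + of_nat n = Complex (s + real n) y" for y by (simp add: complex_eq_iff)
      ultimately show "((\<lambda>y. qdl N (Complex s y + of_nat n)) \<longlongrightarrow> 1) at_top"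
        using s by (simp only:) (intro qdl_tendsto_1 N; auto)
    qed
    have Plim: "((\<lambda>y. P (Complex s y)) \<longlongrightarrow> (\<Prod>i<N. (1 - w ^ i * 1) ^ i)) at_top"
      unfolding P_def by (intro tendsto_intros ulim)
    have Plim': "(\<Prod>i<N. (1 - w ^ i * 1) ^ i) = D0 N ^ N" by (simp add: D0_power[OF N] w_def)
    have D0: "D0 N ^ N \<noteq> 0" by (simp add: D0_def)
    have "((\<lambda>y. Li2 (x (Complex s y))) \<longlongrightarrow> Li2 0) at_top"
    proof (rule isCont_tendsto_compose[OF _ xlim])
      have "0 \<in> cut_plane" by (simp add: cut_plane_def)
      from Li2_has_field_derivative[OF this] show "isCont Li2 0" by (rule DERIV_isCont)
    qed
    then have Lilim: "((\<lambda>y. Li2 (x (Complex s y))) \<longlongrightarrow> 0) at_top" by (simp add: Li2_0)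
    \<comment> \<open>The factor z is unbounded in this limit, so the exponential decay of Ln (1 -
      x) is what makes the product vanish.\<close>
    have zL: "((\<lambda>y. Complex s y * Ln (1 - x (Complex s y))) \<longlongrightarrow> 0) at_top"
    proof (rule Lim_null_comparison)
      have nx: "norm (x (Complex s y)) = exp (- 2 * pi * y)" for y by (simp add: x_def)
      have "((\<lambda>y. exp (- 2 * pi * y)) \<longlongrightarrow> 0) at_top" by real_asymp
      then have "\<forall>\<^sub>F y in at_top. exp (- 2 * pi * y) < 1 / 2" by (rule order_tendstoD) simp
      then show "\<forall>\<^sub>F y in at_top. norm (Complex s y * Ln (1 - x (Complex s y))) \<le> (\<bar>s\<bar> + \<bar>y\<bar>) * (2 * exp (- 2 * pi * y))"
      proof eventually_elim
        case (elim y)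
        have "norm (Ln (1 + (- x (Complex s y)))) \<le> 2 * norm (- x (Complex s y))"
          by (rule norm_Ln_le) (simp only: norm_minus_cancel nx elim)
        then have "norm (Ln (1 - x (Complex s y))) \<le> 2 * exp (- 2 * pi * y)" by (simp only: norm_minus_cancel nx) simp
        moreover have "norm (Complex s y) \<le> \<bar>s\<bar> + \<bar>y\<bar>" using cmod_le[of "Complex s y"] by simp
        ultimately show ?case unfolding norm_mult by (intro mult_mono) auto
      qed
      show "((\<lambda>y. (\<bar>s\<bar> + \<bar>y\<bar>) * (2 * exp (- 2 * pi * y))) \<longlongrightarrow> 0) at_top" by real_asymp
    qed
    have "((\<lambda>y. f (Complex s y)) \<longlongrightarrow> (\<Sum>n<N. 1 ^ n * 1) ^ N * inverse (D0 N ^ N) * exp (0 / (2 * of_real pi * \<i>) + 0)) at_top"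
      unfolding f_def X_def
      by (intro tendsto_mult tendsto_power tendsto_inverse tendsto_exp tendsto_add tendsto_divide tendsto_const Tlim Lilim zL D0
          Plim[unfolded Plim']) auto
    then show "((\<lambda>y. f (Complex (Re z) y)) \<longlongrightarrow> of_nat N ^ N / D0 N ^ N) at_top"
      by (simp add: s_def field_simps)
  qed (use z in auto)
  then show ?thesis by (simp add: f_def T_def P_def X_def w_def)
qed

lemma two_sum_lessThan:
  fixes n :: nat
  shows "2 * (\<Sum>k<n. k) = n * (n - 1)"
proof (induction n)
  case (Suc n)
  then show ?case by (cases n) (auto simp: algebra_simps)
qed simp

text \<open>The claimed determinant without its factor depending on \<zeta>^1, that is, without the
  quadratic term of \<open>calL\<close>.\<close>

definition det_rhs :: "nat \<Rightarrow> complex \<Rightarrow> complex" where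
  "det_rhs N z = of_nat N ^ N / D0 N ^ N * omega_pow N (of_nat N * (of_nat N - 1) * z / 2)
     * exp (- (Li2 (exp2pi z) / (2 * of_real pi * \<i>) + z * Ln (1 - exp2pi z)))"

text \<open>Weighting the k-th factor by v^k expresses all of them through S_0, at a total cost of
  v^M with M = N (N - 1) / 2. The product of the q-Pochhammer symbols times P is v^(2 M), so one v^M
  survives and is the omega-power in the result.\<close>

lemma eigenvalue_product_strip:
  assumes N: "N \<ge> 1" and z: "- 1 < Re z" "Re z < 0"
  shows "(\<Prod>k<N. qdl_dft N (omega_pow N 1 ^ k * cut_root N z) z) = det_rhs N z"
proof -
  interpret primitive_root_of_unity N "omega_pow N 1" using N by (rule omega_pow_1_primitive)
  define w where "w = omega_pow N 1"
  define v where "v = omega_pow N z"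
  define u where "u = cut_root N z"
  define x where "x = exp2pi z"
  define M where "M = (\<Sum>k<N. k)"
  have M2: "2 * M = N * (N - 1)" unfolding M_def by (rule two_sum_lessThan)
  have nint: "Re z \<notin> \<int>" using z not_Ints_between[of "- 1" "Re z"] by simp
  have x1: "x \<noteq> 1" unfolding x_def by (rule Re_not_int_imp[OF nint])
  have uN: "u ^ N = 1 - x" unfolding u_def x_def using N x1 by (intro cut_root_power) (auto simp: x_def)
  have uN1: "u ^ N \<noteq> 1" using uN by (simp add: x_def)
  have v0: "v \<noteq> 0" by (simp add: v_def omega_pow_def)
  have vN: "v ^ N = x" using N by (simp add: v_def omega_pow_power omega_pow_N x_def)
  define P where "P = (\<Prod>i<N. (1 - w ^ i * u) ^ i)"
  have "(\<Prod>i<N. 1 - w ^ i * u) \<noteq> 0" unfolding w_def prod_one_minus using uN1 by simp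
  then have P0: "P \<noteq> 0" unfolding P_def prod_zero_iff[OF finite_lessThan] by auto
  have "v ^ M * (\<Prod>k<N. qdl_dft N (w ^ k * u) z) = (\<Prod>k<N. v ^ k * qdl_dft N (w ^ k * u) z)"
    by (simp add: M_def power_sum prod.distrib)
  also have "\<dots> = (\<Prod>k<N. qpoch k u * qdl_dft N u z)"
    by (rule prod.cong[OF refl]) (use qdl_dft_qpoch[OF N z] uN in \<open>simp add: w_def v_def x_def\<close>)
  also have "\<dots> = (\<Prod>k<N. qpoch k u) * qdl_dft N u z ^ N" by (simp add: prod.distrib)
  finally have 1: "v ^ M * (\<Prod>k<N. qdl_dft N (w ^ k * u) z) = (\<Prod>k<N. qpoch k u) * qdl_dft N u z ^ N" .
  have "(\<Prod>k<N. qpoch k u) * P = (v ^ N) ^ (N - 1)"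
    using prod_qpoch_N[OF uN1] by (simp add: P_def w_def uN vN)
  also have "\<dots> = v ^ M * v ^ M" using M2 by (simp flip: power_mult power_add mult_2)
  finally have 2: "(\<Prod>k<N. qpoch k u) * P = v ^ M * v ^ M" .
  have "v ^ M * ((\<Prod>k<N. qdl_dft N (w ^ k * u) z) * P) = v ^ M * (v ^ M * qdl_dft N u z ^ N)"
    using 1 2 by (metis mult.assoc mult.commute)
  then have 3: "(\<Prod>k<N. qdl_dft N (w ^ k * u) z) = v ^ M * (qdl_dft N u z ^ N * inverse P)"
    using v0 P0 by (simp add: field_simps)
  define Y where "Y = Li2 x / (2 * of_real pi * \<i>) + z * Ln (1 - x)"
  have "qdl_dft N u z ^ N * inverse P * exp Y = of_nat N ^ N / D0 N ^ N"
    using qdl_dft_strip[OF N z] by (simp add: u_def P_def w_def Y_def x_def)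
  moreover have "A = A * exp Y * exp (- Y)" for A by (simp add: mult.assoc flip: exp_add)
  ultimately have "qdl_dft N u z ^ N * inverse P = of_nat N ^ N / D0 N ^ N * exp (- Y)" by metis
  moreover have "v ^ M = omega_pow N (of_nat N * (of_nat N - 1) * z / 2)"
  proof -
    have "2 * (of_nat M :: complex) = of_nat (N * (N - 1))" using M2 by (metis of_nat_mult of_nat_numeral)
    then have "of_nat M = of_nat N * (of_nat N - 1) / (2::complex)" using N by (simp add: of_nat_diff field_simps)
    then show ?thesis unfolding v_def omega_pow_power by (simp only:) simp
  qed
  ultimately show ?thesis using 3 by (simp add: det_rhs_def Y_def x_def u_def w_def)
qed

text \<open>The formula extends to \<open>Re z = 0\<close> by letting \<open>z\<close> approach from the left, the side on which the
  principal branches are continuous.\<close>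
lemma eigenvalue_product_boundary:
  assumes N: "N \<ge> 1" and z: "- 1 < Re z" "Re z \<le> 0" "z \<noteq> 0"
  shows "(\<Prod>k<N. qdl_dft N (omega_pow N 1 ^ k * cut_root N z) z) = det_rhs N z"
proof (cases "Re z < 0")
  case True
  then show ?thesis using eigenvalue_product_strip[OF N z(1)] by simp
next
  case False
  then have Re0: "Re z = 0" using z by simp
  then have Im0: "Im z \<noteq> 0" using z by (auto simp: complex_eq_iff)
  \<comment> \<open>On Re z = 0 the number x is a positive real r, beyond 1 if Im z < 0. Moving z to
    the left by \<delta> turns x clockwise by the angle 2 pi \<delta>, and \<delta> < 1/2 keeps it
    in the lower half plane.\<close>
  define \<delta> where "\<delta> n = 1 / (2 * (real n + 2))" for n
  define Z where "Z n = z - of_real (\<delta> n)" for n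
  define r where "r = exp (- 2 * pi * Im z)"
  define \<theta> where "\<theta> n = 2 * pi * \<delta> n" for n
  have \<delta>: "0 < \<delta> n" "\<delta> n < 1 / 2" for n by (auto simp: \<delta>_def field_simps)
  have \<delta>lim: "\<delta> \<longlonglongrightarrow> 0" unfolding \<delta>_def[abs_def] by real_asymp
  have Zlim: "Z \<longlonglongrightarrow> z"
  proof -
    have "(\<lambda>n. z - of_real (\<delta> n)) \<longlonglongrightarrow> z - of_real 0" by (intro tendsto_intros \<delta>lim)
    then show ?thesis by (simp add: Z_def[abs_def])
  qed
  have r: "r > 0" "r \<noteq> 1" using Im0 by (auto simp: r_def)
  have xz: "exp2pi z = of_real r"
    using Re0 by (simp add: exp_eq_polar r_def)
  have xZ: "exp2pi (Z n) = of_real r * cis (- \<theta> n)" for n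
    using Re0 by (simp add: exp_eq_polar r_def Z_def \<theta>_def)
  have \<theta>: "0 < \<theta> n \<and> \<theta> n < pi" for n using \<delta>[of n] by (auto simp: \<theta>_def)
  have \<theta>lim: "\<theta> \<longlonglongrightarrow> 0"
  proof -
    have "(\<lambda>n. 2 * pi * \<delta> n) \<longlonglongrightarrow> 2 * pi * 0" by (intro tendsto_intros \<delta>lim)
    then show ?thesis by (simp add: \<theta>_def[abs_def])
  qed
  note below = Li2_tendsto_from_below[OF r \<theta> \<theta>lim, folded xz xZ]
  have ulim: "(\<lambda>n. cut_root N (Z n)) \<longlonglongrightarrow> cut_root N z"
    unfolding cut_root_def using N by (intro tendsto_intros below(2)) auto
  have "(\<lambda>n. \<Prod>k<N. qdl_dft N (omega_pow N 1 ^ k * cut_root N (Z n)) (Z n)) \<longlonglongrightarrow>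
      (\<Prod>k<N. qdl_dft N (omega_pow N 1 ^ k * cut_root N z) z)"
    unfolding qdl_dft_def
  proof (intro tendsto_prod tendsto_sum tendsto_mult tendsto_power tendsto_const ulim)
    fix m assume "m \<in> {..<N}"
    then have "isCont (qdl N) (z + of_nat m)"
      using z by (intro DERIV_isCont[OF qdl_has_field_derivative[OF N]]) auto
    moreover have "(\<lambda>n. Z n + of_nat m) \<longlonglongrightarrow> z + of_nat m" by (intro tendsto_intros Zlim)
    ultimately show "(\<lambda>n. qdl N (Z n + of_nat m)) \<longlonglongrightarrow> qdl N (z + of_nat m)" by (rule isCont_tendsto_compose)
  qed
  moreover have "(\<Prod>k<N. qdl_dft N (omega_pow N 1 ^ k * cut_root N (Z n)) (Z n)) = det_rhs N (Z n)" for n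
    using \<delta>[of n] Re0 by (intro eigenvalue_product_strip N) (auto simp: Z_def)
  moreover have "(\<lambda>n. det_rhs N (Z n)) \<longlonglongrightarrow> det_rhs N z"
    unfolding det_rhs_def
  proof (intro tendsto_mult tendsto_const tendsto_exp tendsto_minus tendsto_add tendsto_divide below Zlim)
    show "(\<lambda>n. omega_pow N (of_nat N * (of_nat N - 1) * Z n / 2)) \<longlonglongrightarrow> omega_pow N (of_nat N * (of_nat N - 1) * z / 2)"
      unfolding omega_pow_def using N by (intro tendsto_intros Zlim) auto
  qed auto
  ultimately show ?thesis using LIMSEQ_unique by simp
qed

section \<open>Periodicity\<close>

definition Lambda_dft :: "nat \<Rightarrow> complex \<Rightarrow> complex \<Rightarrow> complex" where
  "Lambda_dft N y z = (\<Sum>n<N. y ^ n * Lambda N (z + of_nat n))"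

text \<open>An index shift by one; the end terms n = 0 and n = N match by
  \<open>Lambda_shift_N\<close> because y^N = 1 - x.\<close>

lemma Lambda_dft_shift:
  assumes N: "N \<ge> 1" and x: "exp2pi z \<noteq> 1" and y: "y ^ N = 1 - exp2pi z"
  shows "y * Lambda_dft N y (z + 1) = Lambda_dft N y z"
proof -
  have "(\<Sum>n<Suc N. y ^ n * Lambda N (z + of_nat n)) = Lambda N z + (\<Sum>n<N. y ^ Suc n * Lambda N (z + of_nat (Suc n)))"
    by (subst sum.lessThan_Suc_shift) simp
  moreover have "(\<Sum>n<Suc N. y ^ n * Lambda N (z + of_nat n)) = Lambda_dft N y z + y ^ N * Lambda N (z + of_nat N)"
    by (simp add: Lambda_dft_def)
  moreover have "y ^ N * Lambda N (z + of_nat N) = Lambda N z"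
    using Lambda_shift_N[OF N x] by (simp add: y)
  moreover have "(\<Sum>n<N. y ^ Suc n * Lambda N (z + of_nat (Suc n))) = y * Lambda_dft N y (z + 1)"
    by (simp add: Lambda_dft_def sum_distrib_left mult_ac add_ac)
  ultimately show ?thesis by simp
qed

definition det_formula :: "nat \<Rightarrow> complex \<Rightarrow> bool" where
  "det_formula N z \<longleftrightarrow> (\<forall>u. u ^ N = 1 - exp2pi z \<longrightarrow>
     (\<Prod>k<N. Lambda_dft N (omega_pow N 1 ^ k * u) z) = det_rhs N z)"

text \<open>Multiplication by w permutes the factors cyclically, w^N = 1 closing the cycle.\<close>

lemma (in primitive_root_of_unity) prod_rotate:
  fixes f :: "complex \<Rightarrow> complex"
  shows "(\<Prod>k<N. f (w ^ k * (w ^ i * u))) = (\<Prod>k<N. f (w ^ k * u))"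
proof (induction i)
  case (Suc i)
  obtain M where M: "N = Suc M" using N_pos by (cases N) auto
  have s: "(\<Prod>k<N. f (w ^ k * (w * u))) = (\<Prod>k<N. f (w ^ k * u))" for u
  proof -
    have a: "w ^ k * (w * u) = w ^ Suc k * u" for k by (simp add: mult_ac)
    have "(\<Prod>k<Suc M. f (w ^ Suc k * u)) = (\<Prod>k<M. f (w ^ Suc k * u)) * f (w ^ N * u)"
      unfolding M by (rule prod.lessThan_Suc)
    also have "\<dots> = f (w ^ 0 * u) * (\<Prod>k<M. f (w ^ Suc k * u))" by (simp add: power_N mult.commute)
    also have "\<dots> = (\<Prod>k<Suc M. f (w ^ k * u))" by (rule prod.lessThan_Suc_shift[symmetric])
    finally show ?thesis unfolding a M .
  qed
  have "(\<Prod>k<N. f (w ^ k * (w ^ Suc i * u))) = (\<Prod>k<N. f (w ^ k * (w * (w ^ i * u))))" by (simp add: mult_ac)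
  then show ?case using s Suc by simp
qed simp

text \<open>At u' / u the product in \<open>prod_one_minus\<close> vanishes, hence so does one of
  its factors.\<close>

lemma (in primitive_root_of_unity) roots_differ_by_power:
  assumes "u ^ N = u' ^ N" "u' \<noteq> 0"
  obtains i where "u = w ^ i * u'"
proof -
  have "u \<noteq> 0" using assms N_pos by (auto simp: power_0_left)
  have "(\<Prod>i<N. 1 - w ^ i * (u' / u)) = 0"
    unfolding prod_one_minus using assms \<open>u \<noteq> 0\<close> by (simp add: power_divide)
  then obtain i where "1 - w ^ i * (u' / u) = 0" by (auto simp: prod_zero_iff)
  then have "u = w ^ i * u'" using \<open>u \<noteq> 0\<close> by (simp add: field_simps)
  then show thesis by (rule that)
qed

lemma det_formula_base:
  assumes N: "N \<ge> 1" and z: "- 1 < Re z" "Re z \<le> 0" "z \<noteq> 0"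
  shows "det_formula N z"
  unfolding det_formula_def
proof (intro allI impI)
  interpret primitive_root_of_unity N "omega_pow N 1" using N by (rule omega_pow_1_primitive)
  fix u assume u: "u ^ N = 1 - exp2pi z"
  have x: "exp2pi z \<noteq> 1"
  proof
    assume "exp2pi z = 1"
    then obtain n :: int where n: "z = of_int n" unfolding exp_2pi_i_eq_1_iff by (elim Ints_cases)
    then have "- 1 < real_of_int n" "real_of_int n \<le> 0" using z by auto
    then have "n = 0" by linarith
    then show False using n z by simp
  qed
  have "cut_root N z \<noteq> 0" by (simp add: cut_root_def)
  then obtain i where i: "u = omega_pow N 1 ^ i * cut_root N z"
    using roots_differ_by_power[of u "cut_root N z"] u cut_root_power[OF N x] by auto
  have "Lambda_dft N y z = qdl_dft N y z" for y
    unfolding Lambda_dft_def qdl_dft_def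
    by (intro sum.cong refl arg_cong2[where f = "(*)"] Lambda_strip N) (use z in auto)
  then show "(\<Prod>k<N. Lambda_dft N (omega_pow N 1 ^ k * u) z) = det_rhs N z"
    unfolding i prod_rotate[where f = "\<lambda>y. Lambda_dft N y z"] using eigenvalue_product_boundary[OF N z] by simp
qed

text \<open>Passing back from z + 1 to z multiplies both sides by the same nonzero factor w^M u^N
  with M = N (N - 1) / 2: the eigenvalue product by \<open>Lambda_dft_shift\<close>, the right side
  because z + 1 adds one Ln (1 - x) in the exponent and one w^M in the omega-power. Since w^(2 M) =
  1, w^M is its own inverse.\<close>

lemma det_formula_shift:
  assumes N: "N \<ge> 1" and x: "exp2pi z \<noteq> 1"
  shows "det_formula N (z + 1) \<longleftrightarrow> det_formula N z"
proof -
  interpret primitive_root_of_unity N "omega_pow N 1" using N by (rule omega_pow_1_primitive)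
  define w where "w = omega_pow N 1"
  define M where "M = (\<Sum>k<N. k)"
  have M2: "2 * M = N * (N - 1)" unfolding M_def by (rule two_sum_lessThan)
  have w0: "w \<noteq> 0" using w_nonzero by (simp add: w_def)
  have wM: "w ^ M * w ^ M = 1"
  proof -
    have "w ^ M * w ^ M = (w ^ N) ^ (N - 1)" using M2 by (simp flip: power_mult power_add mult_2)
    then show ?thesis using power_N by (simp add: w_def)
  qed
  have x': "exp2pi (z + 1) = exp2pi z"
    by (simp add: distrib_left exp_add exp_two_pi_i)
  have P: "w ^ M * u ^ N * (\<Prod>k<N. Lambda_dft N (w ^ k * u) (z + 1)) = (\<Prod>k<N. Lambda_dft N (w ^ k * u) z)"
    if u: "u ^ N = 1 - exp2pi z" for u
  proof -
    have "w ^ M * u ^ N * (\<Prod>k<N. Lambda_dft N (w ^ k * u) (z + 1)) = (\<Prod>k<N. w ^ k * u * Lambda_dft N (w ^ k * u) (z + 1))"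
      by (simp add: M_def power_sum prod.distrib)
    also have "\<dots> = (\<Prod>k<N. Lambda_dft N (w ^ k * u) z)"
    proof (rule prod.cong[OF refl])
      fix k
      have "(w ^ k) ^ N = 1" unfolding w_def by (metis mult.commute power_N power_mult power_one)
      then have "(w ^ k * u) ^ N = 1 - exp2pi z" using u by (simp add: power_mult_distrib)
      then show "w ^ k * u * Lambda_dft N (w ^ k * u) (z + 1) = Lambda_dft N (w ^ k * u) z"
        by (rule Lambda_dft_shift[OF N x])
    qed
    finally show ?thesis .
  qed
  have R: "det_rhs N (z + 1) * (1 - exp2pi z) = w ^ M * det_rhs N z"
  proof -
    define L where "L = Ln (1 - exp2pi z)"
    define A where "A = Li2 (exp2pi z) / (2 * of_real pi * \<i>)"
    have eL: "1 - exp2pi z = exp L" using x by (simp add: L_def)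
    have "2 * (of_nat M :: complex) = of_nat (N * (N - 1))" using M2 by (metis of_nat_mult of_nat_numeral)
    then have M': "of_nat M = of_nat N * (of_nat N - 1) / (2::complex)" using N by (simp add: of_nat_diff field_simps)
    have "a * (z + 1) / 2 = a / 2 * z + a / 2 * 1" for a by (simp add: distrib_left add_divide_distrib)
    then have "of_nat N * (of_nat N - 1) * (z + 1) / 2 = of_nat M * z + of_nat M * 1"
      unfolding M' .
    then have "omega_pow N (of_nat N * (of_nat N - 1) * (z + 1) / 2) = omega_pow N (of_nat M * z + of_nat M * 1)"
      by (simp only:)
    also have "\<dots> = omega_pow N (of_nat M * z) * w ^ M" unfolding omega_pow_add w_def omega_pow_power ..
    also have "of_nat M * z = of_nat N * (of_nat N - 1) * z / 2" unfolding M' by simp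
    finally have o: "omega_pow N (of_nat N * (of_nat N - 1) * (z + 1) / 2) = omega_pow N (of_nat N * (of_nat N - 1) * z / 2) * w ^ M" .
    have "- (A + (z + 1) * L) = - (A + z * L) + - L" by (simp add: algebra_simps)
    then have e: "exp (- (A + (z + 1) * L)) * exp L = exp (- (A + z * L))" by (simp only: exp_add mult.assoc) (simp flip: exp_add)
    define O' where "O' = omega_pow N (of_nat N * (of_nat N - 1) * z / 2)"
    have d1: "det_rhs N (z + 1) = of_nat N ^ N / D0 N ^ N * (O' * w ^ M) * exp (- (A + (z + 1) * L))"
      by (simp only: det_rhs_def x' o A_def L_def O'_def)
    have d0: "det_rhs N z = of_nat N ^ N / D0 N ^ N * O' * exp (- (A + z * L))"
      by (simp only: det_rhs_def A_def L_def O'_def)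
    have "det_rhs N (z + 1) * exp L = of_nat N ^ N / D0 N ^ N * (O' * w ^ M) * (exp (- (A + (z + 1) * L)) * exp L)"
      unfolding d1 by (simp only: mult.assoc)
    also have "\<dots> = w ^ M * det_rhs N z" unfolding e d0 by (simp only: mult_ac)
    finally show ?thesis unfolding eL .
  qed
  have R': "w ^ M * u ^ N * det_rhs N (z + 1) = det_rhs N z" if "u ^ N = 1 - exp2pi z" for u
  proof -
    have "w ^ M * u ^ N * det_rhs N (z + 1) = w ^ M * (det_rhs N (z + 1) * (1 - exp2pi z))"
      unfolding that by (simp only: mult_ac)
    also have "\<dots> = det_rhs N z" unfolding R by (simp only: mult.assoc[symmetric] wM mult_1)
    finally show ?thesis .
  qed
  have "(\<Prod>k<N. Lambda_dft N (w ^ k * u) (z + 1)) = det_rhs N (z + 1) \<longleftrightarrow> (\<Prod>k<N. Lambda_dft N (w ^ k * u) z) = det_rhs N z"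
    if u: "u ^ N = 1 - exp2pi z" for u
  proof -
    have "w ^ M * u ^ N \<noteq> 0" using w0 u x by simp
    then show ?thesis using P[OF u] R'[OF u] by (metis mult_left_cancel)
  qed
  then show ?thesis unfolding det_formula_def x' w_def by blast
qed

lemma det_formula_all:
  assumes N: "N \<ge> 1" and x: "exp2pi z \<noteq> 1"
  shows "det_formula N z"
proof -
  have per: "exp2pi (y + of_int k) = exp2pi y" for y and k :: int
  proof -
    have "exp2pi (of_int k) = 1" unfolding exp_2pi_i_eq_1_iff by simp
    then show ?thesis by (simp add: distrib_left exp_add)
  qed
  have shift: "det_formula N (y + of_int k) \<longleftrightarrow> det_formula N y" if y: "exp2pi y \<noteq> 1" for y k
  proof (induction k rule: int_induct[where k = 0])
    case (step1 i)
    have "det_formula N (y + of_int i + 1) \<longleftrightarrow> det_formula N (y + of_int i)"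
      by (rule det_formula_shift[OF N]) (use per y in simp)
    then show ?case using step1 by (simp add: add_ac)
  next
    case (step2 i)
    have "det_formula N (y + of_int (i - 1) + 1) \<longleftrightarrow> det_formula N (y + of_int (i - 1))"
      by (rule det_formula_shift[OF N]) (simp only: per y not_False_eq_True)
    then show ?case using step2 by (simp add: add_ac)
  qed simp
  \<comment> \<open>The ceiling, unlike the floor, gives -1 < Re y <= 0, the range of
    \<open>det_formula_base\<close>.\<close>
  define y where "y = z - of_int \<lceil>Re z\<rceil>"
  have z: "z = y + of_int \<lceil>Re z\<rceil>" by (simp add: y_def)
  have "exp2pi y \<noteq> 1" using x per[of y "\<lceil>Re z\<rceil>"] z by metis
  moreover have "- 1 < Re y" "Re y \<le> 0" unfolding y_def by (simp_all, linarith)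
  moreover have "y \<noteq> 0" using \<open>exp2pi y \<noteq> 1\<close> by auto
  ultimately show ?thesis using shift det_formula_base[OF N] z by metis
qed

theorem theoremA6:
  fixes N :: nat and z0 z1 :: complex
  assumes "N \<ge> 2"
    and "exp (2 * of_real pi * \<i> * z1) = 1 / (1 - exp (2 * of_real pi * \<i> * z0))"
    and "\<forall>k::int. \<bar>k\<bar> < int N \<longrightarrow> \<not> is_pole (Lambda N) (z0 + of_int k)"
  shows "det (mat N N (\<lambda>(i, j). Lambda3 N z0 z1 (int i - int j)))
     = of_nat N ^ N / D0 N ^ N
       * omega_pow N (of_nat N * (of_nat N - 1) * z0 / 2)
       * exp (- calL z0 z1 / (2 * of_real pi * \<i>))"
proof -
  have N: "N \<ge> 1" using assms(1) by simp
  interpret primitive_root_of_unity N "omega_pow N 1" using N by (rule omega_pow_1_primitive)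
  define w where "w = omega_pow N 1"
  define x where "x = exp (2 * of_real pi * \<i> * z0)"
  \<comment> \<open>The root of 1 - x contained in the matrix entries: u^N = exp (- 2 pi i z1),
    which the constraint between z0 and z1 makes equal to 1 - x.\<close>
  define u where "u = omega_pow N (- z1)"
  define c where "c = omega_pow N (- z0 * z1 / 2)"
  \<comment> \<open>For x = 1 the constraint would read exp (2 pi i z1) = 1 / 0, which is 0 in HOL
    and not a value of exp.\<close>
  have x1: "x \<noteq> 1"
  proof
    assume "x = 1"
    then have "exp (2 * of_real pi * \<i> * z1) = 0" using assms(2) by (simp add: x_def)
    then show False by simp
  qed
  have e1: "exp (- (2 * of_real pi * \<i> * z1)) = 1 - x" unfolding exp_minus assms(2) x_def by simp
  have u: "u ^ N = 1 - x"
    unfolding u_def omega_pow_power omega_pow_N[OF N] using e1 by simp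
  have a: "Lambda3 N z0 z1 (int n) = c * (u ^ n * Lambda N (z0 + of_nat n))" for n
  proof -
    have "- of_int (int n) * z1 = of_nat n * (- z1)" by simp
    then show ?thesis unfolding Lambda3_def c_def u_def omega_pow_power by (simp add: mult.assoc)
  qed
  \<comment> \<open>Adding N to n produces 1 - x from omega^(- N z1), which cancels the factor 1 /
    (1 - x) of \<open>Lambda_shift_N\<close>. The constraint is what makes the matrix
    circulant.\<close>
  have per: "Lambda3 N z0 z1 (n + int N) = Lambda3 N z0 z1 n" for n
  proof -
    have "exp2pi (of_int n) = 1" unfolding exp_2pi_i_eq_1_iff by simp
    then have xn: "exp2pi (z0 + of_int n) = x" by (simp add: distrib_left exp_add x_def)
    have "- of_int (n + int N) * z1 = - of_int n * z1 + of_nat N * (- z1)" by (simp add: algebra_simps)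
    then have "omega_pow N (- of_int (n + int N) * z1) = omega_pow N (- of_int n * z1) * (1 - x)"
      using u by (simp only: omega_pow_add u_def omega_pow_power)
    moreover have "(1 - x) * Lambda N (z0 + of_int n + of_nat N) = Lambda N (z0 + of_int n)"
      using Lambda_shift_N[OF N, of "z0 + of_int n"] x1 unfolding xn by simp
    moreover have "z0 + of_int (n + int N) = z0 + of_int n + of_nat N" by simp
    ultimately show ?thesis unfolding Lambda3_def by (metis mult.assoc)
  qed
  have "det (mat N N (\<lambda>(i, j). Lambda3 N z0 z1 (int i - int j)))
      = (\<Prod>k<N. \<Sum>n<N. w ^ (k * n) * Lambda3 N z0 z1 (int n))"
    unfolding w_def by (rule det_circulant[where a = "Lambda3 N z0 z1", OF per])
  also have "\<dots> = (\<Prod>k<N. c * Lambda_dft N (w ^ k * u) z0)"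
    unfolding a Lambda_dft_def sum_distrib_left
    by (intro prod.cong sum.cong refl) (simp add: power_mult_distrib mult_ac flip: power_mult)
  also have "\<dots> = c ^ N * (\<Prod>k<N. Lambda_dft N (w ^ k * u) z0)" by (simp add: prod.distrib)
  also have "(\<Prod>k<N. Lambda_dft N (w ^ k * u) z0) = det_rhs N z0"
    using det_formula_all[OF N, of z0] x1 u unfolding det_formula_def w_def x_def by blast
  also have "c ^ N * det_rhs N z0 = of_nat N ^ N / D0 N ^ N * omega_pow N (of_nat N * (of_nat N - 1) * z0 / 2)
     * (c ^ N * exp (- (Li2 x / (2 * of_real pi * \<i>) + z0 * Ln (1 - x))))"
    unfolding det_rhs_def x_def by (simp only: mult_ac)
  \<comment> \<open>The common prefactor of the entries contributes c^N = exp (- pi i z0 z1), the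
    quadratic term of \<open>calL\<close> missing from \<open>det_rhs\<close>.\<close>
  also have "c ^ N * exp (- (Li2 x / (2 * of_real pi * \<i>) + z0 * Ln (1 - x))) = exp (- calL z0 z1 / (2 * of_real pi * \<i>))"
  proof -
    have "c ^ N = exp2pi (- z0 * z1 / 2)"
      unfolding c_def omega_pow_power omega_pow_N[OF N] ..
    moreover have "2 * of_real pi * \<i> * (- z0 * z1 / 2) + - (Li2 x / (2 * of_real pi * \<i>) + z0 * Ln (1 - x)) = - calL z0 z1 / (2 * of_real pi * \<i>)"
    proof -
      have "y * (- z0 * z1 / 2) + - (B / y + z0 * L) = - (B + y\<^sup>2 / 2 * z0 * z1 + y * z0 * L) / y" if "y \<noteq> 0" for y B L :: complex
        using that by (simp add: field_simps power2_eq_square)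
      from this[of "2 * of_real pi * \<i>"] show ?thesis by (simp add: calL_def x_def)
    qed
    ultimately show ?thesis by (simp only: exp_add[symmetric])
  qed
  finally show ?thesis .
qed

end
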